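(* Let $U$ be a connected 2-dimensional manifold and let $\kappa : J^n(U,LG(2,4)) \to \mathbb{R}$ be an $n$-th order $CSp(4,\mathbb{R})$-invariant. Then $\kappa$ induces a contact-invariant function $\mathsf{K} : \mathbb{J}^n \to \mathbb{R}$, namely $\mathsf{K}(j^n_x s) = \kappa(j^n_x(\tilde\psi_{\mathsf b}\circ s))$ for local maps $s: U\to J^2|_\xi$ and any conformal symplectic basis $\mathsf b$ of $C_\xi$; that is, $\mathsf{K}\circ\Phi^{(n)} = \mathsf{K}$ for every (local) contact transformation $\tilde\phi$ of $J^2$. In particular, for any constant $c\in\mathbb{R}$, the condition $\mathsf{K}=c$ defines a contact-invariant class of PDE.
   Context: $LG(2,4)$ is the manifold of 2-dimensional isotropic subspaces of $\mathbb{R}^4$ with the standard symplectic form represented by $J=\begin{pmatrix}0&I_2\\-I_2&0\end{pmatrix}$, and $CSp(4,\mathbb{R})=\{X\in GL(4,\mathbb{R}): X^TJX=\rho J \text{ for some }\rho\in\mathbb{R}^\times\}$ acts on it. $J^n(U,LG(2,4))$ is the space of $n$-jets of local maps $U\to LG(2,4)$, on which $g\in CSp(4,\mathbb{R})$ acts by prolongation $g^{(n)}\cdot j^n_x s=j^n_x(g\cdot s)$. An $n$-th order $CSp(4,\mathbb{R})$-invariant is a function $\kappa:J^n(U,LG(2,4))\to\mathbb{R}$ with $\kappa(g^{(n)}\cdot \mathbf{p})=\kappa(\mathbf p)$ for all $g,\mathbf p$. $J^1=J^1(\mathbb{R}^2,\mathbb{R})$ is the first jet space, with local coordinates $(x,y,z,p,q)$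 and contact distribution $C=\{\sigma=0\}$ of rank 4, $\sigma=dz-p\,dx-q\,dy$; $\eta=d\sigma$ restricts to a symplectic form on each $C_\xi$, well defined up to scale. $J^2=J^2(\mathbb{R}^2,\mathbb{R})$ is the bundle $\pi^2_1:J^2\to J^1$ whose fibre over $\xi$ is $J^2|_\xi=LG(C_\xi,[\eta])$, the set of Lagrangian (2-dimensional isotropic) subspaces of $C_\xi$; it carries the canonical system $\tilde C_{\tilde\xi}=((\pi^2_1)_* )^{-1}(\tilde\xi)$. A contact transformation of $J^1$ (resp. $J^2$) is a (local) diffeomorphism preserving $C$ (resp. $\tilde C$). Every contact transformation $\tilde\phi$ of $J^2$ is the prolongation of a contact transformation $\phi$ of $J^1$ (it acts on Lagrangian subspaces by $\phi_*$), so it maps $J^2|_\xi$ to $J^2|_{\phi(\xi)}$. A conformal symplectic basis of $(C_\xi,[\eta])$ is a basis $\mathsf b=\{e_i\}_{i=1}^4$ for which $(\eta(e_i,e_j))$ is a multiple of $J$; mapping $\mathsf b$ to the standard basis of $\mathbb{R}^4$ induces $\tilde\psi_{\mathsf b}:J^2|_\xi\to LG(2,4)$. $\mathbb{J}^n=\dot\bigcup_{\xi\in J^1}J^n(U,J^2|_\xi)$, and a contact transformation $\tilde\phi$ of $J^2$ induces $\Phi^{(n)}:\mathbb{J}^n\to\mathbb{J}^n$, $\Phi^{(n)}(j^n_xs)=j^n_x(\tilde\phi\circ s)$. A function $\mathsf K$ on $\mathbb{J}^n$ is contact-invariant if $\mathsf K\circ\Phi^{(n)}=\mathsf K$ for all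 contact transformations $\tilde\phi$ of $J^2$. A (second order scalar) PDE in the plane is a hypersurface $\Sigma\subset J^2$ transverse to $\pi^2_1$ with $\pi^2_1|_\Sigma$ a submersion onto $J^1$, so each $\Sigma|_\xi=\Sigma\cap J^2|_\xi$ is a surface; the condition $\mathsf K=c$ is imposed on the jets of parametrizations $s$ of the surfaces $\Sigma|_\xi$. *)

theory Defs
  imports "HOL-Analysis.Analysis"
begin

section \<open>Smooth maps between open sets of Euclidean spaces\<close>

fun Ck_on :: "nat \<Rightarrow> 'a::euclidean_space set \<Rightarrow> ('a \<Rightarrow> 'b::euclidean_space) \<Rightarrow> bool" where
  "Ck_on 0 S f \<longleftrightarrow> continuous_on S f"
| "Ck_on (Suc k) S f \<longleftrightarrow> (\<forall>x\<in>S. f differentiable (at x)) \<and>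
     (\<forall>v. Ck_on k S (\<lambda>x. frechet_derivative f (at x) v))"

text \<open>Only used for open sets.\<close>
definition smooth_on :: "'a::euclidean_space set \<Rightarrow> ('a \<Rightarrow> 'b::euclidean_space) \<Rightarrow> bool" where
  "smooth_on S f \<longleftrightarrow> (\<forall>k. Ck_on k S f)"

text \<open>The iterated directional derivatives; with basis vectors as directions these are the
  partial derivatives of all orders.\<close>
fun dir_deriv :: "'a::euclidean_space list \<Rightarrow> ('a \<Rightarrow> 'b::euclidean_space) \<Rightarrow> 'a \<Rightarrow> 'b" where
  "dir_deriv [] f = f"
| "dir_deriv (v # vs) f = dir_deriv vs (\<lambda>x. frechet_derivative f (at x) v)"


section \<open>Manifolds given by atlases\<close>

text \<open>A chart is a domain together with a coordinate map into the model space; a manifold is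
  represented by an atlas, whose underlying set is the union of the chart domains.\<close>
type_synonym ('a, 'e) chart = "'a set \<times> ('a \<Rightarrow> 'e)"

definition carrier_of :: "('a, 'e) chart set \<Rightarrow> 'a set" where
  "carrier_of A = \<Union> (fst ` A)"

definition local_rep ::
  "('a, 'e) chart \<Rightarrow> ('b, 'f) chart \<Rightarrow> ('a \<Rightarrow> 'b) \<Rightarrow> 'e \<Rightarrow> 'f" where
  "local_rep c d f = snd d \<circ> f \<circ> inv_into (fst c) (snd c)"

definition smooth_atlas :: "('a, 'e::euclidean_space) chart set \<Rightarrow> bool" where
  "smooth_atlas A \<longleftrightarrow>
     (\<forall>c\<in>A. inj_on (snd c) (fst c) \<and> open (snd c ` fst c)) \<and>
     (\<forall>c\<in>A. \<forall>d\<in>A. open (snd c ` (fst c \<inter> fst d)) \<and>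
        smooth_on (snd c ` (fst c \<inter> fst d)) (local_rep c d id))"

text \<open>For a smooth atlas these sets do form a topology.\<close>
definition atlas_topology :: "('a, 'e::euclidean_space) chart set \<Rightarrow> 'a topology" where
  "atlas_topology A =
     topology (\<lambda>S. S \<subseteq> carrier_of A \<and> (\<forall>c\<in>A. open (snd c ` (S \<inter> fst c))))"

text \<open>The dimension of the manifold is the dimension of the model space \<open>'e\<close>.\<close>
definition is_manifold :: "('a, 'e::euclidean_space) chart set \<Rightarrow> bool" where
  "is_manifold A \<longleftrightarrow> smooth_atlas A \<and>
     Hausdorff_space (atlas_topology A) \<and> second_countable (atlas_topology A)"

definition smooth_map ::
  "('a, 'e::euclidean_space) chart set \<Rightarrow> ('b, 'f::euclidean_space) chart set \<Rightarrow>
   'a set \<Rightarrow> ('a \<Rightarrow> 'b) \<Rightarrow> bool" where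
  "smooth_map A B V f \<longleftrightarrow>
     (\<forall>x\<in>V. \<exists>c\<in>A. \<exists>d\<in>B. \<exists>W. openin (atlas_topology A) W \<and> x \<in> W \<and>
        W \<subseteq> V \<inter> fst c \<and> f ` W \<subseteq> fst d \<and> smooth_on (snd c ` W) (local_rep c d f))"

text \<open>The differential of \<open>f\<close> at \<open>x\<close>, expressed in the charts \<open>c\<close> and \<open>d\<close>.\<close>
definition chart_diff ::
  "('a, 'e::euclidean_space) chart \<Rightarrow> ('b, 'f::euclidean_space) chart \<Rightarrow>
   ('a \<Rightarrow> 'b) \<Rightarrow> 'a \<Rightarrow> 'e \<Rightarrow> 'f" where
  "chart_diff c d f x = frechet_derivative (local_rep c d f) (at (snd c x))"


section \<open>Jets\<close>

text \<open>A local map at \<open>x\<close> is represented by a total function that is smooth, with values in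
  the target manifold, on a neighbourhood of \<open>x\<close>; its values elsewhere are irrelevant.\<close>
definition local_map ::
  "('a, 'e::euclidean_space) chart set \<Rightarrow> ('b, 'f::euclidean_space) chart set \<Rightarrow>
   'a \<Rightarrow> ('a \<Rightarrow> 'b) \<Rightarrow> bool" where
  "local_map A B x s \<longleftrightarrow>
     (\<exists>V. openin (atlas_topology A) V \<and> x \<in> V \<and> smooth_map A B V s)"

definition same_jet ::
  "('a, 'e::euclidean_space) chart set \<Rightarrow> ('b, 'f::euclidean_space) chart set \<Rightarrow>
   nat \<Rightarrow> 'a \<Rightarrow> ('a \<Rightarrow> 'b) \<Rightarrow> ('a \<Rightarrow> 'b) \<Rightarrow> bool" where
  "same_jet A B n x s t \<longleftrightarrow> s x = t x \<and>
     (\<forall>c\<in>A. \<forall>d\<in>B. x \<in> fst c \<longrightarrow> s x \<in> fst d \<longrightarrow>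
        (\<forall>vs. length vs \<le> n \<longrightarrow>
           dir_deriv vs (local_rep c d s) (snd c x) = dir_deriv vs (local_rep c d t) (snd c x)))"

text \<open>The \<open>n\<close>-jet of \<open>s\<close> at \<open>x\<close>: the base point and the class of all local maps at \<open>x\<close>
  agreeing with \<open>s\<close> up to order \<open>n\<close>.\<close>
type_synonym ('a, 'b) jet = "'a \<times> ('a \<Rightarrow> 'b) set"

definition jet ::
  "('a, 'e::euclidean_space) chart set \<Rightarrow> ('b, 'f::euclidean_space) chart set \<Rightarrow>
   nat \<Rightarrow> 'a \<Rightarrow> ('a \<Rightarrow> 'b) \<Rightarrow> ('a, 'b) jet" where
  "jet A B n x s = (x, {t. local_map A B x t \<and> same_jet A B n x s t})"

definition jet_space ::
  "('a, 'e::euclidean_space) chart set \<Rightarrow> ('b, 'f::euclidean_space) chart set \<Rightarrow>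
   nat \<Rightarrow> ('a, 'b) jet set" where
  "jet_space A B n = {jet A B n x s | x s. local_map A B x s}"


section \<open>Lagrangian Grassmannians of four-dimensional conformal symplectic spaces\<close>

definition Jmat :: "real^4^4" where
  "Jmat = (\<chi> i j. if (i, j) \<in> {(1, 3), (2, 4)} then 1
                 else if (i, j) \<in> {(3, 1), (4, 2)} then -1 else 0)"

definition std_form :: "real^4 \<Rightarrow> real^4 \<Rightarrow> real" where
  "std_form u v = u \<bullet> (Jmat *v v)"

definition CSp4 :: "(real^4^4) set" where
  "CSp4 = {X. invertible X \<and> (\<exists>\<rho>. \<rho> \<noteq> 0 \<and> transpose X ** Jmat ** X = \<rho> *\<^sub>R Jmat)}"

definition LG :: "'v::euclidean_space set \<Rightarrow> ('v \<Rightarrow> 'v \<Rightarrow> real) \<Rightarrow> 'v set set" where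
  "LG V \<omega> = {L. subspace L \<and> L \<subseteq> V \<and> dim L = 2 \<and> (\<forall>u\<in>L. \<forall>v\<in>L. \<omega> u v = 0)}"

definition conf_sympl_basis ::
  "'v::euclidean_space set \<Rightarrow> ('v \<Rightarrow> 'v \<Rightarrow> real) \<Rightarrow> (4 \<Rightarrow> 'v) \<Rightarrow> bool" where
  "conf_sympl_basis V \<omega> b \<longleftrightarrow> inj b \<and> independent (range b) \<and> span (range b) = V \<and>
     (\<exists>\<rho>. \<forall>i j. \<omega> (b i) (b j) = \<rho> * Jmat $ i $ j)"

text \<open>The standard affine parametrization, by the symmetric matrices with entries
  \<open>m$1, m$2, m$3\<close>, of the Lagrangian planes transverse to \<open>span {b 3, b 4}\<close>.\<close>
definition lagr_plane :: "(4 \<Rightarrow> 'v::euclidean_space) \<Rightarrow> real^3 \<Rightarrow> 'v set" where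
  "lagr_plane b m = span {b 1 + m$1 *\<^sub>R b 3 + m$2 *\<^sub>R b 4, b 2 + m$2 *\<^sub>R b 3 + m$3 *\<^sub>R b 4}"

definition LG_atlas ::
  "'v::euclidean_space set \<Rightarrow> ('v \<Rightarrow> 'v \<Rightarrow> real) \<Rightarrow> ('v set, real^3) chart set" where
  "LG_atlas V \<omega> = {(range (lagr_plane b), inv (lagr_plane b)) | b. conf_sympl_basis V \<omega> b}"

abbreviation LG24_atlas :: "((real^4) set, real^3) chart set" where
  "LG24_atlas \<equiv> LG_atlas UNIV std_form"

definition CSp_invariant ::
  "('u, real^2) chart set \<Rightarrow> nat \<Rightarrow> (('u, (real^4) set) jet \<Rightarrow> real) \<Rightarrow> bool" where
  "CSp_invariant U n \<kappa> \<longleftrightarrow>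
     (\<forall>g\<in>CSp4. \<forall>x s. local_map U LG24_atlas x s \<longrightarrow>
        \<kappa> (jet U LG24_atlas n x (\<lambda>y. (*v) g ` s y)) = \<kappa> (jet U LG24_atlas n x s))"


section \<open>The jet spaces \<open>J\<^sup>1(\<real>\<^sup>2, \<real>)\<close> and \<open>J\<^sup>2(\<real>\<^sup>2, \<real>)\<close>\<close>

text \<open>\<open>J\<^sup>1(\<real>\<^sup>2, \<real>)\<close> in its global coordinates \<open>(x, y, z, p, q)\<close>; tangent vectors are
  written in the same coordinates.\<close>
type_synonym J1 = "real \<times> real \<times> real \<times> real \<times> real"

definition \<sigma> :: "J1 \<Rightarrow> J1 \<Rightarrow> real" where
  "\<sigma> = (\<lambda>(x, y, z, p, q) (dx, dy, dz, dp, dq). dz - p * dx - q * dy)"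

definition ext_deriv :: "('v::euclidean_space \<Rightarrow> 'v \<Rightarrow> real) \<Rightarrow> 'v \<Rightarrow> 'v \<Rightarrow> 'v \<Rightarrow> real" where
  "ext_deriv \<alpha> \<xi> v w =
     frechet_derivative (\<lambda>\<zeta>. \<alpha> \<zeta> w) (at \<xi>) v - frechet_derivative (\<lambda>\<zeta>. \<alpha> \<zeta> v) (at \<xi>) w"

definition contact_plane :: "J1 \<Rightarrow> J1 set" where
  "contact_plane \<xi> = {v. \<sigma> \<xi> v = 0}"

definition \<eta> :: "J1 \<Rightarrow> J1 \<Rightarrow> J1 \<Rightarrow> real" where
  "\<eta> = ext_deriv \<sigma>"

type_synonym J2 = "J1 \<times> J1 set"

definition J2_points :: "J2 set" where
  "J2_points = {(\<xi>, L). L \<in> LG (contact_plane \<xi>) (\<eta> \<xi>)}"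

text \<open>One bundle chart for every local smooth frame of \<open>C\<close> consisting of conformal symplectic
  bases.  The frame \<open>\<partial>\<^sub>x + p \<partial>\<^sub>z, \<partial>\<^sub>y + q \<partial>\<^sub>z, \<partial>\<^sub>p, \<partial>\<^sub>q\<close> gives the usual coordinates
  \<open>(x, y, z, p, q, r, s, t)\<close>.\<close>
definition J2_atlas :: "(J2, J1 \<times> (real^3)) chart set" where
  "J2_atlas =
     {({(\<xi>, L). \<xi> \<in> B \<and> L \<in> range (lagr_plane (b \<xi>))},
       \<lambda>(\<xi>, L). (\<xi>, inv (lagr_plane (b \<xi>)) L)) | B b.
      open B \<and> (\<forall>i. smooth_on B (\<lambda>\<xi>. b \<xi> i)) \<and>
      (\<forall>\<xi>\<in>B. conf_sympl_basis (contact_plane \<xi>) (\<eta> \<xi>) (b \<xi>))}"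

text \<open>The fibre of \<open>J\<^sup>2\<close> over \<open>\<xi>\<close>, a copy of the Lagrangian Grassmannian of \<open>C\<^sub>\<xi>\<close>.\<close>
definition fibre_atlas :: "J1 \<Rightarrow> (J2, real^3) chart set" where
  "fibre_atlas \<xi> =
     {({\<xi>} \<times> fst c, snd c \<circ> snd) | c. c \<in> LG_atlas (contact_plane \<xi>) (\<eta> \<xi>)}"

definition J1_chart :: "(J1, J1) chart" where
  "J1_chart = (UNIV, id)"

text \<open>The canonical system at the point \<open>P = (\<xi>, L)\<close>: the tangent vectors, given by their
  components in the chart \<open>c\<close>, which the differential of the projection \<open>fst\<close> maps into \<open>L\<close>.\<close>
definition canonical_system :: "(J2, J1 \<times> (real^3)) chart \<Rightarrow> J2 \<Rightarrow> (J1 \<times> (real^3)) set" where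
  "canonical_system c P = {v. chart_diff c J1_chart fst P v \<in> snd P}"

text \<open>A local contact transformation of \<open>J\<^sup>2\<close> with domain \<open>D\<close>: a diffeomorphism between the
  open sets \<open>D\<close> and \<open>\<phi> ` D\<close> preserving the canonical system.\<close>
definition contact_transformation :: "J2 set \<Rightarrow> (J2 \<Rightarrow> J2) \<Rightarrow> bool" where
  "contact_transformation D \<phi> \<longleftrightarrow>
     openin (atlas_topology J2_atlas) D \<and> openin (atlas_topology J2_atlas) (\<phi> ` D) \<and>
     inj_on \<phi> D \<and> smooth_map J2_atlas J2_atlas D \<phi> \<and>
     smooth_map J2_atlas J2_atlas (\<phi> ` D) (inv_into D \<phi>) \<and>
     (\<forall>P\<in>D. \<forall>c\<in>J2_atlas. \<forall>d\<in>J2_atlas. P \<in> fst c \<longrightarrow> \<phi> P \<in> fst d \<longrightarrow>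
        chart_diff c d \<phi> P ` canonical_system c P = canonical_system d (\<phi> P))"


section \<open>Contact-invariant functions\<close>

definition basis_coords :: "(4 \<Rightarrow> 'v::euclidean_space) \<Rightarrow> 'v \<Rightarrow> real^4" where
  "basis_coords b v = (\<chi> i. representation (range b) v (b i))"

definition psi :: "(4 \<Rightarrow> J1) \<Rightarrow> J2 \<Rightarrow> (real^4) set" where
  "psi b P = basis_coords b ` snd P"

text \<open>The fibrewise jets; the union is disjoint because a jet determines the value of its
  representatives at the base point, hence the fibre.\<close>
definition JJ :: "('u, real^2) chart set \<Rightarrow> nat \<Rightarrow> ('u, J2) jet set" where
  "JJ U n = (\<Union>\<xi>. jet_space U (fibre_atlas \<xi>) n)"

definition induced_by ::
  "('u, real^2) chart set \<Rightarrow> nat \<Rightarrow> (('u, (real^4) set) jet \<Rightarrow> real) \<Rightarrow>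
   (('u, J2) jet \<Rightarrow> real) \<Rightarrow> bool" where
  "induced_by U n \<kappa> K \<longleftrightarrow>
     (\<forall>\<xi> x s b. local_map U (fibre_atlas \<xi>) x s \<longrightarrow>
        conf_sympl_basis (contact_plane \<xi>) (\<eta> \<xi>) b \<longrightarrow>
        K (jet U (fibre_atlas \<xi>) n x s) = \<kappa> (jet U LG24_atlas n x (psi b \<circ> s)))"

text \<open>\<open>K \<circ> \<Phi> = K\<close> where \<open>\<Phi>\<close> is the map induced by \<open>\<phi>\<close> on fibrewise jets.  A local contact
  transformation need not map all of a fibre intersected with its domain into one fibre, but
  \<open>\<phi> \<circ> s\<close> is required to be a local map into the fibre containing \<open>\<phi> (s x)\<close>.\<close>
definition contact_invariant ::
  "('u, real^2) chart set \<Rightarrow> nat \<Rightarrow> (('u, J2) jet \<Rightarrow> real) \<Rightarrow> bool" where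
  "contact_invariant U n K \<longleftrightarrow>
     (\<forall>D \<phi>. contact_transformation D \<phi> \<longrightarrow>
        (\<forall>\<xi> x s. local_map U (fibre_atlas \<xi>) x s \<longrightarrow> s x \<in> D \<longrightarrow>
           local_map U (fibre_atlas (fst (\<phi> (s x)))) x (\<phi> \<circ> s) \<and>
           K (jet U (fibre_atlas (fst (\<phi> (s x)))) n x (\<phi> \<circ> s)) =
             K (jet U (fibre_atlas \<xi>) n x s)))"


section \<open>Partial differential equations\<close>

text \<open>\<open>F\<close> is a submersion defining \<open>\<Sigma>\<close> as a hypersurface near \<open>P\<close>, in the chart \<open>c\<close>; the
  tangent space of \<open>\<Sigma>\<close> at \<open>P\<close> is then the kernel of the derivative of \<open>F\<close>.\<close>
definition local_equation ::
  "('a, 'e::euclidean_space) chart \<Rightarrow> 'a set \<Rightarrow> 'a \<Rightarrow> ('e \<Rightarrow> real) \<Rightarrow> bool" where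
  "local_equation c \<Sigma> P F \<longleftrightarrow> P \<in> fst c \<and>
     (\<exists>W. open W \<and> snd c P \<in> W \<and> W \<subseteq> snd c ` fst c \<and> smooth_on W F \<and>
        (\<forall>w\<in>W. frechet_derivative F (at w) \<noteq> (\<lambda>_. 0)) \<and>
        snd c ` (\<Sigma> \<inter> fst c) \<inter> W = {w\<in>W. F w = 0})"

text \<open>The PDEs on all of \<open>J\<^sup>1\<close> are those over \<open>B = UNIV\<close>.  General \<open>B\<close> (automatically open)
  is needed for images under local contact transformations.\<close>
definition is_PDE_over :: "J1 set \<Rightarrow> J2 set \<Rightarrow> bool" where
  "is_PDE_over B \<Sigma> \<longleftrightarrow> \<Sigma> \<subseteq> J2_points \<and> fst ` \<Sigma> = B \<and>
     (\<forall>P\<in>\<Sigma>. \<exists>c\<in>J2_atlas. \<exists>F. local_equation c \<Sigma> P F \<and>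
        (let T = {v. frechet_derivative F (at (snd c P)) v = 0};
             dpi = chart_diff c J1_chart fst P
         in {u + v | u v. u \<in> T \<and> dpi v = 0} = UNIV \<and> dpi ` T = UNIV))"

text \<open>\<open>s\<close> parametrizes the surface \<open>\<Sigma>|\<^sub>\<xi>\<close> near \<open>s x\<close>.  As the surface and the parameter domain
  have the same dimension, an injective immersion is a diffeomorphism onto an open part of it.\<close>
definition local_parametrization ::
  "('u, real^2) chart set \<Rightarrow> J2 set \<Rightarrow> J1 \<Rightarrow> 'u \<Rightarrow> ('u \<Rightarrow> J2) \<Rightarrow> bool" where
  "local_parametrization U \<Sigma> \<xi> x s \<longleftrightarrow>
     (\<exists>V. openin (atlas_topology U) V \<and> x \<in> V \<and> smooth_map U (fibre_atlas \<xi>) V s \<and>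
        s ` V \<subseteq> \<Sigma> \<and> inj_on s V \<and>
        (\<forall>y\<in>V. \<forall>c\<in>U. \<forall>d\<in>fibre_atlas \<xi>. y \<in> fst c \<longrightarrow> s y \<in> fst d \<longrightarrow>
           inj (chart_diff c d s y)))"

definition PDE_class ::
  "('u, real^2) chart set \<Rightarrow> nat \<Rightarrow> (('u, J2) jet \<Rightarrow> real) \<Rightarrow> real \<Rightarrow> J1 set \<Rightarrow> J2 set set" where
  "PDE_class U n K c B =
     {\<Sigma>. is_PDE_over B \<Sigma> \<and>
        (\<forall>\<xi> x s. local_parametrization U \<Sigma> \<xi> x s \<longrightarrow> K (jet U (fibre_atlas \<xi>) n x s) = c)}"

text \<open>\<open>\<P> B\<close> is the part of the class consisting of the equations over \<open>B\<close>.  Local contact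
  transformations preserve the class; global ones moreover preserve the equations over all
  of \<open>J\<^sup>1\<close>.\<close>
definition contact_invariant_class :: "(J1 set \<Rightarrow> J2 set set) \<Rightarrow> bool" where
  "contact_invariant_class \<P> \<longleftrightarrow>
     (\<forall>D \<phi> B \<Sigma>. contact_transformation D \<phi> \<longrightarrow> \<Sigma> \<in> \<P> B \<longrightarrow>
        \<phi> ` (\<Sigma> \<inter> D) \<in> \<P> (fst ` \<phi> ` (\<Sigma> \<inter> D))) \<and>
     (\<forall>\<phi> \<Sigma>. contact_transformation J2_points \<phi> \<longrightarrow> \<phi> ` J2_points = J2_points \<longrightarrow>
        \<Sigma> \<in> \<P> UNIV \<longrightarrow> \<phi> ` \<Sigma> \<in> \<P> UNIV)"

end

(* A map into a fibre of J2 becomes, in a conformal symplectic basis, a map into LG(2,4), and two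
   bases differ by an element of CSp(4,R); so everything reduces to showing that a contact
   transformation phi of J2 acts on each fibre, locally, as L -> A L for one conformal symplectic
   isomorphism A between contact planes.

   Let f be the J1-component of phi in charts, with coordinates (xi, m) on the source, and let theta
   be the pullback of the contact form by f.  As phi preserves the canonical system, Df maps it to
   Lagrangian planes; hence theta and d theta = f^* eta vanish on it.  The brackets of the canonical
   system with the vertical fields span the preimage of the contact distribution C, so theta vanishes
   on that preimage, and the same computation once more shows that eta vanishes on
   Df(0, w) x Df(C x R^3).  Since phi is a diffeomorphism, Df(C x R^3) is all of C at the image
   point, and nondegeneracy of eta gives Df(0, w) = 0.  So f depends on xi only, locally, and A is
   its derivative; A is conformal because it maps an open set of Lagrangian planes to Lagrangian
   planes. *)
theory Submission
  imports Defs
begin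

section \<open>Calculus of smooth maps\<close>

text \<open>A conformal symplectic isomorphism maps conformal symplectic bases to such bases, and
  the atlases \<open>LG_atlas\<close> have a chart for every such basis. Hence it matches charts
  with charts of identical coordinates (\<open>atlas_iso\<close>): local representatives do not
  change, and jets are transported without a chain rule of higher order. The same holds for
  \<open>psi b\<close>.

  The obstacle is that a local transformation is known to act linearly only near each point of a
  fibre, since its domain may meet the fibre in pieces that go to different fibres. Germs suffice
  for jets and for equations over arbitrary base sets. Equations over all of \<open>J1\<close> stay
  such because the Lagrangian Grassmannian is connected, so that a global transformation maps whole
  fibres into fibres.

  Brackets appear only through the functions \<open>\<theta> v\<close> with constant
  \<open>v\<close>: constant fields commute, so d\<theta>(u, v) is u(\<theta> v) - v(\<theta> u).
  Conformality is a count: a skew form on R^4 has six coefficients, vanishing on an open set of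
  Lagrangian planes gives five independent equations, and the multiples of the symplectic form
  remain.\<close>

lemma Ck_on_cong:
  assumes "Ck_on k S f" "open S" "\<And>x. x \<in> S \<Longrightarrow> f x = g x"
  shows "Ck_on k S g"
  using assms
proof (induction k arbitrary: f g)
  case 0
  then show ?case
    by (simp cong: continuous_on_cong)
next
  case (Suc k)
  have d: "(g has_derivative frechet_derivative f (at x)) (at x)" if "x \<in> S" for x
  proof -
    have "(f has_derivative frechet_derivative f (at x)) (at x)"
      using Suc.prems(1) that by (simp add: frechet_derivative_works)
    then show ?thesis
      by (rule has_derivative_transform_within_open) (use Suc.prems that in auto)
  qed
  have "Ck_on k S (\<lambda>x. frechet_derivative g (at x) v)" for v
    by (rule Suc.IH[of "\<lambda>x. frechet_derivative f (at x) v"])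
      (use Suc.prems d frechet_derivative_at in \<open>fastforce+\<close>)
  then show ?case
    using d by (auto simp: differentiable_def)
qed

text \<open>Smoothness may be checked on any explicit derivative \<open>f'\<close>: by uniqueness it
  agrees on the open set with \<open>frechet_derivative\<close>, in terms of which
  \<open>Ck_on\<close> is defined.\<close>

lemma Ck_on_SucI:
  assumes "open S" "\<And>x. x \<in> S \<Longrightarrow> (f has_derivative f' x) (at x)"
    and "\<And>v. Ck_on k S (\<lambda>x. f' x v)"
  shows "Ck_on (Suc k) S f"
proof -
  have "Ck_on k S (\<lambda>x. frechet_derivative f (at x) v)" for v
    by (rule Ck_on_cong[OF assms(3)[of v] assms(1)]) (metis assms(2) frechet_derivative_at)
  then show ?thesis
    using assms(2) by (auto simp: differentiable_def)
qed

lemma Ck_on_has_derivative: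
  assumes "Ck_on (Suc k) S f" "x \<in> S"
  shows "(f has_derivative frechet_derivative f (at x)) (at x)"
  using assms by (simp add: frechet_derivative_works)

lemma Ck_on_SucD: "Ck_on (Suc k) S f \<Longrightarrow> Ck_on k S f"
proof (induction k arbitrary: f)
  case 0
  then show ?case
    by (auto intro!: continuous_at_imp_continuous_on differentiable_imp_continuous_within)
next
  case (Suc k)
  then show ?case by simp
qed

lemma Ck_on_continuous: "Ck_on k S f \<Longrightarrow> continuous_on S f"
  by (induction k) (auto dest: Ck_on_SucD simp del: Ck_on.simps(2))

lemma Ck_on_subset: "Ck_on k S f \<Longrightarrow> T \<subseteq> S \<Longrightarrow> Ck_on k T f"
  by (induction k arbitrary: f) (auto intro: continuous_on_subset)

lemma Ck_on_local:
  assumes "\<And>x. x \<in> S \<Longrightarrow> \<exists>T. open T \<and> x \<in> T \<and> Ck_on k T f"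
  shows "Ck_on k S f"
  using assms
proof (induction k arbitrary: f)
  case 0
  then show ?case
    by (auto intro!: continuous_at_imp_continuous_on) (metis continuous_on_eq_continuous_at)
next
  case (Suc k)
  have "Ck_on k S (\<lambda>x. frechet_derivative f (at x) v)" for v
  proof (rule Suc.IH)
    fix x assume "x \<in> S"
    then obtain T where "open T" "x \<in> T" "Ck_on (Suc k) T f"
      using Suc.prems by blast
    then show "\<exists>T. open T \<and> x \<in> T \<and> Ck_on k T (\<lambda>x. frechet_derivative f (at x) v)"
      by (intro exI[of _ T]) simp
  qed
  moreover have "f differentiable (at x)" if "x \<in> S" for x
    using Suc.prems[OF that] by auto
  ultimately show ?case
    by simp
qed

lemma Ck_on_const: "Ck_on k S (\<lambda>x. c)"
  by (induction k arbitrary: c) auto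

lemma Ck_on_bounded_linear:
  assumes "bounded_linear L" "open S" "Ck_on k S f"
  shows "Ck_on k S (\<lambda>x. L (f x))"
  using assms(3)
proof (induction k arbitrary: f)
  case 0
  then show ?case
    using bounded_linear.continuous_on[OF assms(1)] by simp
next
  case (Suc k)
  show ?case
    by (rule Ck_on_SucI[OF assms(2) bounded_linear.has_derivative[OF assms(1)
          Ck_on_has_derivative[OF Suc.prems]]])
      (use Suc in auto)
qed

lemma Ck_on_ident:
  assumes "open S"
  shows "Ck_on k S (\<lambda>x. x)"
proof (cases k)
  case (Suc j)
  show ?thesis
    unfolding Suc by (rule Ck_on_SucI[OF assms has_derivative_ident]) (rule Ck_on_const)
qed auto

lemma Ck_on_add:
  assumes "open S" "Ck_on k S f" "Ck_on k S g"
  shows "Ck_on k S (\<lambda>x. f x + g x)"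
  using assms(2,3)
proof (induction k arbitrary: f g)
  case 0
  then show ?case by (auto intro: continuous_intros)
next
  case (Suc k)
  show ?case
    by (rule Ck_on_SucI[OF assms(1) has_derivative_add
          [OF Ck_on_has_derivative[OF Suc.prems(1)] Ck_on_has_derivative[OF Suc.prems(2)]]])
      (use Suc in auto)
qed

lemma Ck_on_sum:
  assumes "open S" "\<And>i. i \<in> I \<Longrightarrow> Ck_on k S (f i)"
  shows "Ck_on k S (\<lambda>x. \<Sum>i\<in>I. f i x)"
  using assms(2)
  by (induction I rule: infinite_finite_induct) (auto intro: Ck_on_add Ck_on_const assms(1))

lemma Ck_on_scaleR:
  fixes f :: "'a::euclidean_space \<Rightarrow> real"
  assumes "open S" "Ck_on k S f" "Ck_on k S g"
  shows "Ck_on k S (\<lambda>x. f x *\<^sub>R g x)"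
  using assms(2,3)
proof (induction k arbitrary: f g)
  case 0
  then show ?case by (auto intro: continuous_intros)
next
  case (Suc k)
  show ?case
    by (rule Ck_on_SucI[OF assms(1) has_derivative_scaleR
          [OF Ck_on_has_derivative[OF Suc.prems(1)] Ck_on_has_derivative[OF Suc.prems(2)]]])
      (use Suc Suc.prems[THEN Ck_on_SucD] in \<open>auto intro!: Ck_on_add assms(1)\<close>)
qed

text \<open>The derivative of 1/f is -(1/f) Df (1/f), which contains 1/f again, at the lower order
  of the induction hypothesis; therefore \<open>f\<close> stays fixed in the induction.\<close>

lemma Ck_on_inverse:
  fixes f :: "'a::euclidean_space \<Rightarrow> real"
  assumes "open S" "Ck_on k S f" "\<And>x. x \<in> S \<Longrightarrow> f x \<noteq> 0"
  shows "Ck_on k S (\<lambda>x. inverse (f x))"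
  using assms(2)
proof (induction k)
  case 0
  then show ?case using assms(3) by (auto intro: continuous_intros)
next
  case (Suc k)
  have i: "Ck_on k S (\<lambda>x. inverse (f x))"
    using Suc Ck_on_SucD by blast
  have "Ck_on k S (\<lambda>x. - 1 * (inverse (f x) * frechet_derivative f (at x) v * inverse (f x)))" for v
    unfolding real_scaleR_def[symmetric]
    by (intro Ck_on_scaleR assms(1) i Ck_on_const) (use Suc.prems in auto)
  then show ?case
    using Deriv.has_derivative_inverse[OF assms(3) Ck_on_has_derivative[OF Suc.prems]]
    by (intro Ck_on_SucI[OF assms(1)]) auto
qed

text \<open>\<open>Ck_on\<close> controls the derivative of \<open>f\<close> in fixed directions,
  while the chain rule applies it to the varying vector Dg(x) v. Expanding that vector in
  \<open>Basis\<close> leaves sums of products of maps of lower order.\<close>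

lemma Ck_on_compose:
  assumes "open S" "open T" "Ck_on k T f" "Ck_on k S g" "g ` S \<subseteq> T"
  shows "Ck_on k S (\<lambda>x. f (g x))"
  using assms(3,4)
proof (induction k arbitrary: f)
  case 0
  then show ?case
    using assms(5) by (auto intro: continuous_on_compose2)
next
  case (Suc k)
  have gT: "g x \<in> T" if "x \<in> S" for x
    using assms(5) that by auto
  have expand: "frechet_derivative f (at (g x)) (frechet_derivative g (at x) v) =
      (\<Sum>e\<in>Basis. (frechet_derivative g (at x) v \<bullet> e) *\<^sub>R frechet_derivative f (at (g x)) e)"
    if "x \<in> S" for x v
  proof -
    have "linear (frechet_derivative f (at (g x)))"
      using Ck_on_has_derivative[OF Suc.prems(1) gT[OF that]] has_derivative_linear by blast
    then show ?thesis
      by (subst euclidean_representation[of "frechet_derivative g (at x) v", symmetric])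
        (simp only: linear_sum linear_scale)
  qed
  have sum: "Ck_on k S (\<lambda>x. \<Sum>e\<in>Basis. (frechet_derivative g (at x) v \<bullet> e) *\<^sub>R
      frechet_derivative f (at (g x)) e)" for v
  proof (intro Ck_on_sum Ck_on_scaleR assms(1))
    show "Ck_on k S (\<lambda>x. frechet_derivative g (at x) v \<bullet> e)" for e
      by (rule Ck_on_bounded_linear[OF bounded_linear_inner_left assms(1)])
        (use Suc.prems in auto)
    show "Ck_on k S (\<lambda>x. frechet_derivative f (at (g x)) e)" for e
      by (rule Suc.IH) (use Suc.prems Ck_on_SucD in auto)
  qed
  have "Ck_on k S (\<lambda>x. frechet_derivative f (at (g x)) (frechet_derivative g (at x) v))" for v
    by (rule Ck_on_cong[OF sum[of v] assms(1)]) (rule expand[symmetric])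
  then show ?case
    using has_derivative_compose[OF Ck_on_has_derivative[OF Suc.prems(2)]
        Ck_on_has_derivative[OF Suc.prems(1) gT]]
    by (intro Ck_on_SucI[OF assms(1)])
qed

section \<open>Infinitely differentiable maps\<close>

lemma smooth_on_cong:
  assumes "smooth_on S f" "open S" "\<And>x. x \<in> S \<Longrightarrow> f x = g x"
  shows "smooth_on S g"
  using assms Ck_on_cong unfolding smooth_on_def by blast

lemma smooth_on_subset: "smooth_on S f \<Longrightarrow> T \<subseteq> S \<Longrightarrow> smooth_on T f"
  using Ck_on_subset unfolding smooth_on_def by blast

lemma smooth_on_local:
  assumes "\<And>x. x \<in> S \<Longrightarrow> \<exists>T. open T \<and> x \<in> T \<and> smooth_on T f"
  shows "smooth_on S f"
  using assms unfolding smooth_on_def by (meson Ck_on_local)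

lemma smooth_on_has_derivative:
  "smooth_on S f \<Longrightarrow> x \<in> S \<Longrightarrow> (f has_derivative frechet_derivative f (at x)) (at x)"
  using Ck_on_has_derivative unfolding smooth_on_def by blast

lemma smooth_on_continuous_on: "smooth_on S f \<Longrightarrow> continuous_on S f"
  using Ck_on_continuous unfolding smooth_on_def by blast

lemma smooth_on_deriv: "smooth_on S f \<Longrightarrow> smooth_on S (\<lambda>x. frechet_derivative f (at x) v)"
  unfolding smooth_on_def by (metis Ck_on.simps(2))

lemma smooth_on_compose:
  assumes "smooth_on T f" "smooth_on S g" "open S" "open T" "g ` S \<subseteq> T"
  shows "smooth_on S (\<lambda>x. f (g x))"
  using assms Ck_on_compose unfolding smooth_on_def by blast

lemma smooth_on_bounded_linear:
  assumes "bounded_linear L" "open S" "smooth_on S f"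
  shows "smooth_on S (\<lambda>x. L (f x))"
  using assms Ck_on_bounded_linear unfolding smooth_on_def by blast

lemma smooth_on_const: "smooth_on S (\<lambda>x. c)"
  using Ck_on_const unfolding smooth_on_def by blast

lemma smooth_on_ident: "open S \<Longrightarrow> smooth_on S (\<lambda>x. x)"
  using Ck_on_ident unfolding smooth_on_def by blast

lemma smooth_on_add:
  "open S \<Longrightarrow> smooth_on S f \<Longrightarrow> smooth_on S g \<Longrightarrow> smooth_on S (\<lambda>x. f x + g x)"
  using Ck_on_add unfolding smooth_on_def by blast

lemma smooth_on_sum:
  "open S \<Longrightarrow> (\<And>i. i \<in> I \<Longrightarrow> smooth_on S (f i)) \<Longrightarrow> smooth_on S (\<lambda>x. \<Sum>i\<in>I. f i x)"
  unfolding smooth_on_def by (simp add: Ck_on_sum)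

lemma smooth_on_scaleR:
  fixes f :: "'a::euclidean_space \<Rightarrow> real"
  shows "open S \<Longrightarrow> smooth_on S f \<Longrightarrow> smooth_on S g \<Longrightarrow> smooth_on S (\<lambda>x. f x *\<^sub>R g x)"
  using Ck_on_scaleR unfolding smooth_on_def by blast

lemma smooth_on_mult:
  fixes f :: "'a::euclidean_space \<Rightarrow> real"
  shows "open S \<Longrightarrow> smooth_on S f \<Longrightarrow> smooth_on S g \<Longrightarrow> smooth_on S (\<lambda>x. f x * g x)"
  using smooth_on_scaleR[of S f g] by simp

lemma smooth_on_diff:
  assumes "open S" "smooth_on S f" "smooth_on S g"
  shows "smooth_on S (\<lambda>x. f x - g x)"
  using smooth_on_add[OF assms(1,2) smooth_on_bounded_linear[OF _ assms(1,3), of uminus]]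
  by (simp add: bounded_linear_minus bounded_linear_ident)

lemma smooth_on_divide:
  fixes f :: "'a::euclidean_space \<Rightarrow> real"
  assumes "open S" "smooth_on S f" "smooth_on S g" "\<And>x. x \<in> S \<Longrightarrow> g x \<noteq> 0"
  shows "smooth_on S (\<lambda>x. f x / g x)"
proof -
  have "smooth_on S (\<lambda>x. inverse (g x))"
    using assms(3) unfolding smooth_on_def by (simp add: Ck_on_inverse assms(1,4))
  then show ?thesis
    unfolding divide_inverse by (rule smooth_on_mult[OF assms(1,2)])
qed

lemma smooth_on_Pair:
  assumes "open S" "smooth_on S f" "smooth_on S g"
  shows "smooth_on S (\<lambda>x. (f x, g x))"
proof -
  have "smooth_on S (\<lambda>x. (f x, 0) + (0, g x))"
    by (intro smooth_on_add smooth_on_bounded_linear[of "\<lambda>y. (y, 0)"]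
        smooth_on_bounded_linear[of "\<lambda>y. (0, y)"] assms
        bounded_linear_Pair bounded_linear_ident bounded_linear_zero)
  then show ?thesis by simp
qed

lemma smooth_on_vec:
  fixes f :: "'n::finite \<Rightarrow> 'a::euclidean_space \<Rightarrow> real"
  assumes "open S" "\<And>i. smooth_on S (f i)"
  shows "smooth_on S (\<lambda>x. \<chi> i. f i x)"
proof -
  have "(\<chi> i. f i x) = (\<Sum>i\<in>UNIV. f i x *\<^sub>R axis i 1)" for x
    by (simp add: vec_eq_iff axis_def if_distrib cong: if_cong)
  then show ?thesis
    using assms by (simp add: smooth_on_sum smooth_on_scaleR smooth_on_const)
qed

lemma inverse_derivative_at:
  assumes "smooth_on S f" "smooth_on T g" "open S" "x \<in> S" "f x \<in> T"
    and "\<And>y. y \<in> S \<Longrightarrow> g (f y) = y"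
  shows "frechet_derivative g (at (f x)) (frechet_derivative f (at x) v) = v"
proof -
  have "((\<lambda>y. g (f y)) has_derivative
      (\<lambda>v. frechet_derivative g (at (f x)) (frechet_derivative f (at x) v))) (at x)"
    using has_derivative_compose[OF smooth_on_has_derivative[OF assms(1,4)]
        smooth_on_has_derivative[OF assms(2,5)]] .
  then have "((\<lambda>y. y) has_derivative
      (\<lambda>v. frechet_derivative g (at (f x)) (frechet_derivative f (at x) v))) (at x)"
    by (rule has_derivative_transform_within_open) (use assms in auto)
  then show ?thesis
    using has_derivative_unique[OF _ has_derivative_ident] by metis
qed

section \<open>Symmetry of second derivatives\<close>

text \<open>The mean value theorem is used twice: along \<open>u\<close> for the increment of
  \<open>f\<close> over \<open>t *\<^sub>R v\<close>, then along \<open>v\<close> for the derivative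
  in direction \<open>u\<close>. The intermediate points stay in the parallelogram at
  \<open>x\<close>, whence the bound on \<open>dist y x\<close>.\<close>

lemma second_difference_mean_value:
  fixes f :: "'a::euclidean_space \<Rightarrow> real"
  assumes "smooth_on (ball x r) f" "t > 0" "t * (norm u + norm v) < r"
  shows "\<exists>y. dist y x \<le> t * (norm u + norm v) \<and>
    f (x + t *\<^sub>R u + t *\<^sub>R v) - f (x + t *\<^sub>R u) - f (x + t *\<^sub>R v) + f x =
    t * (t * frechet_derivative (\<lambda>x. frechet_derivative f (at x) u) (at y) v)"
proof -
  let ?D = "\<lambda>y. frechet_derivative f (at y) u"
  have near: "dist (x + a *\<^sub>R u + b *\<^sub>R v) x \<le> t * (norm u + norm v)"
    if "0 \<le> a" "a \<le> t" "0 \<le> b" "b \<le> t" for a b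
  proof -
    have "norm (a *\<^sub>R u + b *\<^sub>R v) \<le> a * norm u + b * norm v"
      using that by (intro norm_triangle_le) auto
    also have "\<dots> \<le> t * norm u + t * norm v"
      using that by (intro add_mono mult_right_mono) auto
    finally show ?thesis
      by (simp add: dist_norm algebra_simps)
  qed
  then have inball: "x + a *\<^sub>R u + b *\<^sub>R v \<in> ball x r"
    if "0 \<le> a" "a \<le> t" "0 \<le> b" "b \<le> t" for a b
    using that assms(3) by (simp add: dist_commute) (meson le_less_trans)
  have d: "((\<lambda>s. f (x + s *\<^sub>R u + b *\<^sub>R v)) has_real_derivative ?D (x + s *\<^sub>R u + b *\<^sub>R v)) (at s)"
    if "0 \<le> s" "s \<le> t" "0 \<le> b" "b \<le> t" for s b
  proof -
    have "((\<lambda>s. x + s *\<^sub>R u + b *\<^sub>R v) has_derivative (\<lambda>h. h *\<^sub>R u)) (at s)"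
      by (auto intro!: derivative_eq_intros)
    from has_derivative_compose[OF this smooth_on_has_derivative[OF assms(1) inball[OF that]]]
    show ?thesis
      unfolding has_field_derivative_def
      by (rule has_derivative_eq_rhs)
        (use linear_cmul[OF has_derivative_linear[OF smooth_on_has_derivative[OF assms(1) inball[OF that]]]]
          in \<open>auto simp: mult.commute\<close>)
  qed
  have "\<exists>a>0. a < t \<and>
      (f (x + t *\<^sub>R u + t *\<^sub>R v) - f (x + t *\<^sub>R u + 0 *\<^sub>R v)) -
      (f (x + 0 *\<^sub>R u + t *\<^sub>R v) - f (x + 0 *\<^sub>R u + 0 *\<^sub>R v)) =
      (t - 0) * (?D (x + a *\<^sub>R u + t *\<^sub>R v) - ?D (x + a *\<^sub>R u + 0 *\<^sub>R v))"
    by (rule MVT2[OF assms(2)]) (intro DERIV_diff d; use assms(2) in auto)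
  then obtain a where a: "0 < a" "a < t"
    and eq1: "f (x + t *\<^sub>R u + t *\<^sub>R v) - f (x + t *\<^sub>R u) - f (x + t *\<^sub>R v) + f x =
      t * (?D (x + a *\<^sub>R u + t *\<^sub>R v) - ?D (x + a *\<^sub>R u + 0 *\<^sub>R v))"
    by auto
  have d2: "((\<lambda>s. ?D (x + a *\<^sub>R u + s *\<^sub>R v)) has_real_derivative
      frechet_derivative ?D (at (x + a *\<^sub>R u + s *\<^sub>R v)) v) (at s)"
    if "0 \<le> s" "s \<le> t" for s
  proof -
    have i: "x + a *\<^sub>R u + s *\<^sub>R v \<in> ball x r"
      using that a by (intro inball) auto
    have "((\<lambda>s. x + a *\<^sub>R u + s *\<^sub>R v) has_derivative (\<lambda>h. h *\<^sub>R v)) (at s)"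
      by (auto intro!: derivative_eq_intros)
    from has_derivative_compose[OF this smooth_on_has_derivative[OF smooth_on_deriv[OF assms(1)] i]]
    show ?thesis
      unfolding has_field_derivative_def
      by (rule has_derivative_eq_rhs)
        (use linear_cmul[OF has_derivative_linear[OF smooth_on_has_derivative[OF smooth_on_deriv[OF assms(1)] i]]]
          in \<open>auto simp: mult.commute\<close>)
  qed
  have "\<exists>b>0. b < t \<and> ?D (x + a *\<^sub>R u + t *\<^sub>R v) - ?D (x + a *\<^sub>R u + 0 *\<^sub>R v) =
      (t - 0) * frechet_derivative ?D (at (x + a *\<^sub>R u + b *\<^sub>R v)) v"
    by (rule MVT2[OF assms(2)]) (rule d2; simp)
  then obtain b where b: "0 < b" "b < t" "?D (x + a *\<^sub>R u + t *\<^sub>R v) - ?D (x + a *\<^sub>R u + 0 *\<^sub>R v) =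
      t * frechet_derivative ?D (at (x + a *\<^sub>R u + b *\<^sub>R v)) v"
    by auto
  then show ?thesis
    using eq1 near[of a b] a by (intro exI[of _ "x + a *\<^sub>R u + b *\<^sub>R v"]) auto
qed

text \<open>The second difference is symmetric in \<open>u\<close> and \<open>v\<close>, so the two
  mixed derivatives take equal values at points \<open>y\<close> and \<open>z\<close> arbitrarily
  close to \<open>x\<close>; continuity brings the equality to \<open>x\<close>.\<close>

lemma second_derivative_symmetric_real:
  fixes f :: "'a::euclidean_space \<Rightarrow> real"
  assumes "smooth_on S f" "open S" "x \<in> S"
  shows "frechet_derivative (\<lambda>x. frechet_derivative f (at x) u) (at x) v =
    frechet_derivative (\<lambda>x. frechet_derivative f (at x) v) (at x) u" (is "?P x = ?Q x")
proof (rule ccontr)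
  assume ne: "?P x \<noteq> ?Q x"
  let ?P = "\<lambda>x. frechet_derivative (\<lambda>x. frechet_derivative f (at x) u) (at x) v"
  let ?Q = "\<lambda>x. frechet_derivative (\<lambda>x. frechet_derivative f (at x) v) (at x) u"
  define e where "e = \<bar>?P x - ?Q x\<bar> / 2"
  have e: "e > 0"
    using ne by (auto simp: e_def)
  obtain r where r: "r > 0" "ball x r \<subseteq> S"
    using assms open_contains_ball by blast
  have "isCont ?P x" "isCont ?Q x"
    using smooth_on_continuous_on[OF smooth_on_deriv[OF smooth_on_deriv[OF assms(1)]]] assms(2,3)
    by (auto simp: continuous_on_eq_continuous_at)
  then obtain d1 d2 where d: "d1 > 0" "d2 > 0" "\<And>y. dist y x < d1 \<Longrightarrow> dist (?P y) (?P x) < e"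
    "\<And>y. dist y x < d2 \<Longrightarrow> dist (?Q y) (?Q x) < e"
    unfolding continuous_at_eps_delta using e by metis
  define m where "m = min r (min d1 d2)"
  \<comment> \<open>The summand 1 keeps \<open>N\<close> positive when \<open>u\<close> and
    \<open>v\<close> vanish; \<open>t\<close> is chosen so that \<open>t * N\<close> is half of
    \<open>m\<close>.\<close>
  define N where "N = norm u + norm v + 1"
  define t where "t = m / (2 * N)"
  have m: "m > 0" and N: "N > 0"
    using r d unfolding m_def N_def by (auto intro: add_nonneg_pos)
  then have t: "t > 0"
    by (simp add: t_def)
  have "t * (norm u + norm v) < t * N"
    using t unfolding N_def by simp
  also have "\<dots> < m"
    using m N by (simp add: t_def field_simps)
  finally have tm: "t * (norm u + norm v) < m" .
  then have tr: "t * (norm u + norm v) < r" "t * (norm v + norm u) < r"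
    by (auto simp: m_def add.commute)
  have s: "smooth_on (ball x r) f"
    using smooth_on_subset[OF assms(1) r(2)] .
  obtain y where y: "dist y x \<le> t * (norm u + norm v)"
      "f (x + t *\<^sub>R u + t *\<^sub>R v) - f (x + t *\<^sub>R u) - f (x + t *\<^sub>R v) + f x = t * (t * ?P y)"
    using second_difference_mean_value[OF s t tr(1)] by blast
  obtain z where z: "dist z x \<le> t * (norm v + norm u)"
      "f (x + t *\<^sub>R v + t *\<^sub>R u) - f (x + t *\<^sub>R v) - f (x + t *\<^sub>R u) + f x = t * (t * ?Q z)"
    using second_difference_mean_value[OF s t tr(2)] by blast
  have "t * (t * ?P y) = t * (t * ?Q z)"
    using y(2) z(2) by (simp add: algebra_simps)
  then have "?P y = ?Q z"
    using t by simp
  moreover have "dist (?P y) (?P x) < e" "dist (?Q z) (?Q x) < e"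
    using y(1) z(1) tm d by (auto simp: m_def add.commute)
  ultimately have "\<bar>?P x - ?Q x\<bar> < 2 * e"
    unfolding dist_real_def by linarith
  then show False
    by (simp add: e_def)
qed

text \<open>Reduced to components. It serves to cancel the second derivatives of \<open>f\<close> in
  the exterior derivative of a pulled-back contact form.\<close>

lemma second_derivative_symmetric:
  fixes f :: "'a::euclidean_space \<Rightarrow> 'b::euclidean_space"
  assumes "smooth_on S f" "open S" "x \<in> S"
  shows "frechet_derivative (\<lambda>x. frechet_derivative f (at x) u) (at x) v =
    frechet_derivative (\<lambda>x. frechet_derivative f (at x) v) (at x) u"
proof (rule euclidean_eqI)
  fix e :: 'b
  assume "e \<in> Basis"
  let ?g = "\<lambda>x. f x \<bullet> e"
  have g: "smooth_on S ?g"
    by (rule smooth_on_bounded_linear[OF bounded_linear_inner_left assms(2,1)])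
  have in1: "frechet_derivative (\<lambda>x. h x \<bullet> e) (at y) w = frechet_derivative h (at y) w \<bullet> e"
    if "smooth_on S h" "y \<in> S" for h :: "'a \<Rightarrow> 'b" and y w
    using frechet_derivative_at[OF bounded_linear.has_derivative[OF bounded_linear_inner_left[of e]
        smooth_on_has_derivative[OF that]]] by metis
  have in2: "frechet_derivative (\<lambda>x. frechet_derivative f (at x) u) (at x) v \<bullet> e =
      frechet_derivative (\<lambda>x. frechet_derivative ?g (at x) u) (at x) v" for u v
  proof -
    have "((\<lambda>x. frechet_derivative f (at x) u \<bullet> e) has_derivative
      (\<lambda>v. frechet_derivative (\<lambda>x. frechet_derivative f (at x) u) (at x) v \<bullet> e)) (at x)"
      by (rule bounded_linear.has_derivative[OF bounded_linear_inner_left])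
        (rule smooth_on_has_derivative[OF smooth_on_deriv[OF assms(1)] assms(3)])
    then have "((\<lambda>x. frechet_derivative ?g (at x) u) has_derivative
      (\<lambda>v. frechet_derivative (\<lambda>x. frechet_derivative f (at x) u) (at x) v \<bullet> e)) (at x)"
      by (rule has_derivative_transform_within_open) (use assms in1[OF assms(1)] in auto)
    then show ?thesis
      by (metis frechet_derivative_at)
  qed
  show "frechet_derivative (\<lambda>x. frechet_derivative f (at x) u) (at x) v \<bullet> e =
    frechet_derivative (\<lambda>x. frechet_derivative f (at x) v) (at x) u \<bullet> e"
    unfolding in2 by (rule second_derivative_symmetric_real[OF g assms(2,3)])
qed

section \<open>Atlases and jets\<close>

text \<open>Holds for non-differentiable maps too, since both sides are the same choice from the
  same set of derivatives.\<close>

lemma frechet_derivative_cong_open: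
  assumes "open S" "x \<in> S" "\<And>y. y \<in> S \<Longrightarrow> f y = g y"
  shows "frechet_derivative f (at x) = frechet_derivative g (at x)"
proof -
  have "(f has_derivative D) (at x) \<longleftrightarrow> (g has_derivative D) (at x)" for D
    by (metis assms has_derivative_transform_within_open)
  then show ?thesis
    unfolding frechet_derivative_def by simp
qed

lemma dir_deriv_cong_open:
  assumes "open S" "x \<in> S" "\<And>y. y \<in> S \<Longrightarrow> f y = g y"
  shows "dir_deriv vs f x = dir_deriv vs g x"
  using assms(3)
proof (induction vs arbitrary: f g)
  case Nil
  then show ?case using assms by simp
next
  case (Cons v vs)
  show ?case
    using frechet_derivative_cong_open[OF assms(1) _ Cons.prems] by (auto intro: Cons.IH)
qed

section \<open>Topology and smooth maps of an atlas\<close>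

lemma smooth_atlas_inj: "smooth_atlas A \<Longrightarrow> c \<in> A \<Longrightarrow> inj_on (snd c) (fst c)"
  unfolding smooth_atlas_def by blast

lemma istopology_atlas:
  assumes "smooth_atlas A"
  shows "istopology (\<lambda>S. S \<subseteq> carrier_of A \<and> (\<forall>c\<in>A. open (snd c ` (S \<inter> fst c))))"
  unfolding istopology_def
proof (intro conjI allI impI)
  fix S T
  assume S: "S \<subseteq> carrier_of A \<and> (\<forall>c\<in>A. open (snd c ` (S \<inter> fst c)))"
    and T: "T \<subseteq> carrier_of A \<and> (\<forall>c\<in>A. open (snd c ` (T \<inter> fst c)))"
  have "snd c ` (S \<inter> T \<inter> fst c) = snd c ` (S \<inter> fst c) \<inter> snd c ` (T \<inter> fst c)" if "c \<in> A" for c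
  proof -
    have "S \<inter> T \<inter> fst c = (S \<inter> fst c) \<inter> (T \<inter> fst c)"
      by auto
    then show ?thesis
      using inj_on_image_Int[OF smooth_atlas_inj[OF assms that], of "S \<inter> fst c" "T \<inter> fst c"]
      by simp
  qed
  then show "S \<inter> T \<subseteq> carrier_of A" "\<forall>c\<in>A. open (snd c ` (S \<inter> T \<inter> fst c))"
    using S T by auto
next
  fix K
  assume K: "\<forall>S\<in>K. S \<subseteq> carrier_of A \<and> (\<forall>c\<in>A. open (snd c ` (S \<inter> fst c)))"
  then show "\<Union>K \<subseteq> carrier_of A"
    by auto
  have "snd c ` (\<Union>K \<inter> fst c) = (\<Union>S\<in>K. snd c ` (S \<inter> fst c))" if "c \<in> A" for c
    by auto
  moreover have "open (\<Union>S\<in>K. snd c ` (S \<inter> fst c))" if "c \<in> A" for c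
    by (rule open_UN) (use K that in blast)
  ultimately show "\<forall>c\<in>A. open (snd c ` (\<Union>K \<inter> fst c))"
    by simp
qed

lemma openin_atlas:
  assumes "smooth_atlas A"
  shows "openin (atlas_topology A) S \<longleftrightarrow>
    S \<subseteq> carrier_of A \<and> (\<forall>c\<in>A. open (snd c ` (S \<inter> fst c)))"
  unfolding atlas_topology_def topology_inverse'[OF istopology_atlas[OF assms]] ..

lemma open_chart_image:
  assumes "smooth_atlas A" "openin (atlas_topology A) W" "c \<in> A" "W \<subseteq> fst c"
  shows "open (snd c ` W)"
  using assms by (metis inf.absorb1 openin_atlas)

lemma inv_into_chart [simp]:
  assumes "smooth_atlas A" "c \<in> A" "x \<in> fst c"
  shows "inv_into (fst c) (snd c) (snd c x) = x"
  using assms smooth_atlas_inj by (metis inv_into_f_f)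

lemma openin_chart_vimage:
  assumes "smooth_atlas A" "c \<in> A" "open R"
  shows "openin (atlas_topology A) {x \<in> fst c. snd c x \<in> R}"
  unfolding openin_atlas[OF assms(1)]
proof (intro conjI ballI)
  show "{x \<in> fst c. snd c x \<in> R} \<subseteq> carrier_of A"
    using assms(2) by (auto simp: carrier_of_def)
  fix d assume d: "d \<in> A"
  have eq: "snd d ` ({x \<in> fst c. snd c x \<in> R} \<inter> fst d) =
      snd d ` (fst d \<inter> fst c) \<inter> local_rep d c id -` R"
    using assms d by (auto simp: local_rep_def)
  have "open (snd d ` (fst d \<inter> fst c))" "continuous_on (snd d ` (fst d \<inter> fst c)) (local_rep d c id)"
    using assms d smooth_on_continuous_on unfolding smooth_atlas_def by blast+
  then show "open (snd d ` ({x \<in> fst c. snd c x \<in> R} \<inter> fst d))"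
    unfolding eq using assms(3) by (simp add: continuous_on_open_vimage Int_commute)
qed

lemma openin_chart:
  assumes "smooth_atlas A" "c \<in> A"
  shows "openin (atlas_topology A) (fst c)"
  using openin_chart_vimage[OF assms open_UNIV] by simp

text \<open>Whereas \<open>smooth_map\<close> provides a single pair of charts, smoothness of the transition
  functions gives all of them.\<close>
lemma smooth_map_charts:
  assumes A: "smooth_atlas A" and B: "smooth_atlas B" and f: "smooth_map A B V f"
    and c: "c \<in> A" and d: "d \<in> B" and x: "x \<in> V" "x \<in> fst c" "f x \<in> fst d"
  shows "\<exists>W. openin (atlas_topology A) W \<and> x \<in> W \<and> W \<subseteq> V \<inter> fst c \<and> f ` W \<subseteq> fst d \<and>
    smooth_on (snd c ` W) (local_rep c d f)"
proof -
  obtain c' d' W' where c': "c' \<in> A" "d' \<in> B" "openin (atlas_topology A) W'" "x \<in> W'"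
    "W' \<subseteq> V \<inter> fst c'" "f ` W' \<subseteq> fst d'" and sm: "smooth_on (snd c' ` W') (local_rep c' d' f)"
    using f x unfolding smooth_map_def by meson
  let ?g = "local_rep c' d' f"
  have g: "?g (snd c' y) = snd d' (f y)" if "y \<in> W'" for y
    using that c' A by (auto simp: local_rep_def)
  define R' where "R' = snd c' ` W' \<inter> ?g -` (snd d' ` (fst d' \<inter> fst d))"
  have oW': "open (snd c' ` W')"
    using open_chart_image[OF A c'(3,1)] c'(5) by blast
  have od: "open (snd d' ` (fst d' \<inter> fst d))"
    and sd: "smooth_on (snd d' ` (fst d' \<inter> fst d)) (local_rep d' d id)"
    using B c' d unfolding smooth_atlas_def by blast+
  have oc: "open (snd c ` (fst c \<inter> fst c'))"
    and sc: "smooth_on (snd c ` (fst c \<inter> fst c')) (local_rep c c' id)"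
    using A c' c unfolding smooth_atlas_def by blast+
  have R': "open R'"
    unfolding R'_def
    by (metis oW' od sm smooth_on_continuous_on continuous_on_open_vimage Int_commute)
  \<comment> \<open>\<open>W\<close> turns out to be the part of \<open>W'\<close> on which
    \<open>c\<close> and \<open>d\<close> apply as well; its definition through \<open>R'\<close>
    makes it visibly open.\<close>
  define W where "W = {y \<in> fst c'. snd c' y \<in> R'} \<inter> fst c"
  have oW: "openin (atlas_topology A) W"
    unfolding W_def by (intro openin_Int openin_chart_vimage openin_chart A c' c R')
  have W: "y \<in> W \<longleftrightarrow> y \<in> W' \<and> y \<in> fst c \<and> f y \<in> fst d" for y
  proof
    assume y: "y \<in> W"
    then obtain w where w: "w \<in> W'" "snd c' y = snd c' w"
      by (auto simp: W_def R'_def)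
    then have "y = w"
      using y c' inj_onD[OF smooth_atlas_inj[OF A c'(1)]] by (auto simp: W_def)
    then have yW: "y \<in> W'" using w by simp
    then have "snd d' (f y) \<in> snd d' ` (fst d' \<inter> fst d)"
      using y g by (auto simp: W_def R'_def)
    moreover have "f y \<in> fst d'"
      using yW c' by auto
    ultimately have "f y \<in> fst d"
      using inj_onD[OF smooth_atlas_inj[OF B c'(2)]] by auto
    then show "y \<in> W' \<and> y \<in> fst c \<and> f y \<in> fst d"
      using yW y by (auto simp: W_def)
  next
    assume y: "y \<in> W' \<and> y \<in> fst c \<and> f y \<in> fst d"
    then have "snd d' (f y) \<in> snd d' ` (fst d' \<inter> fst d)"
      using c' by auto
    then show "y \<in> W"
      using y g[of y] c' by (auto simp: W_def R'_def)
  qed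
  have ocW: "open (snd c ` W)"
    by (rule open_chart_image[OF A oW c]) (simp add: W_def)
  have cc': "local_rep c c' id (snd c y) = snd c' y" if "y \<in> W" for y
    using that c c' W A by (auto simp: local_rep_def)
  have "smooth_on (snd c ` W) (\<lambda>p. ?g (local_rep c c' id p))"
  proof (rule smooth_on_compose[OF sm smooth_on_subset[OF sc] ocW oW'])
    show "snd c ` W \<subseteq> snd c ` (fst c \<inter> fst c')"
      using W c' by auto
    show "local_rep c c' id ` snd c ` W \<subseteq> snd c' ` W'"
      using cc' W by auto
  qed
  then have "smooth_on (snd c ` W) (\<lambda>p. local_rep d' d id (?g (local_rep c c' id p)))"
  proof (rule smooth_on_compose[OF sd _ ocW od])
    have "snd d' (f y) \<in> snd d' ` (fst d' \<inter> fst d)" if "y \<in> W" for y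
      using that W c' by blast
    then show "(\<lambda>p. ?g (local_rep c c' id p)) ` snd c ` W \<subseteq> snd d' ` (fst d' \<inter> fst d)"
      using cc' W g by auto
  qed
  then have "smooth_on (snd c ` W) (local_rep c d f)"
  proof (rule smooth_on_cong[OF _ ocW])
    fix p assume "p \<in> snd c ` W"
    then obtain y where y: "y \<in> W" "p = snd c y" by auto
    then have "f y \<in> fst d'" "y \<in> fst c" "y \<in> W'" using W c' by auto
    then show "local_rep d' d id (?g (local_rep c c' id p)) = local_rep c d f p"
      unfolding y(2) cc'[OF y(1)] g[OF \<open>y \<in> W'\<close>]
      using A B c c' d by (simp add: local_rep_def)
  qed
  then show ?thesis
    using oW W x c' by (intro exI[of _ W]) auto
qed

text \<open>The neighbourhoods of single points are glued to the whole coordinate domain, so that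
  one pair of charts yields a smooth map on an open set of the model space.\<close>

lemma smooth_map_local_rep:
  assumes A: "smooth_atlas A" and B: "smooth_atlas B" and f: "smooth_map A B V f"
    and c: "c \<in> A" and d: "d \<in> B"
  shows "open (snd c ` {x \<in> V \<inter> fst c. f x \<in> fst d})"
    and "smooth_on (snd c ` {x \<in> V \<inter> fst c. f x \<in> fst d}) (local_rep c d f)"
proof -
  let ?X = "{x \<in> V \<inter> fst c. f x \<in> fst d}"
  have *: "\<exists>T. open T \<and> p \<in> T \<and> T \<subseteq> snd c ` ?X \<and> smooth_on T (local_rep c d f)"
    if p: "p \<in> snd c ` ?X" for p
  proof -
    obtain x where x: "x \<in> V" "x \<in> fst c" "f x \<in> fst d" "p = snd c x"
      using p by blast
    obtain W where W: "openin (atlas_topology A) W" "x \<in> W" "W \<subseteq> V \<inter> fst c" "f ` W \<subseteq> fst d"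
      "smooth_on (snd c ` W) (local_rep c d f)"
      using smooth_map_charts[OF A B f c d x(1-3)] by blast
    then show ?thesis
      using open_chart_image[OF A W(1) c] x by (intro exI[of _ "snd c ` W"]) auto
  qed
  show "open (snd c ` ?X)"
    using * by (subst open_subopen) blast
  show "smooth_on (snd c ` ?X) (local_rep c d f)"
    using * by (intro smooth_on_local) blast
qed

text \<open>The assumption on \<open>N\<close> is stated in the charts of \<open>B\<close> because
  \<open>N\<close> will be open in a larger manifold: in the application \<open>B\<close> is the
  atlas of one fibre and \<open>N\<close> is open in the second jet space.\<close>

lemma openin_smooth_map_chart:
  assumes A: "smooth_atlas A" and V: "openin (atlas_topology A) V" and f: "smooth_map A B V f"
    and N: "\<And>x d. x \<in> V \<Longrightarrow> f x \<in> N \<Longrightarrow> d \<in> B \<Longrightarrow> f x \<in> fst d \<Longrightarrow>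
      \<exists>R. open R \<and> snd d (f x) \<in> R \<and> {p \<in> fst d. snd d p \<in> R} \<subseteq> N"
  shows "openin (atlas_topology A) {x \<in> V. f x \<in> N}"
proof (subst openin_subopen, intro ballI)
  fix x assume x: "x \<in> {x \<in> V. f x \<in> N}"
  then obtain c d W where W: "c \<in> A" "d \<in> B" "openin (atlas_topology A) W" "x \<in> W"
    "W \<subseteq> V \<inter> fst c" "f ` W \<subseteq> fst d" and sm: "smooth_on (snd c ` W) (local_rep c d f)"
    using f unfolding smooth_map_def by (metis (no_types, lifting) mem_Collect_eq)
  then obtain R where R: "open R" "snd d (f x) \<in> R" "{p \<in> fst d. snd d p \<in> R} \<subseteq> N"
    using N[of x d] x by auto
  have rep: "local_rep c d f (snd c y) = snd d (f y)" if "y \<in> W" for y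
    using that W A by (auto simp: local_rep_def)
  have o: "open (snd c ` W)"
    using open_chart_image[OF A W(3,1)] W by blast
  let ?Q = "snd c ` W \<inter> local_rep c d f -` R"
  have "open ?Q"
    by (metis o R(1) sm smooth_on_continuous_on continuous_on_open_vimage Int_commute)
  then have "openin (atlas_topology A) {y \<in> fst c. snd c y \<in> ?Q}"
    by (rule openin_chart_vimage[OF A W(1)])
  moreover have "x \<in> {y \<in> fst c. snd c y \<in> ?Q}"
    using W R rep by auto
  moreover have "{y \<in> fst c. snd c y \<in> ?Q} \<subseteq> {x \<in> V. f x \<in> N}"
  proof
    fix y assume y: "y \<in> {y \<in> fst c. snd c y \<in> ?Q}"
    then obtain w where "w \<in> W" "snd c y = snd c w" by auto
    then have "y \<in> W"
      using W y inj_onD[OF smooth_atlas_inj[OF A W(1)], of y w] by auto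
    then show "y \<in> {x \<in> V. f x \<in> N}"
      using y rep W R(3) by auto
  qed
  ultimately show "\<exists>T. openin (atlas_topology A) T \<and> x \<in> T \<and> T \<subseteq> {x \<in> V. f x \<in> N}"
    by blast
qed

lemma smooth_map_subset:
  assumes "smooth_map A B V f" "openin (atlas_topology A) V'" "V' \<subseteq> V"
  shows "smooth_map A B V' f"
  unfolding smooth_map_def
proof
  fix x assume x: "x \<in> V'"
  then obtain c d W where W: "c \<in> A" "d \<in> B" "openin (atlas_topology A) W" "x \<in> W"
    "W \<subseteq> V \<inter> fst c" "f ` W \<subseteq> fst d" "smooth_on (snd c ` W) (local_rep c d f)"
    using assms unfolding smooth_map_def by (meson subsetD)
  show "\<exists>c\<in>A. \<exists>d\<in>B. \<exists>W. openin (atlas_topology A) W \<and> x \<in> W \<and>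
        W \<subseteq> V' \<inter> fst c \<and> f ` W \<subseteq> fst d \<and> smooth_on (snd c ` W) (local_rep c d f)"
    using W x assms(2)
    by (intro bexI[of _ c] bexI[of _ d] exI[of _ "W \<inter> V'"])
      (auto intro: smooth_on_subset)
qed

lemma smooth_map_carrier: "smooth_map A B V f \<Longrightarrow> x \<in> V \<Longrightarrow> f x \<in> carrier_of B"
  unfolding smooth_map_def carrier_of_def by blast

lemma local_rep_cong:
  assumes "smooth_atlas A" "c \<in> A"
    and "\<And>y. y \<in> V \<Longrightarrow> snd d (f y) = snd d' (g y)" "p \<in> snd c ` (V \<inter> fst c)"
  shows "local_rep c d f p = local_rep c d' g p"
  using assms by (auto simp: local_rep_def)

lemma smooth_map_cong:
  assumes "smooth_atlas A" "smooth_map A B V f" "\<And>x. x \<in> V \<Longrightarrow> f x = g x"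
  shows "smooth_map A B V g"
  unfolding smooth_map_def
proof
  fix x assume x: "x \<in> V"
  then obtain c d W where W: "c \<in> A" "d \<in> B" "openin (atlas_topology A) W" "x \<in> W"
    "W \<subseteq> V \<inter> fst c" "f ` W \<subseteq> fst d" and sm: "smooth_on (snd c ` W) (local_rep c d f)"
    using assms(2) unfolding smooth_map_def by meson
  have "smooth_on (snd c ` W) (local_rep c d g)"
    by (rule smooth_on_cong[OF sm])
      (use open_chart_image[OF assms(1) W(3,1)] W assms in
        \<open>auto intro!: local_rep_cong[OF assms(1), where V = W]\<close>)
  moreover have "g ` W \<subseteq> fst d"
    using W assms(3) by (metis Int_subset_iff image_cong subset_iff)
  ultimately show "\<exists>c\<in>A. \<exists>d\<in>B. \<exists>W. openin (atlas_topology A) W \<and> x \<in> W \<and>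
        W \<subseteq> V \<inter> fst c \<and> g ` W \<subseteq> fst d \<and> smooth_on (snd c ` W) (local_rep c d g)"
    using W by blast
qed

section \<open>Local maps and jets\<close>

lemma local_map_carrier: "local_map A B x s \<Longrightarrow> s x \<in> carrier_of B"
  unfolding local_map_def using smooth_map_carrier by metis

lemma local_map_cong:
  assumes "smooth_atlas A" "openin (atlas_topology A) V" "x \<in> V" "\<And>y. y \<in> V \<Longrightarrow> s y = t y"
    and "local_map A B x s"
  shows "local_map A B x t"
proof -
  obtain V' where V': "openin (atlas_topology A) V'" "x \<in> V'" "smooth_map A B V' s"
    using assms(5) by (auto simp: local_map_def)
  have "openin (atlas_topology A) (V \<inter> V')"
    using assms V' by blast
  then have "smooth_map A B (V \<inter> V') t"
    by (intro smooth_map_cong[OF assms(1) smooth_map_subset[OF V'(3)]]) (use assms in auto)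
  then show ?thesis
    unfolding local_map_def using assms V' by blast
qed

lemma same_jet_sym: "same_jet A B n x s t \<Longrightarrow> same_jet A B n x t s"
  unfolding same_jet_def by (metis (no_types, lifting))

lemma same_jet_trans:
  "same_jet A B n x s t \<Longrightarrow> same_jet A B n x t u \<Longrightarrow> same_jet A B n x s u"
  unfolding same_jet_def by (metis (no_types, lifting))

lemma jet_eqI: "same_jet A B n x s t \<Longrightarrow> jet A B n x s = jet A B n x t"
  unfolding jet_def using same_jet_sym same_jet_trans by fast

text \<open>A local map belongs to its own jet, hence to every equal jet. The two target atlases may
  differ, which is what allows the fibre to be recovered from a fibrewise jet.\<close>

lemma jet_eqD:
  assumes "jet A B n x s = jet A B' n x' t" "local_map A B' x' t"
  shows "x = x'" "local_map A B x t" "same_jet A B n x s t"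
proof -
  show x: "x = x'"
    using assms by (simp add: jet_def)
  have "t \<in> {t. local_map A B' x' t \<and> same_jet A B' n x' t t}"
    using assms by (simp add: same_jet_def)
  then show "local_map A B x t" "same_jet A B n x s t"
    using assms(1) by (auto simp: jet_def)
qed

lemma same_jet_germ:
  assumes "smooth_atlas A" "openin (atlas_topology A) V" "x \<in> V" "\<And>y. y \<in> V \<Longrightarrow> s y = t y"
  shows "same_jet A B n x s t"
  unfolding same_jet_def
proof (intro conjI ballI impI allI)
  show "s x = t x" using assms by simp
  fix c d vs
  assume c: "c \<in> A" "x \<in> fst c"
  show "dir_deriv vs (local_rep c d s) (snd c x) = dir_deriv vs (local_rep c d t) (snd c x)"
  proof (rule dir_deriv_cong_open)
    show "open (snd c ` (V \<inter> fst c))"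
      using assms c openin_atlas by blast
    show "local_rep c d s p = local_rep c d t p" if "p \<in> snd c ` (V \<inter> fst c)" for p
      by (rule local_rep_cong[OF assms(1) c(1) _ that]) (simp add: assms)
  qed (use assms c in auto)
qed

text \<open>The coordinates are required to agree also outside the chart domains, where both are the
  junk value of \<open>inv\<close>; this spares restricting germs to chart domains.\<close>
definition corresponding_charts ::
  "('b, 'f) chart set \<Rightarrow> ('b \<Rightarrow> 'c) \<Rightarrow> ('b, 'f) chart \<Rightarrow> ('c, 'f) chart \<Rightarrow> bool" where
  "corresponding_charts B h d d' \<longleftrightarrow>
     (\<forall>p\<in>carrier_of B. (h p \<in> fst d' \<longleftrightarrow> p \<in> fst d) \<and> snd d' (h p) = snd d p)"

text \<open>Smoothness of a composite with \<open>h\<close> asks for a target chart to each source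
  chart; \<open>same_jet\<close> and the immersion condition quantify over all target charts and use
  the converse clause.\<close>

definition atlas_iso :: "('b, 'f) chart set \<Rightarrow> ('c, 'f) chart set \<Rightarrow> ('b \<Rightarrow> 'c) \<Rightarrow> bool" where
  "atlas_iso B B' h \<longleftrightarrow> (\<forall>d\<in>B. \<exists>d'\<in>B'. corresponding_charts B h d d') \<and>
     (\<forall>d'\<in>B'. \<exists>d\<in>B. corresponding_charts B h d d')"

lemma atlas_iso_carrier:
  assumes "atlas_iso B B' h" "p \<in> carrier_of B"
  shows "h p \<in> carrier_of B'"
proof -
  obtain d where "d \<in> B" "p \<in> fst d"
    using assms(2) by (auto simp: carrier_of_def)
  then show ?thesis
    using assms unfolding atlas_iso_def corresponding_charts_def carrier_of_def by blast
qed

lemma atlas_iso_compose: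
  assumes "atlas_iso B B' h" "atlas_iso B' B'' k"
  shows "atlas_iso B B'' (k \<circ> h)"
proof -
  have *: "corresponding_charts B (k \<circ> h) d d''"
    if "corresponding_charts B h d d'" "corresponding_charts B' k d' d''" for d d' d''
    using that atlas_iso_carrier[OF assms(1)] unfolding corresponding_charts_def by simp
  show ?thesis
    unfolding atlas_iso_def by (meson * assms atlas_iso_def)
qed

lemma atlas_iso_cong:
  assumes "atlas_iso B B' h" "\<And>p. p \<in> carrier_of B \<Longrightarrow> h p = k p"
  shows "atlas_iso B B' k"
  using assms by (simp add: atlas_iso_def corresponding_charts_def)

lemma smooth_map_atlas_iso:
  assumes "smooth_atlas A" "smooth_map A B V f" "atlas_iso B B' h"
  shows "smooth_map A B' V (h \<circ> f)"
  unfolding smooth_map_def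
proof
  fix x assume x: "x \<in> V"
  then obtain c d W where W: "c \<in> A" "d \<in> B" "openin (atlas_topology A) W" "x \<in> W"
    "W \<subseteq> V \<inter> fst c" "f ` W \<subseteq> fst d" and sm: "smooth_on (snd c ` W) (local_rep c d f)"
    using assms(2) unfolding smooth_map_def by meson
  obtain d' where d': "d' \<in> B'" "corresponding_charts B h d d'"
    using assms(3) W(2) unfolding atlas_iso_def by blast
  have *: "h (f y) \<in> fst d' \<and> snd d (f y) = snd d' (h (f y))" if "y \<in> W" for y
    using that W d' smooth_map_carrier[OF assms(2), of y]
    by (auto simp: corresponding_charts_def)
  have "smooth_on (snd c ` W) (local_rep c d' (h \<circ> f))"
    by (rule smooth_on_cong[OF sm])
      (use open_chart_image[OF assms(1) W(3,1)] W * in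
        \<open>auto intro!: local_rep_cong[OF assms(1), where V = W]\<close>)
  then show "\<exists>c\<in>A. \<exists>d\<in>B'. \<exists>W. openin (atlas_topology A) W \<and> x \<in> W \<and>
        W \<subseteq> V \<inter> fst c \<and> (h \<circ> f) ` W \<subseteq> fst d \<and> smooth_on (snd c ` W) (local_rep c d (h \<circ> f))"
    using W d' * by (intro bexI[of _ c] bexI[of _ d'] exI[of _ W]) auto
qed

lemma local_map_atlas_iso:
  "smooth_atlas A \<Longrightarrow> local_map A B x s \<Longrightarrow> atlas_iso B B' h \<Longrightarrow> local_map A B' x (h \<circ> s)"
  unfolding local_map_def by (meson smooth_map_atlas_iso)

lemma local_rep_atlas_iso:
  assumes "smooth_atlas A" "smooth_map A B V f" "c \<in> A"
    and "corresponding_charts B h d d'" "p \<in> snd c ` (V \<inter> fst c)"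
  shows "local_rep c d' (h \<circ> f) p = local_rep c d f p"
  by (rule local_rep_cong[OF assms(1,3) _ assms(5)])
    (use assms smooth_map_carrier in \<open>fastforce simp: corresponding_charts_def\<close>)

text \<open>In corresponding charts \<open>h \<circ> s\<close> and \<open>s\<close> have the same
  local representative near \<open>x\<close>, so nothing has to be differentiated through
  \<open>h\<close>.\<close>

lemma same_jet_atlas_iso:
  assumes A: "smooth_atlas A" and h: "atlas_iso B B' h"
    and s: "local_map A B x s" and t: "local_map A B x t" and st: "same_jet A B n x s t"
  shows "same_jet A B' n x (h \<circ> s) (h \<circ> t)"
  unfolding same_jet_def
proof (intro conjI ballI impI allI)
  show "(h \<circ> s) x = (h \<circ> t) x"
    using st by (simp add: same_jet_def)
  obtain V1 V2 where V: "openin (atlas_topology A) V1" "x \<in> V1" "smooth_map A B V1 s"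
      "openin (atlas_topology A) V2" "x \<in> V2" "smooth_map A B V2 t"
    using s t unfolding local_map_def by blast
  fix c d' vs
  assume c: "c \<in> A" "x \<in> fst c" and d': "d' \<in> B'" "(h \<circ> s) x \<in> fst d'"
    and vs: "length (vs :: 'b list) \<le> n"
  obtain d where d: "d \<in> B" "corresponding_charts B h d d'"
    using h d' unfolding atlas_iso_def by blast
  then have "s x \<in> fst d"
    using d' local_map_carrier[OF s] by (simp add: corresponding_charts_def)
  then have "dir_deriv vs (local_rep c d s) (snd c x) = dir_deriv vs (local_rep c d t) (snd c x)"
    using st c d vs by (simp add: same_jet_def)
  moreover have "dir_deriv vs (local_rep c d' (h \<circ> f)) (snd c x) = dir_deriv vs (local_rep c d f) (snd c x)"
    if "openin (atlas_topology A) V" "x \<in> V" "smooth_map A B V f" for V f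
    by (rule dir_deriv_cong_open[OF _ _ local_rep_atlas_iso[OF A that(3) c(1) d(2)]])
      (use A that c openin_atlas in auto)
  ultimately show "dir_deriv vs (local_rep c d' (h \<circ> s)) (snd c x) =
      dir_deriv vs (local_rep c d' (h \<circ> t)) (snd c x)"
    using V by metis
qed

lemma chart_diff_atlas_iso:
  assumes "smooth_atlas A" "openin (atlas_topology A) V" "smooth_map A B V f" "c \<in> A"
    and "corresponding_charts B h d d'" "x \<in> V" "x \<in> fst c"
  shows "chart_diff c d' (h \<circ> f) x = chart_diff c d f x"
  unfolding chart_diff_def
  by (rule frechet_derivative_cong_open[OF _ _ local_rep_atlas_iso[OF assms(1,3-5)]])
    (use assms openin_atlas in auto)

section \<open>Lagrangian planes in coordinates\<close>

definition vec4 :: "real \<Rightarrow> real \<Rightarrow> real \<Rightarrow> real \<Rightarrow> real^4" where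
  "vec4 a b c d = (\<chi> i. if i = 1 then a else if i = 2 then b else if i = 3 then c else d)"

lemma vec4_nth [simp]:
  "vec4 a b c d $ 1 = a" "vec4 a b c d $ 2 = b" "vec4 a b c d $ 3 = c" "vec4 a b c d $ 4 = d"
  by (simp_all add: vec4_def)

definition frame_comb :: "(4 \<Rightarrow> 'v::euclidean_space) \<Rightarrow> real^4 \<Rightarrow> 'v" where
  "frame_comb b x = (\<Sum>i\<in>UNIV. x $ i *\<^sub>R b i)"

lemma frame_comb_4: "frame_comb b x = x$1 *\<^sub>R b 1 + x$2 *\<^sub>R b 2 + x$3 *\<^sub>R b 3 + x$4 *\<^sub>R b 4"
  by (simp add: frame_comb_def sum_4)

lemma linear_frame_comb: "linear (frame_comb b)"
  by (rule linearI) (simp_all add: frame_comb_def scaleR_left_distrib sum.distrib scaleR_sum_right)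

lemma span_pair: "span {u, v} = {\<alpha> *\<^sub>R u + \<beta> *\<^sub>R v | \<alpha> \<beta>. True}"
proof -
  have "x \<in> span {u, v} \<longleftrightarrow> (\<exists>\<alpha> \<beta>. x - \<alpha> *\<^sub>R u = \<beta> *\<^sub>R v)" for x
    by (auto simp: span_insert[of u] span_singleton)
  then have "x \<in> span {u, v} \<longleftrightarrow> (\<exists>\<alpha> \<beta>. x = \<alpha> *\<^sub>R u + \<beta> *\<^sub>R v)" for x
    by (simp add: diff_eq_eq add.commute)
  then show ?thesis by auto
qed

lemma lagr_plane_eq:
  "lagr_plane b m =
    frame_comb b ` {x. x$3 = m$1 * x$1 + m$2 * x$2 \<and> x$4 = m$2 * x$1 + m$3 * x$2}"
proof -
  have "\<exists>x. v = frame_comb b x \<and> x$3 = m$1 * x$1 + m$2 * x$2 \<and> x$4 = m$2 * x$1 + m$3 * x$2"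
    if v: "v = \<alpha> *\<^sub>R (b 1 + m$1 *\<^sub>R b 3 + m$2 *\<^sub>R b 4) + \<beta> *\<^sub>R (b 2 + m$2 *\<^sub>R b 3 + m$3 *\<^sub>R b 4)"
    for v \<alpha> \<beta>
    by (rule exI[of _ "vec4 \<alpha> \<beta> (m$1 * \<alpha> + m$2 * \<beta>) (m$2 * \<alpha> + m$3 * \<beta>)"])
      (simp add: v frame_comb_4 algebra_simps)
  moreover have "frame_comb b x =
      x$1 *\<^sub>R (b 1 + m$1 *\<^sub>R b 3 + m$2 *\<^sub>R b 4) + x$2 *\<^sub>R (b 2 + m$2 *\<^sub>R b 3 + m$3 *\<^sub>R b 4)"
    if "x$3 = m$1 * x$1 + m$2 * x$2" "x$4 = m$2 * x$1 + m$3 * x$2" for x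
    using that by (simp add: frame_comb_4 algebra_simps)
  ultimately show ?thesis
    unfolding lagr_plane_def span_pair by blast
qed

lemma lagr_plane_linear_image:
  "linear A \<Longrightarrow> lagr_plane (A \<circ> b) m = A ` lagr_plane b m"
  by (simp add: lagr_plane_def linear_span_image[symmetric] linear_add linear_scale)

lemma std_form_eq: "std_form u v = u$1 * v$3 + u$2 * v$4 - u$3 * v$1 - u$4 * v$2"
  by (simp add: std_form_def Jmat_def inner_vec_def matrix_vector_mult_def sum_4)

lemma Jmat_entries:
  "Jmat$1$1 = 0" "Jmat$1$2 = 0" "Jmat$1$3 = 1" "Jmat$1$4 = 0"
  "Jmat$2$1 = 0" "Jmat$2$2 = 0" "Jmat$2$3 = 0" "Jmat$2$4 = 1"
  "Jmat$3$1 = -1" "Jmat$3$2 = 0" "Jmat$3$3 = 0" "Jmat$3$4 = 0"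
  "Jmat$4$1 = 0" "Jmat$4$2 = -1" "Jmat$4$3 = 0" "Jmat$4$4 = 0"
  by (simp_all add: Jmat_def)

lemma frame_comb_axis [simp]: "frame_comb b (axis i 1) = b i"
  by (simp add: frame_comb_def axis_def if_distrib[of "\<lambda>c. c *\<^sub>R _"] cong: if_cong)

lemma conf_sympl_basisI:
  assumes "\<And>x. frame_comb b x = 0 \<Longrightarrow> x = 0" "range (frame_comb b) = V"
    and "\<And>i j. \<omega> (b i) (b j) = \<rho> * Jmat$i$j"
  shows "conf_sympl_basis V \<omega> b"
proof -
  have inj: "inj b"
  proof (rule injI, rule ccontr)
    fix i j assume ij: "b i = b j" "i \<noteq> j"
    have "frame_comb b (axis i 1 - axis j 1) = 0"
      by (simp add: linear_diff[OF linear_frame_comb] ij)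
    then have "axis i (1::real) = axis j 1"
      using assms(1) by fastforce
    then show False
      using ij by (simp add: axis_eq_axis)
  qed
  have "independent (range b)"
  proof (rule independent_if_scalars_zero)
    fix f x assume f: "(\<Sum>v\<in>range b. f v *\<^sub>R v) = 0" and x: "x \<in> range b"
    have "frame_comb b (\<chi> i. f (b i)) = 0"
      using f by (simp add: frame_comb_def sum.reindex[OF inj])
    then have "(\<chi> i. f (b i)) = 0"
      by (rule assms(1))
    then show "f x = 0"
      using x by (auto simp: vec_eq_iff)
  qed simp
  moreover have "span (range b) = V"
  proof -
    have "range b \<subseteq> V"
      using assms(2) frame_comb_axis by (metis image_subsetI rangeI)
    moreover have "subspace V"
      using assms(2) linear_subspace_image[OF linear_frame_comb subspace_UNIV] by metis
    moreover have "frame_comb b x \<in> span (range b)" for x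
      unfolding frame_comb_def by (intro span_sum span_scale span_base) auto
    ultimately show ?thesis
      using assms(2) by (intro span_unique) (auto simp: span_minimal intro: subspace_span, metis rangeE span_minimal subsetD)
  qed
  ultimately show ?thesis
    unfolding conf_sympl_basis_def using inj assms(3) by blast
qed

lemma
  assumes "conf_sympl_basis V \<omega> b"
  shows frame_comb_basis_coords: "v \<in> V \<Longrightarrow> frame_comb b (basis_coords b v) = v"
    and frame_comb_eq_0: "frame_comb b x = 0 \<Longrightarrow> x = 0"
    and range_frame_comb: "range (frame_comb b) = V"
proof -
  have b: "inj b" "independent (range b)" "span (range b) = V"
    using assms by (auto simp: conf_sympl_basis_def)
  show *: "frame_comb b (basis_coords b v) = v" if "v \<in> V" for v
    using real_vector.sum_representation_eq[OF b(2), of v "range b"] that b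
    by (simp add: frame_comb_def basis_coords_def sum.reindex)
  show "x = 0" if "frame_comb b x = 0"
  proof -
    have "(\<Sum>v\<in>range b. x $ (inv b v) *\<^sub>R v) = 0"
      using that b by (simp add: frame_comb_def sum.reindex)
    then have "x $ (inv b v) = 0" if "v \<in> range b" for v
      using real_vector.independentD[OF b(2) finite_imageI[OF finite] subset_refl, of "\<lambda>v. x $ (inv b v)" v] that
      by simp
    from this[OF rangeI] show ?thesis
      using b(1) by (simp add: vec_eq_iff)
  qed
  have "frame_comb b x \<in> V" for x
    unfolding frame_comb_def b(3)[symmetric] by (intro span_sum span_scale span_base) auto
  then show "range (frame_comb b) = V"
    using * by (metis equalityI image_subsetI rangeI subsetI)
qed

lemma frame_comb_inject:
  "conf_sympl_basis V \<omega> b \<Longrightarrow> frame_comb b x = frame_comb b y \<longleftrightarrow> x = y"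
  using frame_comb_eq_0[of V \<omega> b "x - y"] by (auto simp: linear_diff[OF linear_frame_comb])

lemma frame_comb_in_lagr_plane:
  "conf_sympl_basis V \<omega> b \<Longrightarrow> frame_comb b x \<in> lagr_plane b m \<longleftrightarrow>
    x$3 = m$1 * x$1 + m$2 * x$2 \<and> x$4 = m$2 * x$1 + m$3 * x$2"
  by (auto simp: lagr_plane_eq image_iff frame_comb_inject)

lemma inj_lagr_plane:
  assumes "conf_sympl_basis V \<omega> b"
  shows "inj (lagr_plane b)"
proof (rule injI)
  fix m m' assume eq: "lagr_plane b m = lagr_plane b m'"
  have "frame_comb b (vec4 1 0 (m$1) (m$2)) \<in> lagr_plane b m"
    "frame_comb b (vec4 0 1 (m$2) (m$3)) \<in> lagr_plane b m"
    by (simp_all add: frame_comb_in_lagr_plane[OF assms])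
  then show "m = m'"
    unfolding eq by (simp add: frame_comb_in_lagr_plane[OF assms] vec_eq_iff forall_3)
qed

lemma inv_lagr_plane [simp]:
  "conf_sympl_basis V \<omega> b \<Longrightarrow> inv (lagr_plane b) (lagr_plane b m) = m"
  by (simp add: inj_lagr_plane)

lemma conf_sympl_basis_mem: "conf_sympl_basis V \<omega> b \<Longrightarrow> b i \<in> V"
  unfolding conf_sympl_basis_def by (metis rangeI span_base)

lemma dim_lagr_plane_le: "dim (lagr_plane b m) \<le> 2"
proof -
  have "dim (lagr_plane b m) \<le> card {b 1 + m$1 *\<^sub>R b 3 + m$2 *\<^sub>R b 4, b 2 + m$2 *\<^sub>R b 3 + m$3 *\<^sub>R b 4}"
    unfolding lagr_plane_def by (rule span_card_ge_dim) (auto intro: span_base)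
  also have "\<dots> \<le> 2"
    by (simp add: card_insert_if)
  finally show ?thesis .
qed

lemma independent_pairI:
  fixes u v :: "'w::euclidean_space"
  assumes "\<forall>\<alpha> \<beta>. \<alpha> *\<^sub>R u + \<beta> *\<^sub>R v = 0 \<longrightarrow> \<alpha> = 0 \<and> \<beta> = 0"
  shows "u \<noteq> v" "independent {u, v}"
proof -
  show ne: "u \<noteq> v"
    using assms[THEN spec, of 1, THEN spec, of "-1"] by auto
  show "independent {u, v}"
  proof (rule independent_if_scalars_zero)
    fix f x assume "(\<Sum>w\<in>{u, v}. f w *\<^sub>R w) = 0" "x \<in> {u, v}"
    then show "f x = 0"
      using assms[THEN spec, of "f u", THEN spec, of "f v"] ne by auto
  qed simp
qed

lemma independent_pairD:
  fixes u v :: "'w::euclidean_space"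
  assumes "independent {u, v}" "u \<noteq> v" "\<alpha> *\<^sub>R u + \<beta> *\<^sub>R v = 0"
  shows "\<alpha> = 0 \<and> \<beta> = 0"
  using real_vector.independentD[OF assms(1), of "{u, v}" "\<lambda>w. if w = u then \<alpha> else \<beta>"] assms(2,3)
  by force

text \<open>The form lives on the ambient space, nondegeneracy on \<open>V\<close> only: on all of
  \<open>J1\<close> the form \<open>\<eta> \<xi>\<close> has the z-direction in its kernel.\<close>

locale sympl_space =
  fixes V :: "'v::euclidean_space set" and \<omega> :: "'v \<Rightarrow> 'v \<Rightarrow> real"
  assumes bilinear_form: "bilinear \<omega>"
    and alternating: "\<omega> v v = 0"
    and nondegenerate: "v \<in> V \<Longrightarrow> (\<And>w. w \<in> V \<Longrightarrow> \<omega> v w = 0) \<Longrightarrow> v = 0"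
begin

lemma form_simps:
  "\<omega> (u + v) w = \<omega> u w + \<omega> v w" "\<omega> u (v + w) = \<omega> u v + \<omega> u w"
  "\<omega> (c *\<^sub>R u) v = c * \<omega> u v" "\<omega> u (c *\<^sub>R v) = c * \<omega> u v"
  "\<omega> (- u) v = - \<omega> u v" "\<omega> u (- v) = - \<omega> u v"
  using bilinear_ladd[OF bilinear_form] bilinear_radd[OF bilinear_form]
    bilinear_lmul[OF bilinear_form] bilinear_rmul[OF bilinear_form]
    bilinear_lneg[OF bilinear_form] bilinear_rneg[OF bilinear_form] by auto

lemma skew: "\<omega> u v = - \<omega> v u"
proof -
  have "\<omega> u v + \<omega> v u = 0"
    using alternating[of "u + v"] unfolding form_simps(1,2) by (simp add: alternating)
  then show ?thesis by linarith
qed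

text \<open>\<open>conf_sympl_basis\<close> does not exclude the factor 0. Nondegeneracy does,
  because a vanishing factor would make the nonzero vector \<open>b 1\<close> orthogonal to all of
  \<open>V\<close>.\<close>

lemma form_frame_comb:
  assumes "conf_sympl_basis V \<omega> b"
  obtains \<rho> where "\<rho> \<noteq> 0" "\<And>i j. \<omega> (b i) (b j) = \<rho> * Jmat$i$j"
    "\<And>x y. \<omega> (frame_comb b x) (frame_comb b y) = \<rho> * std_form x y"
proof -
  obtain \<rho> where \<rho>: "\<And>i j. \<omega> (b i) (b j) = \<rho> * Jmat$i$j"
    using assms by (auto simp: conf_sympl_basis_def)
  have eq: "\<omega> (frame_comb b x) (frame_comb b y) = \<rho> * std_form x y" for x y
    by (simp add: frame_comb_4 form_simps \<rho> Jmat_entries std_form_eq algebra_simps)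
  have "\<rho> \<noteq> 0"
  proof
    assume "\<rho> = 0"
    then have "\<omega> (b 1) w = 0" if "w \<in> V" for w
      using eq[of "axis 1 1"] range_frame_comb[OF assms] that by auto
    then have "b 1 = 0"
      by (intro nondegenerate conf_sympl_basis_mem[OF assms])
    then have "axis (1::4) (1::real) = 0"
      using frame_comb_eq_0[OF assms, of "axis 1 1"] by simp
    then show False
      by (simp add: axis_eq_0_iff)
  qed
  then show thesis
    using that \<rho> eq by blast
qed

text \<open>Up to the square of the conformal factor this is the determinant of the first two
  coordinates of \<open>u\<close> and \<open>v\<close>, nonzero exactly when they span a plane
  transverse to \<open>span {b 3, b 4}\<close>. Written with the form, it visibly depends smoothly
  on a frame.\<close>

definition minor :: "(4 \<Rightarrow> 'v) \<Rightarrow> 'v \<Rightarrow> 'v \<Rightarrow> real" where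
  "minor b u v = \<omega> u (b 3) * \<omega> v (b 4) - \<omega> u (b 4) * \<omega> v (b 3)"

text \<open>Cramer's rule for the symmetric matrix of the plane spanned by \<open>u\<close> and \<open>v\<close>.  Up to the
  common factor of the form on \<open>b\<close>, the four coordinates of \<open>u\<close> are \<open>\<omega> u (b 3)\<close>,
  \<open>\<omega> u (b 4)\<close>, \<open>\<omega> (b 1) u\<close> and \<open>\<omega> (b 2) u\<close>.\<close>
definition slope :: "(4 \<Rightarrow> 'v) \<Rightarrow> 'v \<Rightarrow> 'v \<Rightarrow> real^3" where
  "slope b u v = (\<chi> k. (if k = 1 then \<omega> (b 1) u * \<omega> v (b 4) - \<omega> (b 1) v * \<omega> u (b 4)
     else if k = 2 then \<omega> u (b 3) * \<omega> (b 1) v - \<omega> v (b 3) * \<omega> (b 1) u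
     else \<omega> u (b 3) * \<omega> (b 2) v - \<omega> v (b 3) * \<omega> (b 2) u) / minor b u v)"

lemma form_basis_coords:
  assumes "\<And>x y. \<omega> (frame_comb b x) (frame_comb b y) = \<rho> * std_form x y"
  shows "\<omega> (frame_comb b y) (b 3) = \<rho> * y$1" "\<omega> (frame_comb b y) (b 4) = \<rho> * y$2"
    "\<omega> (b 1) (frame_comb b y) = \<rho> * y$3" "\<omega> (b 2) (frame_comb b y) = \<rho> * y$4"
proof -
  have "std_form y (axis 3 1) = y$1" "std_form y (axis 4 1) = y$2"
    "std_form (axis 1 1) y = y$3" "std_form (axis 2 1) y = y$4"
    by (simp_all add: std_form_eq axis_def)
  then show "\<omega> (frame_comb b y) (b 3) = \<rho> * y$1" "\<omega> (frame_comb b y) (b 4) = \<rho> * y$2"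
    "\<omega> (b 1) (frame_comb b y) = \<rho> * y$3" "\<omega> (b 2) (frame_comb b y) = \<rho> * y$4"
    using assms[of y "axis 3 1"] assms[of y "axis 4 1"] assms[of "axis 1 1" y] assms[of "axis 2 1" y]
    by simp_all
qed

lemma span_eq_lagr_plane:
  assumes b: "conf_sympl_basis V \<omega> b" and uv: "u \<in> V" "v \<in> V" "\<omega> u v = 0"
    and D: "minor b u v \<noteq> 0"
  shows "span {u, v} = lagr_plane b (slope b u v)"
proof -
  obtain \<rho> where \<rho>: "\<rho> \<noteq> 0"
    "\<And>x y. \<omega> (frame_comb b x) (frame_comb b y) = \<rho> * std_form x y"
    using form_frame_comb[OF b] by metis
  obtain y z where y: "u = frame_comb b y" and z: "v = frame_comb b z"
    using uv range_frame_comb[OF b] by blast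
  note co = form_basis_coords[OF \<rho>(2)]
  have D': "y$1 * z$2 - y$2 * z$1 \<noteq> 0"
    using D \<rho>(1) by (auto simp: minor_def y z co algebra_simps)
  have mnr: "minor b u v = \<rho> * \<rho> * (y$1 * z$2 - y$2 * z$1)"
    by (simp add: minor_def y z co algebra_simps)
  have iso: "y$1 * z$3 + y$2 * z$4 = y$3 * z$1 + y$4 * z$2"
    using uv(3) \<rho> by (simp add: y z std_form_eq)
  have sl: "slope b u v $ 1 = (y$3 * z$2 - z$3 * y$2) / (y$1 * z$2 - y$2 * z$1)"
    "slope b u v $ 2 = (y$1 * z$3 - z$1 * y$3) / (y$1 * z$2 - y$2 * z$1)"
    "slope b u v $ 3 = (y$1 * z$4 - z$1 * y$4) / (y$1 * z$2 - y$2 * z$1)"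
  proof -
    have *: "(\<rho> * r * (\<rho> * s) - \<rho> * t * (\<rho> * w)) / minor b u v =
        (r * s - t * w) / (y$1 * z$2 - y$2 * z$1)" for r s t w
    proof -
      have "\<rho> * r * (\<rho> * s) - \<rho> * t * (\<rho> * w) = \<rho> * \<rho> * (r * s - t * w)"
        by algebra
      then show ?thesis
        unfolding mnr using \<rho>(1) by (simp only: mult_divide_mult_cancel_left mult_eq_0_iff simp_thms)
    qed
    show "slope b u v $ 1 = (y$3 * z$2 - z$3 * y$2) / (y$1 * z$2 - y$2 * z$1)"
      "slope b u v $ 2 = (y$1 * z$3 - z$1 * y$3) / (y$1 * z$2 - y$2 * z$1)"
      "slope b u v $ 3 = (y$1 * z$4 - z$1 * y$4) / (y$1 * z$2 - y$2 * z$1)"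
      unfolding *[symmetric] by (simp_all add: slope_def y z co)
  qed
  have "u \<in> lagr_plane b (slope b u v)" "v \<in> lagr_plane b (slope b u v)"
  proof -
    \<comment> \<open>The fourth coordinates need isotropy: Cramer's rule yields the two
      off-diagonal entries separately, \<open>slope\<close> keeps the one from the third
      coordinates, and \<open>iso\<close> says that they coincide.\<close>
    have "y$4 * (y$1 * z$2 - y$2 * z$1) = (y$1 * z$3 - z$1 * y$3) * y$1 + (y$1 * z$4 - z$1 * y$4) * y$2"
      "z$4 * (y$1 * z$2 - y$2 * z$1) = (y$1 * z$3 - z$1 * y$3) * z$1 + (y$1 * z$4 - z$1 * y$4) * z$2"
      using iso by algebra+
    then have "y$4 = slope b u v $ 2 * y$1 + slope b u v $ 3 * y$2"
      "z$4 = slope b u v $ 2 * z$1 + slope b u v $ 3 * z$2"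
      unfolding sl using D' by (simp_all add: divide_simps)
    moreover have "y$3 * (y$1 * z$2 - y$2 * z$1) = (y$3 * z$2 - z$3 * y$2) * y$1 + (y$1 * z$3 - z$1 * y$3) * y$2"
      "z$3 * (y$1 * z$2 - y$2 * z$1) = (y$3 * z$2 - z$3 * y$2) * z$1 + (y$1 * z$3 - z$1 * y$3) * z$2"
      by algebra+
    then have "y$3 = slope b u v $ 1 * y$1 + slope b u v $ 2 * y$2"
      "z$3 = slope b u v $ 1 * z$1 + slope b u v $ 2 * z$2"
      unfolding sl using D' by (simp_all add: divide_simps)
    ultimately show "u \<in> lagr_plane b (slope b u v)" "v \<in> lagr_plane b (slope b u v)"
      unfolding y z using frame_comb_in_lagr_plane[OF b] by auto
  qed
  then have sub: "span {u, v} \<subseteq> lagr_plane b (slope b u v)"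
    by (simp add: lagr_plane_def span_minimal)
  have "\<alpha> = 0 \<and> \<beta> = 0" if "\<alpha> *\<^sub>R u + \<beta> *\<^sub>R v = 0" for \<alpha> \<beta>
  proof -
    have "\<alpha> *\<^sub>R y + \<beta> *\<^sub>R z = 0"
      using that frame_comb_eq_0[OF b]
      by (simp add: y z linear_add[OF linear_frame_comb] linear_scale[OF linear_frame_comb])
    then have e: "\<alpha> * y$1 + \<beta> * z$1 = 0" "\<alpha> * y$2 + \<beta> * z$2 = 0"
      by (auto simp: vec_eq_iff)
    have "\<alpha> * (y$1 * z$2 - y$2 * z$1) = 0" "\<beta> * (y$1 * z$2 - y$2 * z$1) = 0"
      using e by algebra+
    then show ?thesis using D' by simp
  qed
  then have "\<forall>\<alpha> \<beta>. \<alpha> *\<^sub>R u + \<beta> *\<^sub>R v = 0 \<longrightarrow> \<alpha> = 0 \<and> \<beta> = 0"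
    by blast
  from independent_pairI[OF this] have "dim (span {u, v}) = 2"
    by (simp add: dim_eq_card_independent)
  then show ?thesis
    using sub dim_lagr_plane_le by (intro subspace_dim_equal) (auto simp: lagr_plane_def)
qed

lemma minor_nonzero:
  assumes b: "conf_sympl_basis V \<omega> b" and uv: "u \<noteq> v" "independent {u, v}"
    and eq: "span {u, v} = lagr_plane b m"
  shows "minor b u v \<noteq> 0"
proof
  assume 0: "minor b u v = 0"
  obtain \<rho> where \<rho>: "\<rho> \<noteq> 0"
    "\<And>x y. \<omega> (frame_comb b x) (frame_comb b y) = \<rho> * std_form x y"
    using form_frame_comb[OF b] by metis
  have "u \<in> lagr_plane b m" "v \<in> lagr_plane b m"
    unfolding eq[symmetric] by (auto intro: span_base)
  then obtain y z where y: "u = frame_comb b y" "y$3 = m$1 * y$1 + m$2 * y$2" "y$4 = m$2 * y$1 + m$3 * y$2"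
    and z: "v = frame_comb b z" "z$3 = m$1 * z$1 + m$2 * z$2" "z$4 = m$2 * z$1 + m$3 * z$2"
    by (auto simp: lagr_plane_eq)
  have 0: "y$1 * z$2 = y$2 * z$1"
    using 0 \<rho>(1) by (auto simp: minor_def y(1) z(1) form_basis_coords[OF \<rho>(2)] algebra_simps)
  have dep: "\<alpha> = 0 \<and> \<beta> = 0" if "\<alpha> * y$1 + \<beta> * z$1 = 0" "\<alpha> * y$2 + \<beta> * z$2 = 0" for \<alpha> \<beta>
  proof -
    have "\<alpha> * y$3 + \<beta> * z$3 = 0" "\<alpha> * y$4 + \<beta> * z$4 = 0"
      using that unfolding y z by algebra+
    then have "\<alpha> *\<^sub>R y + \<beta> *\<^sub>R z = 0"
      using that by (simp add: vec_eq_iff forall_4)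
    then have "\<alpha> *\<^sub>R u + \<beta> *\<^sub>R v = 0"
      unfolding y(1) z(1) using linear_0[OF linear_frame_comb]
      by (metis linear_add[OF linear_frame_comb] linear_scale[OF linear_frame_comb])
    then show ?thesis
      using independent_pairD[OF uv(2,1)] by blast
  qed
  \<comment> \<open>The combinations of \<open>u\<close> and \<open>v\<close> with coefficients
    \<open>z$1, - y$1\<close> and \<open>z$2, - y$2\<close> have vanishing first two coordinates.
    Independence makes these four numbers 0, and then \<open>u\<close> itself is such a
    combination.\<close>
  show False
    using dep[of "z$1" "- y$1"] dep[of "z$2" "- y$2"] dep[of 1 0] 0 by (auto simp: algebra_simps)
qed

lemma lagr_plane_basis:
  fixes m :: "real^3"
  assumes b: "conf_sympl_basis V \<omega> b"
  defines "u \<equiv> b 1 + m$1 *\<^sub>R b 3 + m$2 *\<^sub>R b 4" and "v \<equiv> b 2 + m$2 *\<^sub>R b 3 + m$3 *\<^sub>R b 4"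
  shows "u \<noteq> v" "independent {u, v}" "u \<in> V" "v \<in> V" "\<omega> u v = 0"
proof -
  have u: "u = frame_comb b (vec4 1 0 (m$1) (m$2))" and v: "v = frame_comb b (vec4 0 1 (m$2) (m$3))"
    by (simp_all add: u_def v_def frame_comb_4)
  show "u \<in> V" "v \<in> V"
    unfolding u v using range_frame_comb[OF b] by auto
  show "\<omega> u v = 0"
    unfolding u v by (rule form_frame_comb[OF b]) (simp add: std_form_eq)
  have "\<alpha> = 0 \<and> \<beta> = 0" if "\<alpha> *\<^sub>R u + \<beta> *\<^sub>R v = 0" for \<alpha> \<beta>
  proof -
    have "\<alpha> *\<^sub>R vec4 1 0 (m$1) (m$2) + \<beta> *\<^sub>R vec4 0 1 (m$2) (m$3) = 0"
      using that frame_comb_eq_0[OF b] unfolding u v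
      by (metis linear_add[OF linear_frame_comb] linear_scale[OF linear_frame_comb])
    then show ?thesis
      by (simp add: vec_eq_iff forall_4)
  qed
  then have "\<forall>\<alpha> \<beta>. \<alpha> *\<^sub>R u + \<beta> *\<^sub>R v = 0 \<longrightarrow> \<alpha> = 0 \<and> \<beta> = 0"
    by blast
  from independent_pairI[OF this] show "u \<noteq> v" "independent {u, v}" by auto
qed

lemma lagr_plane_in_LG:
  assumes "conf_sympl_basis V \<omega> b"
  shows "lagr_plane b m \<in> LG V \<omega>"
proof -
  have "subspace V"
    using range_frame_comb[OF assms] linear_subspace_image[OF linear_frame_comb subspace_UNIV] by metis
  moreover define u v where "u = b 1 + m$1 *\<^sub>R b 3 + m$2 *\<^sub>R b 4"
    and "v = b 2 + m$2 *\<^sub>R b 3 + m$3 *\<^sub>R b 4"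
  moreover have uv: "u \<noteq> v" "independent {u, v}" "u \<in> V" "v \<in> V" "\<omega> u v = 0"
    using lagr_plane_basis[OF assms, of m] unfolding u_def v_def by blast+
  moreover have "\<omega> x y = 0" if "x \<in> span {u, v}" "y \<in> span {u, v}" for x y
    using that uv(5) skew[of v u] by (auto simp: span_pair form_simps alternating)
  ultimately show ?thesis
    unfolding LG_def lagr_plane_def by (auto simp: span_minimal dim_eq_card_independent)
qed

text \<open>By the Pluecker relation four charts suffice to cover; the plane common to all of them
  makes the Lagrangian Grassmannian connected.\<close>
lemma LG_cover:
  assumes b: "conf_sympl_basis V \<omega> b" and L: "L \<in> LG V \<omega>"
  shows "\<exists>b'. conf_sympl_basis V \<omega> b' \<and> L \<in> range (lagr_plane b') \<and>
    span {b 1 + b 3, b 2 + b 4} \<in> range (lagr_plane b')"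
proof -
  obtain \<rho> where \<rho>: "\<rho> \<noteq> 0" "\<And>i j. \<omega> (b i) (b j) = \<rho> * Jmat$i$j"
    "\<And>x y. \<omega> (frame_comb b x) (frame_comb b y) = \<rho> * std_form x y"
    using form_frame_comb[OF b] by metis
  obtain B where B: "B \<subseteq> L" "independent B" "L \<subseteq> span B" "card B = dim L"
    using basis_exists by blast
  then have "card B = 2"
    using L by (simp add: LG_def)
  then obtain u v where uv: "B = {u, v}" "u \<noteq> v"
    by (meson card_2_iff)
  have Lsp: "L = span {u, v}"
  proof
    show "L \<subseteq> span {u, v}"
      using B(3) uv by simp
    show "span {u, v} \<subseteq> L"
      using L B(1) uv by (intro span_minimal) (auto simp: LG_def)
  qed
  have uvV: "u \<in> V" "v \<in> V" "\<omega> u v = 0"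
    using L B uv by (auto simp: LG_def)
  obtain y z where y: "u = frame_comb b y" and z: "v = frame_comb b z"
    using uvV range_frame_comb[OF b] by blast
  \<comment> \<open>Optional quarter turns in the planes of \<open>b 1, b 3\<close> and of
    \<open>b 2, b 4\<close>; they turn the complement \<open>span {b 3, b 4}\<close> into each of
    the four coordinate Lagrangian planes.\<close>
  define swap where "swap s t = (\<lambda>i::4. if i = 1 then (if s then b 3 else b 1)
    else if i = 2 then (if t then b 4 else b 2)
    else if i = 3 then (if s then - b 1 else b 3) else (if t then - b 2 else b 4))" for s t :: bool
  have csb: "conf_sympl_basis V \<omega> (swap s t)" for s t
  proof (rule conf_sympl_basisI)
    let ?r = "\<lambda>x::real^4. vec4 (if s then - x$3 else x$1) (if t then - x$4 else x$2)
      (if s then x$1 else x$3) (if t then x$2 else x$4)"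
    let ?r' = "\<lambda>x::real^4. vec4 (if s then x$3 else x$1) (if t then x$4 else x$2)
      (if s then - x$1 else x$3) (if t then - x$2 else x$4)"
    have r: "frame_comb (swap s t) x = frame_comb b (?r x)" for x
      by (simp add: frame_comb_4 swap_def)
    show "x = 0" if "frame_comb (swap s t) x = 0" for x
      using frame_comb_eq_0[OF b, of "?r x"] that unfolding r
      by (cases s; cases t) (auto simp: vec_eq_iff forall_4)
    have "?r (?r' x) = x" for x
      by (cases s; cases t) (auto simp: vec_eq_iff forall_4)
    then have "frame_comb b x \<in> range (frame_comb (swap s t))" for x
      using r[of "?r' x"] by (metis rangeI)
    then show "range (frame_comb (swap s t)) = V"
      using r range_frame_comb[OF b] by auto
    show "\<omega> (swap s t i) (swap s t j) = \<rho> * Jmat$i$j" for i j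
      using exhaust_4[of i] exhaust_4[of j]
      by (elim disjE; cases s; cases t) (simp_all add: swap_def form_simps \<rho>(2) Jmat_entries)
  qed
  have star: "span {b 1 + b 3, b 2 + b 4} \<in> range (lagr_plane (swap s t))" for s t
  proof -
    \<comment> \<open>A quarter turn changes the slope of the line through \<open>b 1 + b 3\<close>
      from 1 to -1, and likewise for \<open>b 2 + b 4\<close>; it never becomes infinite, so the
      plane lies in all four charts.\<close>
    have "lagr_plane (swap s t) (vector [if s then -1 else 1, 0, if t then -1 else 1]) =
        span {b 1 + b 3, b 2 + b 4}"
      by (cases s; cases t) (simp_all add: lagr_plane_def swap_def add.commute)
    then show ?thesis by (metis rangeI)
  qed
  have "\<exists>s t. minor (swap s t) u v \<noteq> 0"
  proof (rule ccontr)
    assume "\<nexists>s t. minor (swap s t) u v \<noteq> 0"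
    then have 0: "minor (swap s t) u v = 0" for s t by blast
    have "\<omega> u (b 1) = - \<rho> * y$3" "\<omega> u (b 2) = - \<rho> * y$4" "\<omega> v (b 1) = - \<rho> * z$3" "\<omega> v (b 2) = - \<rho> * z$4"
      using skew[of u] skew[of v] by (simp_all add: y z form_basis_coords[OF \<rho>(3)])
    note co = this form_basis_coords[OF \<rho>(3), of y, folded y] form_basis_coords[OF \<rho>(3), of z, folded z]
    have p: "y$1 * z$2 = y$2 * z$1" "y$3 * z$2 = y$2 * z$3" "y$1 * z$4 = y$4 * z$1" "y$3 * z$4 = y$4 * z$3"
      using 0[of False False] 0[of True False] 0[of False True] 0[of True True] \<rho>(1)
      by (auto simp: minor_def swap_def form_simps co algebra_simps)
    have iso: "y$1 * z$3 + y$2 * z$4 = y$3 * z$1 + y$4 * z$2"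
      using uvV(3) \<rho> by (simp add: y z std_form_eq)
    \<comment> \<open>Four of the six Pluecker coordinates vanish by \<open>p\<close>. Isotropy
      makes the other two opposite to each other, and by the Pluecker relation their product is
      0.\<close>
    have "(y$1 * z$3 - y$3 * z$1) * (y$1 * z$3 - y$3 * z$1) = 0"
      using p iso by algebra
    then have q: "y$1 * z$3 = y$3 * z$1" "y$2 * z$4 = y$4 * z$2"
      using iso by auto
    have m: "y$i * z$j = y$j * z$i" for i j
      using exhaust_4[of i] exhaust_4[of j] p q by (elim disjE; simp)
    have "u \<noteq> 0"
      using B(2) uv(1) dependent_zero by blast
    then have "y \<noteq> 0"
      using linear_0[OF linear_frame_comb] y by metis
    then obtain k where k: "y$k \<noteq> 0"
      by (auto simp: vec_eq_iff)
    have "z$k *\<^sub>R y + (- y$k) *\<^sub>R z = 0"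
      using m[of _ k] by (simp add: vec_eq_iff algebra_simps)
    then have "z$k *\<^sub>R u + (- y$k) *\<^sub>R v = 0"
      unfolding y z using linear_0[OF linear_frame_comb]
      by (metis linear_add[OF linear_frame_comb] linear_scale[OF linear_frame_comb])
    then have "- y$k = 0"
      using independent_pairD[OF _ uv(2)] B(2) uv(1) by blast
    then show False
      using k by simp
  qed
  then show ?thesis
    using span_eq_lagr_plane[OF csb uvV] csb star Lsp by (metis rangeI)
qed

end

section \<open>Conformal symplectic isomorphisms\<close>

definition conf_iso ::
  "'v::euclidean_space set \<Rightarrow> ('v \<Rightarrow> 'v \<Rightarrow> real) \<Rightarrow> 'w::euclidean_space set \<Rightarrow>
   ('w \<Rightarrow> 'w \<Rightarrow> real) \<Rightarrow> ('v \<Rightarrow> 'w) \<Rightarrow> bool" where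
  "conf_iso V \<omega> V' \<omega>' A \<longleftrightarrow> linear A \<and> inj_on A V \<and> A ` V = V' \<and>
     (\<exists>\<mu>. \<mu> \<noteq> 0 \<and> (\<forall>u\<in>V. \<forall>v\<in>V. \<omega>' (A u) (A v) = \<mu> * \<omega> u v))"

lemma frame_comb_linear: "linear A \<Longrightarrow> frame_comb (A \<circ> b) x = A (frame_comb b x)"
  by (simp add: frame_comb_def linear_sum linear_scale)

lemma conf_iso_basis:
  assumes A: "conf_iso V \<omega> V' \<omega>' A" and b: "conf_sympl_basis V \<omega> b"
  shows "conf_sympl_basis V' \<omega>' (A \<circ> b)"
proof -
  have l: "linear A" using A by (simp add: conf_iso_def)
  obtain \<mu> where \<mu>: "\<forall>u\<in>V. \<forall>v\<in>V. \<omega>' (A u) (A v) = \<mu> * \<omega> u v"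
    using A unfolding conf_iso_def by blast
  obtain \<rho> where \<rho>: "\<And>i j. \<omega> (b i) (b j) = \<rho> * Jmat$i$j"
    using b unfolding conf_sympl_basis_def by blast
  show ?thesis
  proof (rule conf_sympl_basisI[where \<rho> = "\<mu> * \<rho>"])
    fix x assume "frame_comb (A \<circ> b) x = 0"
    then have "A (frame_comb b x) = A (frame_comb b 0)"
      by (simp add: frame_comb_linear[OF l] linear_0[OF l] linear_0[OF linear_frame_comb])
    moreover have "frame_comb b y \<in> V" for y
      using range_frame_comb[OF b] by blast
    ultimately have "frame_comb b x = frame_comb b 0"
      using A unfolding conf_iso_def by (meson inj_onD)
    then show "x = 0"
      by (simp add: frame_comb_inject[OF b])
  next
    have "range (frame_comb (A \<circ> b)) = A ` range (frame_comb b)"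
      by (auto simp: frame_comb_linear[OF l])
    then show "range (frame_comb (A \<circ> b)) = V'"
      using A range_frame_comb[OF b] by (simp add: conf_iso_def)
  next
    show "\<omega>' ((A \<circ> b) i) ((A \<circ> b) j) = \<mu> * \<rho> * Jmat$i$j" for i j
      using \<mu> \<rho> conf_sympl_basis_mem[OF b] by simp
  qed
qed

lemma conf_iso_inverse:
  assumes A: "conf_iso V \<omega> V' \<omega>' A" and V: "subspace V"
  obtains B where "conf_iso V' \<omega>' V \<omega> B" "\<And>v. v \<in> V \<Longrightarrow> B (A v) = v" "\<And>w. w \<in> V' \<Longrightarrow> A (B w) = w"
proof -
  have l: "linear A" "inj_on A V" "A ` V = V'" using A by (auto simp: conf_iso_def)
  obtain \<mu> where \<mu>: "\<mu> \<noteq> 0" "\<forall>u\<in>V. \<forall>v\<in>V. \<omega>' (A u) (A v) = \<mu> * \<omega> u v"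
    using A unfolding conf_iso_def by blast
  obtain B where B: "linear B" "\<forall>v\<in>V. B (A v) = v"
    using linear_inj_on_left_inverse[OF l(1), of V] l(2) V by (metis span_eq_iff)
  have AB: "A (B w) = w" "B w \<in> V" if "w \<in> V'" for w
    using that l(3) B(2) by auto
  have "conf_iso V' \<omega>' V \<omega> B"
    unfolding conf_iso_def
  proof (intro conjI exI[of _ "1 / \<mu>"] ballI)
    show "inj_on B V'" by (rule inj_on_inverseI[of _ A]) (rule AB(1))
    show "B ` V' = V" unfolding l(3)[symmetric] using B(2) by (simp add: image_image)
    show "\<omega> (B u) (B v) = 1 / \<mu> * \<omega>' u v" if "u \<in> V'" "v \<in> V'" for u v
      using \<mu>(2)[rule_format, OF AB(2)[OF that(1)] AB(2)[OF that(2)]] AB(1) that \<mu>(1) by simp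
  qed (use B \<mu> in auto)
  then show thesis
    using that B(2) AB by blast
qed

lemma conf_iso_compose:
  assumes A: "conf_iso V \<omega> V' \<omega>' A" and B: "conf_iso V' \<omega>' V'' \<omega>'' B"
  shows "conf_iso V \<omega> V'' \<omega>'' (B \<circ> A)"
proof -
  obtain \<mu> where \<mu>: "\<mu> \<noteq> 0" "\<forall>u\<in>V. \<forall>v\<in>V. \<omega>' (A u) (A v) = \<mu> * \<omega> u v"
    using A unfolding conf_iso_def by blast
  obtain \<nu> where \<nu>: "\<nu> \<noteq> 0" "\<forall>u\<in>V'. \<forall>v\<in>V'. \<omega>'' (B u) (B v) = \<nu> * \<omega>' u v"
    using B unfolding conf_iso_def by blast
  have AV: "A ` V = V'" "linear A" "linear B" "inj_on A V" "inj_on B V'" "B ` V' = V''"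
    using A B by (auto simp: conf_iso_def)
  show ?thesis
    unfolding conf_iso_def
  proof (intro conjI exI[of _ "\<nu> * \<mu>"] ballI)
    show "linear (B \<circ> A)" using AV by (simp add: linear_compose)
    show "inj_on (B \<circ> A) V" using AV by (simp add: comp_inj_on)
    show "(B \<circ> A) ` V = V''" using AV by (metis image_comp)
    show "\<omega>'' ((B \<circ> A) u) ((B \<circ> A) v) = \<nu> * \<mu> * \<omega> u v" if "u \<in> V" "v \<in> V" for u v
    proof -
      have "A u \<in> V'" "A v \<in> V'" using that AV(1) by auto
      then show ?thesis using \<mu>(2) \<nu>(2) that by simp
    qed
  qed (use \<mu> \<nu> in auto)
qed

lemma lagr_plane_subset: "conf_sympl_basis V \<omega> b \<Longrightarrow> lagr_plane b m \<subseteq> V"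
  by (auto simp: lagr_plane_eq dest: range_frame_comb)

lemma carrier_LG_atlas_Pow: "L \<in> carrier_of (LG_atlas V \<omega>) \<Longrightarrow> L \<subseteq> V"
  using lagr_plane_subset by (fastforce simp: carrier_of_def LG_atlas_def)

text \<open>The image of \<open>L\<close> has in the chart of \<open>A \<circ> b\<close> the
  coordinates that \<open>L\<close> has in the chart of \<open>b\<close>. Through the inverse
  isomorphism every chart of the target arises in this way.\<close>

lemma atlas_iso_LG:
  assumes A: "conf_iso V \<omega> V' \<omega>' A" and V: "subspace V"
  shows "atlas_iso (LG_atlas V \<omega>) (LG_atlas V' \<omega>') ((`) A)"
proof -
  have A': "linear A" "inj_on A V" using A by (auto simp: conf_iso_def)
  have corr: "corresponding_charts (LG_atlas V \<omega>) ((`) A) (range (lagr_plane b), inv (lagr_plane b))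
      (range (lagr_plane (A \<circ> b)), inv (lagr_plane (A \<circ> b)))" if b: "conf_sympl_basis V \<omega> b" for b
    unfolding corresponding_charts_def
  proof
    fix L assume "L \<in> carrier_of (LG_atlas V \<omega>)"
    \<comment> \<open>True also for \<open>L\<close> outside the chart; there it makes the two
      inverses the same choice, as \<open>corresponding_charts\<close> demands.\<close>
    then have "lagr_plane (A \<circ> b) m = A ` L \<longleftrightarrow> lagr_plane b m = L" for m
      using inj_on_image_eq_iff[OF A'(2) lagr_plane_subset[OF b] carrier_LG_atlas_Pow]
      by (simp add: lagr_plane_linear_image[OF A'(1)])
    then show "(A ` L \<in> fst (range (lagr_plane (A \<circ> b)), inv (lagr_plane (A \<circ> b)))
        \<longleftrightarrow> L \<in> fst (range (lagr_plane b), inv (lagr_plane b))) \<and>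
      snd (range (lagr_plane (A \<circ> b)), inv (lagr_plane (A \<circ> b))) (A ` L) =
        snd (range (lagr_plane b), inv (lagr_plane b)) L"
      by (auto simp: inv_into_def image_iff eq_commute)
  qed
  obtain B where B: "conf_iso V' \<omega>' V \<omega> B" "\<And>w. w \<in> V' \<Longrightarrow> A (B w) = w"
    using conf_iso_inverse[OF A V] by metis
  have "\<exists>b. conf_sympl_basis V \<omega> b \<and> A \<circ> b = b'" if "conf_sympl_basis V' \<omega>' b'" for b'
    using conf_iso_basis[OF B(1) that] B(2) conf_sympl_basis_mem[OF that]
    by (intro exI[of _ "B \<circ> b'"]) auto
  then show ?thesis
    using corr conf_iso_basis[OF A] unfolding atlas_iso_def LG_atlas_def by blast
qed

section \<open>Fibres as Lagrangian Grassmannians, and conformal coordinates\<close>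

lemma atlas_iso_snd: "atlas_iso (fibre_atlas \<xi>) (LG_atlas (contact_plane \<xi>) (\<eta> \<xi>)) snd"
proof -
  have "corresponding_charts (fibre_atlas \<xi>) snd ({\<xi>} \<times> fst c, snd c \<circ> snd) c" for c
    by (auto simp: corresponding_charts_def carrier_of_def fibre_atlas_def)
  then show ?thesis
    unfolding atlas_iso_def fibre_atlas_def by blast
qed

lemma atlas_iso_Pair: "atlas_iso (LG_atlas (contact_plane \<xi>) (\<eta> \<xi>)) (fibre_atlas \<xi>) (Pair \<xi>)"
proof -
  have "corresponding_charts (LG_atlas (contact_plane \<xi>) (\<eta> \<xi>)) (Pair \<xi>) c ({\<xi>} \<times> fst c, snd c \<circ> snd)" for c
    by (auto simp: corresponding_charts_def)
  then show ?thesis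
    unfolding atlas_iso_def fibre_atlas_def by blast
qed

lemma subspace_of_basis: "conf_sympl_basis V \<omega> b \<Longrightarrow> subspace V"
  unfolding conf_sympl_basis_def by (metis subspace_span)

text \<open>\<open>representation\<close> is 0 off the span of the basis, so
  \<open>basis_coords b\<close> is guaranteed to be linear on \<open>V\<close> only;
  \<open>A\<close> is linear on the ambient space and has the same values on
  \<open>V\<close>.\<close>

lemma (in sympl_space) conf_iso_basis_coords:
  assumes b: "conf_sympl_basis V \<omega> b"
  obtains A where "conf_iso V \<omega> UNIV std_form A" "\<And>v. v \<in> V \<Longrightarrow> A v = basis_coords b v"
proof -
  obtain \<rho> where \<rho>: "\<rho> \<noteq> 0" "\<And>x y. \<omega> (frame_comb b x) (frame_comb b y) = \<rho> * std_form x y"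
    using form_frame_comb[OF b] by metis
  have bb: "independent (range b)" "inj b"
    using b by (auto simp: conf_sympl_basis_def)
  obtain A where A: "linear A" "\<forall>v\<in>range b. A v = axis (inv b v) (1::real)"
    using linear_independent_extend[OF bb(1), of "\<lambda>v. axis (inv b v) 1"] by blast
  then have "A (b i) = axis i 1" for i
    using bb by simp
  then have Ax: "A (frame_comb b x) = x" for x
    using frame_comb_linear[OF A(1), of b x] by (simp add: frame_comb_def comp_def basis_expansion scalar_mult_eq_scaleR[symmetric])
  have V: "\<exists>x. v = frame_comb b x" if "v \<in> V" for v
    using that range_frame_comb[OF b] by blast
  have "conf_iso V \<omega> UNIV std_form A"
    unfolding conf_iso_def
  proof (intro conjI exI[of _ "1 / \<rho>"] ballI)
    show "inj_on A V"
    proof (rule inj_onI)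
      fix u v assume "u \<in> V" "v \<in> V" "A u = A v"
      then show "u = v" using V[of u] V[of v] Ax by auto
    qed
    have "x \<in> A ` V" for x
      using Ax[of x] range_frame_comb[OF b] by (metis imageI rangeI)
    then show "A ` V = UNIV" by blast
    show "std_form (A u) (A v) = 1 / \<rho> * \<omega> u v" if "u \<in> V" "v \<in> V" for u v
      using V[OF that(1)] V[OF that(2)] \<rho> by (auto simp: Ax)
  qed (use A \<rho> in auto)
  moreover have "A v = basis_coords b v" if "v \<in> V" for v
    using Ax[of "basis_coords b v"] frame_comb_basis_coords[OF b that] by simp
  ultimately show thesis
    using that by blast
qed

lemma conf_iso_CSp4:
  assumes "conf_iso UNIV std_form UNIV std_form h"
  shows "matrix h \<in> CSp4" "(*v) (matrix h) = h"
proof -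
  have h: "linear h" "inj h" using assms by (auto simp: conf_iso_def)
  then show v: "(*v) (matrix h) = h"
    by (simp add: matrix_works linear_matrix_vector_mul_eq fun_eq_iff)
  obtain \<mu> where \<mu>: "\<mu> \<noteq> 0" "\<And>u v. std_form (h u) (h v) = \<mu> * std_form u v"
    using assms unfolding conf_iso_def by blast
  have "transpose (matrix h) ** Jmat ** matrix h = \<mu> *\<^sub>R Jmat"
    unfolding matrix_eq
  proof (rule allI, rule vector_eq_ldot[THEN iffD1], rule allI)
    fix u v :: "real^4"
    have "u \<bullet> ((transpose (matrix h) ** Jmat ** matrix h) *v v) = (matrix h *v u) \<bullet> (Jmat *v (matrix h *v v))"
      unfolding matrix_vector_mul_assoc[symmetric]
      by (metis dot_lmul_matrix vector_transpose_matrix)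
    also have "\<dots> = \<mu> * std_form u v"
      using \<mu>(2)[of u v] by (simp add: v std_form_def)
    also have "\<dots> = u \<bullet> ((\<mu> *\<^sub>R Jmat) *v v)"
      by (simp add: std_form_def scaleR_matrix_vector_assoc[symmetric])
    finally show "u \<bullet> ((transpose (matrix h) ** Jmat ** matrix h) *v v) = u \<bullet> ((\<mu> *\<^sub>R Jmat) *v v)" .
  qed
  moreover have "invertible (matrix h)"
    using h by (metis invertible_left_inverse matrix_left_invertible_injective v)
  ultimately show "matrix h \<in> CSp4"
    unfolding CSp4_def using \<mu>(1) by blast
qed

section \<open>The contact planes\<close>

lemma \<sigma>_eq: "\<sigma> \<xi> (a, b, c, d, e) = c - fst (snd (snd (snd \<xi>))) * a - snd (snd (snd (snd \<xi>))) * b"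
  by (simp add: \<sigma>_def split: prod.split)

text \<open>This is dx \<and> dp + dy \<and> dq. Its coefficients are constant, which is why
  \<open>pullback_contact_form\<close> can leave the point \<zeta> arbitrary.\<close>

lemma \<eta>_eq: "\<eta> \<xi> (a, b, c, d, e) (a', b', c', d', e') = a * d' + b * e' - d * a' - e * b'"
proof -
  have "((\<lambda>\<zeta>. \<sigma> \<zeta> (a, b, c, d, e)) has_derivative
      (\<lambda>h. - fst (snd (snd (snd h))) * a - snd (snd (snd (snd h))) * b)) (at \<xi>)" for a b c d e
    unfolding \<sigma>_eq by (auto intro!: derivative_eq_intros)
  from frechet_derivative_at[OF this, symmetric] show ?thesis
    by (simp add: \<eta>_def ext_deriv_def)
qed

definition std_frame :: "J1 \<Rightarrow> 4 \<Rightarrow> J1" where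
  "std_frame \<xi> i = (if i = 1 then (1, 0, fst (snd (snd (snd \<xi>))), 0, 0)
     else if i = 2 then (0, 1, snd (snd (snd (snd \<xi>))), 0, 0)
     else if i = 3 then (0, 0, 0, 1, 0) else (0, 0, 0, 0, 1))"

lemma frame_comb_std_frame:
  "frame_comb (std_frame \<xi>) x =
    (x$1, x$2, fst (snd (snd (snd \<xi>))) * x$1 + snd (snd (snd (snd \<xi>))) * x$2, x$3, x$4)"
  by (simp add: frame_comb_4 std_frame_def)

lemma conf_sympl_basis_std_frame: "conf_sympl_basis (contact_plane \<xi>) (\<eta> \<xi>) (std_frame \<xi>)"
proof (rule conf_sympl_basisI[where \<rho> = 1])
  show "x = 0" if "frame_comb (std_frame \<xi>) x = 0" for x
    using that by (simp add: frame_comb_std_frame vec_eq_iff forall_4 zero_prod_def)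
  have "(a, b, c, d, e) \<in> range (frame_comb (std_frame \<xi>))" if "(a, b, c, d, e) \<in> contact_plane \<xi>" for a b c d e
    using that by (intro image_eqI[of _ _ "vec4 a b d e"])
      (simp_all add: frame_comb_std_frame contact_plane_def \<sigma>_eq)
  moreover have "frame_comb (std_frame \<xi>) x \<in> contact_plane \<xi>" for x
    by (simp add: frame_comb_std_frame contact_plane_def \<sigma>_eq)
  ultimately show "range (frame_comb (std_frame \<xi>)) = contact_plane \<xi>"
    by auto
  show "\<eta> \<xi> (std_frame \<xi> i) (std_frame \<xi> j) = 1 * Jmat$i$j" for i j
    using exhaust_4[of i] exhaust_4[of j]
    by (elim disjE) (simp_all add: std_frame_def \<eta>_eq Jmat_entries)
qed

interpretation contact: sympl_space "contact_plane \<xi>" "\<eta> \<xi>" for \<xi>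
proof
  show "bilinear (\<eta> \<xi>)"
    unfolding bilinear_def by (auto intro!: linearI simp: \<eta>_eq split_paired_all algebra_simps)
  show "\<eta> \<xi> v v = 0" for v
    by (cases v) (auto simp: \<eta>_eq)
  fix v assume v: "v \<in> contact_plane \<xi>" "\<And>w. w \<in> contact_plane \<xi> \<Longrightarrow> \<eta> \<xi> v w = 0"
  obtain x where x: "v = frame_comb (std_frame \<xi>) x"
    using v(1) range_frame_comb[OF conf_sympl_basis_std_frame] by blast
  have "\<eta> \<xi> v (std_frame \<xi> i) = 0" for i
    by (rule v(2)[OF conf_sympl_basis_mem[OF conf_sympl_basis_std_frame]])
  from this[of 1] this[of 2] this[of 3] this[of 4] have "x = 0"
    by (simp add: x frame_comb_std_frame std_frame_def \<eta>_eq vec_eq_iff forall_4)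
  then show "v = 0"
    by (simp add: x linear_0[OF linear_frame_comb])
qed

lemma fst_carrier_fibre: "P \<in> carrier_of (fibre_atlas \<xi>) \<Longrightarrow> fst P = \<xi>"
  by (auto simp: carrier_of_def fibre_atlas_def)

lemma snd_carrier_fibre: "P \<in> carrier_of (fibre_atlas \<xi>) \<Longrightarrow> snd P \<subseteq> contact_plane \<xi>"
  using atlas_iso_carrier[OF atlas_iso_snd] carrier_LG_atlas_Pow by blast

lemma atlas_iso_fibres:
  assumes "conf_iso (contact_plane \<xi>) (\<eta> \<xi>) (contact_plane \<xi>') (\<eta> \<xi>') A"
  shows "atlas_iso (fibre_atlas \<xi>) (fibre_atlas \<xi>') (\<lambda>P. (\<xi>', A ` snd P))"
proof -
  have "atlas_iso (fibre_atlas \<xi>) (fibre_atlas \<xi>') (Pair \<xi>' \<circ> ((`) A \<circ> snd))"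
    by (intro atlas_iso_compose[OF atlas_iso_compose[OF atlas_iso_snd atlas_iso_LG[OF assms]] atlas_iso_Pair]
        subspace_of_basis[OF conf_sympl_basis_std_frame])
  then show ?thesis by (simp add: comp_def)
qed

lemma atlas_iso_psi:
  assumes b: "conf_sympl_basis (contact_plane \<xi>) (\<eta> \<xi>) b"
  shows "atlas_iso (fibre_atlas \<xi>) LG24_atlas (psi b)"
proof -
  obtain A where A: "conf_iso (contact_plane \<xi>) (\<eta> \<xi>) UNIV std_form A"
    "\<And>v. v \<in> contact_plane \<xi> \<Longrightarrow> A v = basis_coords b v"
    using contact.conf_iso_basis_coords[OF b] by blast
  have "atlas_iso (fibre_atlas \<xi>) LG24_atlas ((`) A \<circ> snd)"
    by (rule atlas_iso_compose[OF atlas_iso_snd atlas_iso_LG[OF A(1) subspace_of_basis[OF b]]])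
  then show ?thesis
  proof (rule atlas_iso_cong)
    fix P assume "P \<in> carrier_of (fibre_atlas \<xi>)"
    then show "((`) A \<circ> snd) P = psi b P"
      using snd_carrier_fibre A(2) unfolding psi_def comp_def by (intro image_cong[OF refl]) blast
  qed
qed

text \<open>\<open>g\<close> is the matrix of the coordinate change from \<open>b\<close> to
  \<open>b'\<close>, conformal as a composite of two conformal isomorphisms.\<close>

lemma psi_change_basis:
  assumes b: "conf_sympl_basis (contact_plane \<xi>) (\<eta> \<xi>) b"
    and b': "conf_sympl_basis (contact_plane \<xi>) (\<eta> \<xi>) b'"
  obtains g where "g \<in> CSp4" "\<And>P. P \<in> carrier_of (fibre_atlas \<xi>) \<Longrightarrow> psi b' P = (*v) g ` psi b P"
proof -
  obtain A where A: "conf_iso (contact_plane \<xi>) (\<eta> \<xi>) UNIV std_form A"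
    "\<And>v. v \<in> contact_plane \<xi> \<Longrightarrow> A v = basis_coords b v"
    using contact.conf_iso_basis_coords[OF b] by blast
  obtain A' where A': "conf_iso (contact_plane \<xi>) (\<eta> \<xi>) UNIV std_form A'"
    "\<And>v. v \<in> contact_plane \<xi> \<Longrightarrow> A' v = basis_coords b' v"
    using contact.conf_iso_basis_coords[OF b'] by blast
  obtain B where B: "conf_iso UNIV std_form (contact_plane \<xi>) (\<eta> \<xi>) B"
    "\<And>v. v \<in> contact_plane \<xi> \<Longrightarrow> B (A v) = v"
    using conf_iso_inverse[OF A(1) subspace_of_basis[OF b]] by metis
  note g = conf_iso_CSp4[OF conf_iso_compose[OF B(1) A'(1)]]
  have "psi b' P = (*v) (matrix (A' \<circ> B)) ` psi b P" if "P \<in> carrier_of (fibre_atlas \<xi>)" for P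
    unfolding psi_def g(2) image_image
    using snd_carrier_fibre[OF that] A(2) A'(2) B(2) by (intro image_cong) (auto simp: subset_iff)
  then show thesis
    using that g(1) by blast
qed

section \<open>The induced function on fibrewise jets\<close>

text \<open>Two descriptions of one fibrewise jet may differ in the fibre, the local map and the
  basis. The fibre is determined by the value at \<open>x\<close>, the change of map is absorbed by
  \<open>atlas_iso_psi\<close>, and the change of basis by the invariance of \<kappa>.\<close>

lemma jet_psi_well_defined:
  assumes U: "smooth_atlas U" and \<kappa>: "CSp_invariant U n \<kappa>"
    and s: "local_map U (fibre_atlas \<xi>) x s" and s': "local_map U (fibre_atlas \<xi>') x' s'"
    and eq: "jet U (fibre_atlas \<xi>) n x s = jet U (fibre_atlas \<xi>') n x' s'"
    and b: "conf_sympl_basis (contact_plane \<xi>) (\<eta> \<xi>) b"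
    and b': "conf_sympl_basis (contact_plane \<xi>') (\<eta> \<xi>') b'"
  shows "\<kappa> (jet U LG24_atlas n x (psi b \<circ> s)) = \<kappa> (jet U LG24_atlas n x' (psi b' \<circ> s'))"
proof -
  note * = jet_eqD[OF eq s']
  have "\<xi> = \<xi>'"
    using fst_carrier_fibre[OF local_map_carrier[OF *(2)]] fst_carrier_fibre[OF local_map_carrier[OF s']] *(1)
    by simp
  then have b': "conf_sympl_basis (contact_plane \<xi>) (\<eta> \<xi>) b'"
    using b' by simp
  obtain g where g: "g \<in> CSp4" "\<And>P. P \<in> carrier_of (fibre_atlas \<xi>) \<Longrightarrow> psi b' P = (*v) g ` psi b P"
    using psi_change_basis[OF b b'] by blast
  obtain V where V: "openin (atlas_topology U) V" "x \<in> V" "smooth_map U (fibre_atlas \<xi>) V s'"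
    using *(2) by (auto simp: local_map_def)
  have "jet U LG24_atlas n x (psi b \<circ> s) = jet U LG24_atlas n x (psi b \<circ> s')"
    by (rule jet_eqI[OF same_jet_atlas_iso[OF U atlas_iso_psi[OF b] s *(2,3)]])
  then have "\<kappa> (jet U LG24_atlas n x (psi b \<circ> s)) = \<kappa> (jet U LG24_atlas n x (psi b \<circ> s'))"
    by simp
  also have "\<dots> = \<kappa> (jet U LG24_atlas n x (\<lambda>y. (*v) g ` (psi b \<circ> s') y))"
    using \<kappa>[unfolded CSp_invariant_def, rule_format, OF g(1)
        local_map_atlas_iso[OF U *(2) atlas_iso_psi[OF b]]] by (rule sym)
  also have "jet U LG24_atlas n x (\<lambda>y. (*v) g ` (psi b \<circ> s') y) = jet U LG24_atlas n x (psi b' \<circ> s')"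
    by (rule jet_eqI[OF same_jet_germ[OF U V(1,2)]]) (use smooth_map_carrier[OF V(3)] g(2) in simp)
  finally show ?thesis
    unfolding *(1) .
qed

lemma ex1_induced_function:
  assumes U: "smooth_atlas U" and \<kappa>: "CSp_invariant U n \<kappa>"
  shows "\<exists>!K. K \<in> extensional (JJ U n) \<and> induced_by U n \<kappa> K"
proof -
  \<comment> \<open>The defining formula as a relation: \<open>induced_by\<close> says precisely
    that \<open>K\<close> follows it, and \<open>extensional\<close> fixes the values off
    \<open>JJ U n\<close>, which makes \<open>K\<close> unique.\<close>
  define \<Phi> where "\<Phi> j k \<longleftrightarrow> (\<exists>\<xi> x s b. j = jet U (fibre_atlas \<xi>) n x s \<and> local_map U (fibre_atlas \<xi>) x s \<and>
    conf_sympl_basis (contact_plane \<xi>) (\<eta> \<xi>) b \<and> k = \<kappa> (jet U LG24_atlas n x (psi b \<circ> s)))" for j k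
  have unique: "k = k'" if "\<Phi> j k" "\<Phi> j k'" for j k k'
    using that unfolding \<Phi>_def by (elim exE conjE) (metis jet_psi_well_defined[OF U \<kappa>])
  have ex: "\<exists>k. \<Phi> j k" if "j \<in> JJ U n" for j
    using that conf_sympl_basis_std_frame unfolding \<Phi>_def JJ_def jet_space_def by blast
  have ind: "induced_by U n \<kappa> K \<longleftrightarrow> (\<forall>j k. \<Phi> j k \<longrightarrow> K j = k)" for K
    unfolding induced_by_def \<Phi>_def by blast
  have JJ: "j \<in> JJ U n" if "\<Phi> j k" for j k
    using that unfolding \<Phi>_def JJ_def jet_space_def by blast
  define K where "K j = (if j \<in> JJ U n then (SOME k. \<Phi> j k) else undefined)" for j
  have "\<Phi> j (K j)" if "j \<in> JJ U n" for j
    using ex[OF that] that by (simp add: K_def someI_ex)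
  then have "induced_by U n \<kappa> K"
    unfolding ind using unique JJ by blast
  moreover have "K \<in> extensional (JJ U n)"
    by (simp add: K_def extensional_def)
  moreover have "K' = K" if "K' \<in> extensional (JJ U n)" "induced_by U n \<kappa> K'" for K'
    using that ex \<open>\<And>j. j \<in> JJ U n \<Longrightarrow> \<Phi> j (K j)\<close> \<open>K \<in> extensional (JJ U n)\<close> unfolding ind
    by (intro extensionalityI[of _ "JJ U n"]) auto
  ultimately show ?thesis by blast
qed

section \<open>The atlas of the second jet space\<close>

definition local_frame :: "J1 set \<Rightarrow> (J1 \<Rightarrow> 4 \<Rightarrow> J1) \<Rightarrow> bool" where
  "local_frame B b \<longleftrightarrow> open B \<and> (\<forall>i. smooth_on B (\<lambda>\<xi>. b \<xi> i)) \<and>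
     (\<forall>\<xi>\<in>B. conf_sympl_basis (contact_plane \<xi>) (\<eta> \<xi>) (b \<xi>))"

definition J2_chart :: "J1 set \<Rightarrow> (J1 \<Rightarrow> 4 \<Rightarrow> J1) \<Rightarrow> (J2, J1 \<times> (real^3)) chart" where
  "J2_chart B b = ({(\<xi>, L). \<xi> \<in> B \<and> L \<in> range (lagr_plane (b \<xi>))},
     \<lambda>(\<xi>, L). (\<xi>, inv (lagr_plane (b \<xi>)) L))"

lemma J2_atlas_eq: "J2_atlas = {J2_chart B b | B b. local_frame B b}"
  unfolding J2_atlas_def J2_chart_def local_frame_def by blast

lemma local_frame_basis:
  "local_frame B b \<Longrightarrow> \<xi> \<in> B \<Longrightarrow> conf_sympl_basis (contact_plane \<xi>) (\<eta> \<xi>) (b \<xi>)"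
  by (simp add: local_frame_def)

lemma in_J2_chart:
  "P \<in> fst (J2_chart B b) \<longleftrightarrow> fst P \<in> B \<and> snd P \<in> range (lagr_plane (b (fst P)))"
  by (auto simp: J2_chart_def split: prod.split)

lemma snd_J2_chart: "snd (J2_chart B b) (\<xi>, L) = (\<xi>, inv (lagr_plane (b \<xi>)) L)"
  by (simp add: J2_chart_def)

lemma fst_snd_J2_chart [simp]: "fst (snd (J2_chart B b) P) = fst P"
  by (cases P) (simp add: snd_J2_chart)

lemma snd_J2_chart_lagr_plane:
  "local_frame B b \<Longrightarrow> \<xi> \<in> B \<Longrightarrow> snd (J2_chart B b) (\<xi>, lagr_plane (b \<xi>) m) = (\<xi>, m)"
  by (simp add: snd_J2_chart inv_lagr_plane[OF local_frame_basis])

lemma J2_chart_cases: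
  assumes "local_frame B b" "P \<in> fst (J2_chart B b)"
  obtains \<xi> m where "\<xi> \<in> B" "P = (\<xi>, lagr_plane (b \<xi>) m)" "snd (J2_chart B b) P = (\<xi>, m)"
  using assms by (cases P) (auto simp: in_J2_chart snd_J2_chart_lagr_plane)

lemma inj_on_J2_chart: "local_frame B b \<Longrightarrow> inj_on (snd (J2_chart B b)) (fst (J2_chart B b))"
  by (rule inj_onI) (metis J2_chart_cases prod.inject)

lemma image_J2_chart:
  assumes "local_frame B b"
  shows "snd (J2_chart B b) ` fst (J2_chart B b) = B \<times> UNIV"
proof (intro equalityI subsetI)
  fix p assume "p \<in> snd (J2_chart B b) ` fst (J2_chart B b)"
  then show "p \<in> B \<times> UNIV"
    by (auto elim!: J2_chart_cases[OF assms])
next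
  fix p assume p: "p \<in> B \<times> (UNIV :: (real^3) set)"
  obtain \<xi> m where "p = (\<xi>, m)" by (cases p)
  then show "p \<in> snd (J2_chart B b) ` fst (J2_chart B b)"
    using p snd_J2_chart_lagr_plane[OF assms, of \<xi> m]
    by (intro image_eqI[of _ _ "(\<xi>, lagr_plane (b \<xi>) m)"]) (auto simp: in_J2_chart)
qed

lemma inv_into_J2_chart:
  assumes "local_frame B b" "\<xi> \<in> B"
  shows "inv_into (fst (J2_chart B b)) (snd (J2_chart B b)) (\<xi>, m) = (\<xi>, lagr_plane (b \<xi>) m)"
  by (rule inv_into_f_eq[OF inj_on_J2_chart[OF assms(1)]])
    (use assms in \<open>auto simp: in_J2_chart snd_J2_chart_lagr_plane\<close>)

lemma smooth_on_fst_snd: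
  assumes "open S" "smooth_on S f"
  shows "smooth_on S (\<lambda>x. fst (f x))" "smooth_on S (\<lambda>x. snd (f x))"
  using smooth_on_bounded_linear[OF bounded_linear_fst assms]
    smooth_on_bounded_linear[OF bounded_linear_snd assms] by auto

lemma \<eta>_components:
  "\<eta> \<xi> v w = fst v * fst (snd (snd (snd w))) + fst (snd v) * snd (snd (snd (snd w))) -
    fst (snd (snd (snd v))) * fst w - snd (snd (snd (snd v))) * fst (snd w)"
  by (cases v; cases w) (simp add: \<eta>_eq)

lemma smooth_on_\<eta>:
  assumes "open S" "smooth_on S v" "smooth_on S w"
  shows "smooth_on S (\<lambda>x. \<eta> (g x) (v x) (w x))"
  unfolding \<eta>_components
  by (intro smooth_on_add smooth_on_diff smooth_on_mult smooth_on_fst_snd assms)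

definition graph1 :: "(4 \<Rightarrow> 'v::euclidean_space) \<Rightarrow> real^3 \<Rightarrow> 'v" where
  "graph1 b m = b 1 + m$1 *\<^sub>R b 3 + m$2 *\<^sub>R b 4"

definition graph2 :: "(4 \<Rightarrow> 'v::euclidean_space) \<Rightarrow> real^3 \<Rightarrow> 'v" where
  "graph2 b m = b 2 + m$2 *\<^sub>R b 3 + m$3 *\<^sub>R b 4"

lemma lagr_plane_span: "lagr_plane b m = span {graph1 b m, graph2 b m}"
  by (simp add: lagr_plane_def graph1_def graph2_def)

text \<open>In coordinates the overlap of two charts is the set where the minor \<Delta> does not
  vanish. The transition map keeps \<xi> and replaces \<open>m\<close> by \<open>slope\<close>, a
  quotient with denominator \<Delta> of expressions polynomial in \<open>m\<close> and in the smooth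
  frames.\<close>

lemma smooth_atlas_J2: "smooth_atlas J2_atlas"
  unfolding smooth_atlas_def
proof (intro conjI ballI)
  fix c assume "c \<in> J2_atlas"
  then obtain B b where c: "c = J2_chart B b" "local_frame B b"
    by (auto simp: J2_atlas_eq)
  show "inj_on (snd c) (fst c)" "open (snd c ` fst c)"
    unfolding c(1) image_J2_chart[OF c(2)] using c(2) inj_on_J2_chart
    by (auto simp: local_frame_def intro: open_Times)
  fix d assume "d \<in> J2_atlas"
  then obtain B' b' where d: "d = J2_chart B' b'" "local_frame B' b'"
    by (auto simp: J2_atlas_eq)
  define u where "u = (\<lambda>P. graph1 (b (fst P)) (snd P))"
  define v where "v = (\<lambda>P. graph2 (b (fst P)) (snd P))"
  define S where "S = (B \<inter> B') \<times> (UNIV :: (real^3) set)"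
  define \<Delta> where "\<Delta> = (\<lambda>P. contact.minor (fst P) (b' (fst P)) (u P) (v P))"
  have B: "open B" "open B'" "open S"
    using c(2) d(2) by (auto simp: local_frame_def S_def intro: open_Times)
  have m: "smooth_on S (\<lambda>P. snd P $ k)" for k :: 3
    by (rule smooth_on_bounded_linear[OF bounded_linear_vec_nth B(3)])
      (intro smooth_on_fst_snd smooth_on_ident B)
  note fst = smooth_on_fst_snd(1)[OF B(3) smooth_on_ident[OF B(3)]]
  have b: "smooth_on S (\<lambda>P. b (fst P) i)" for i
    by (rule smooth_on_compose[OF _ fst B(3,1)]) (use c(2) in \<open>auto simp: local_frame_def S_def\<close>)
  have b': "smooth_on S (\<lambda>P. b' (fst P) i)" for i
    by (rule smooth_on_compose[OF _ fst B(3,2)]) (use d(2) in \<open>auto simp: local_frame_def S_def\<close>)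
  note bs = b b'
  have uv: "smooth_on S u" "smooth_on S v"
    unfolding u_def v_def graph1_def graph2_def
    by (intro smooth_on_add smooth_on_scaleR m bs B(3))+
  have \<Delta>: "smooth_on S \<Delta>"
    unfolding \<Delta>_def contact.minor_def
    by (intro smooth_on_diff smooth_on_mult smooth_on_\<eta> uv bs B(3))
  have uvV: "u (\<xi>, m) \<noteq> v (\<xi>, m)" "independent {u (\<xi>, m), v (\<xi>, m)}" "u (\<xi>, m) \<in> contact_plane \<xi>"
    "v (\<xi>, m) \<in> contact_plane \<xi>" "\<eta> \<xi> (u (\<xi>, m)) (v (\<xi>, m)) = 0"
    "lagr_plane (b \<xi>) m = span {u (\<xi>, m), v (\<xi>, m)}" if "\<xi> \<in> B" for \<xi> m
    using contact.lagr_plane_basis[OF local_frame_basis[OF c(2) that], of m]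
    by (simp_all add: u_def v_def lagr_plane_span graph1_def graph2_def)
  have eq: "lagr_plane (b \<xi>) m = lagr_plane (b' \<xi>) (contact.slope \<xi> (b' \<xi>) (u (\<xi>, m)) (v (\<xi>, m)))"
    if "\<xi> \<in> B" "\<xi> \<in> B'" "\<Delta> (\<xi>, m) \<noteq> 0" for \<xi> m
    using contact.span_eq_lagr_plane[OF local_frame_basis[OF d(2) that(2)] uvV(3-5)[OF that(1)]]
      that(3) uvV(6)[OF that(1)] by (simp add: \<Delta>_def)
  have mem: "lagr_plane (b \<xi>) m \<in> range (lagr_plane (b' \<xi>)) \<longleftrightarrow> \<Delta> (\<xi>, m) \<noteq> 0"
    if \<xi>: "\<xi> \<in> B" "\<xi> \<in> B'" for \<xi> m
  proof
    assume "lagr_plane (b \<xi>) m \<in> range (lagr_plane (b' \<xi>))"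
    then obtain m' where "span {u (\<xi>, m), v (\<xi>, m)} = lagr_plane (b' \<xi>) m'"
      using uvV(6)[OF \<xi>(1)] by auto
    from contact.minor_nonzero[OF local_frame_basis[OF d(2) \<xi>(2)] uvV(1,2)[OF \<xi>(1)] this]
    show "\<Delta> (\<xi>, m) \<noteq> 0" by (simp add: \<Delta>_def)
  qed (metis eq \<xi> rangeI)
  have dom: "snd c ` (fst c \<inter> fst d) = {P \<in> S. \<Delta> P \<noteq> 0}"
  proof (intro set_eqI iffI)
    fix P assume "P \<in> snd c ` (fst c \<inter> fst d)"
    then obtain Q where Q: "Q \<in> fst c" "Q \<in> fst d" "P = snd c Q" by blast
    then obtain \<xi> m where "\<xi> \<in> B" "Q = (\<xi>, lagr_plane (b \<xi>) m)" "P = (\<xi>, m)"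
      using J2_chart_cases[OF c(2)] c(1) by metis
    then show "P \<in> {P \<in> S. \<Delta> P \<noteq> 0}"
      using mem[of \<xi> m] Q(2) unfolding d(1) by (simp add: in_J2_chart S_def)
  next
    fix P assume P: "P \<in> {P \<in> S. \<Delta> P \<noteq> 0}"
    obtain \<xi> m where "P = (\<xi>, m)" by (cases P)
    then show "P \<in> snd c ` (fst c \<inter> fst d)"
      using P mem[of \<xi> m] snd_J2_chart_lagr_plane[OF c(2), of \<xi> m] unfolding c(1) d(1)
      by (intro image_eqI[of _ _ "(\<xi>, lagr_plane (b \<xi>) m)"]) (auto simp: in_J2_chart S_def)
  qed
  have S': "{P \<in> S. \<Delta> P \<noteq> 0} = S \<inter> \<Delta> -` (- {0})" by auto
  have oS': "open {P \<in> S. \<Delta> P \<noteq> 0}"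
    unfolding S' using smooth_on_continuous_on[OF \<Delta>] B(3)
    by (intro continuous_open_preimage) auto
  then show "open (snd c ` (fst c \<inter> fst d))" by (simp add: dom)
  let ?T = "{P \<in> S. \<Delta> P \<noteq> 0}"
  have T: "smooth_on ?T f" if "smooth_on S f" for f :: "_ \<Rightarrow> 'x::euclidean_space"
    using smooth_on_subset[OF that] by auto
  have num: "smooth_on ?T (\<lambda>P. if k = (1::3) then \<eta> (fst P) (b' (fst P) 1) (u P) * \<eta> (fst P) (v P) (b' (fst P) 4) -
        \<eta> (fst P) (b' (fst P) 1) (v P) * \<eta> (fst P) (u P) (b' (fst P) 4)
     else if k = 2 then \<eta> (fst P) (u P) (b' (fst P) 3) * \<eta> (fst P) (b' (fst P) 1) (v P) -
        \<eta> (fst P) (v P) (b' (fst P) 3) * \<eta> (fst P) (b' (fst P) 1) (u P)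
     else \<eta> (fst P) (u P) (b' (fst P) 3) * \<eta> (fst P) (b' (fst P) 2) (v P) -
        \<eta> (fst P) (v P) (b' (fst P) 3) * \<eta> (fst P) (b' (fst P) 2) (u P))" for k
    using exhaust_3[of k]
    by (elim disjE) (simp_all, (rule T, intro smooth_on_diff smooth_on_mult smooth_on_\<eta> uv bs B(3))+)
  have "smooth_on ?T (\<lambda>P. (fst P, contact.slope (fst P) (b' (fst P)) (u P) (v P)))"
    unfolding contact.slope_def \<Delta>_def[symmetric]
    by (intro smooth_on_Pair smooth_on_vec smooth_on_divide num oS' T[OF \<Delta>[unfolded \<Delta>_def]]
        smooth_on_fst_snd smooth_on_ident) (simp add: \<Delta>_def)
  then show "smooth_on (snd c ` (fst c \<inter> fst d)) (local_rep c d id)"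
    unfolding dom
  proof (rule smooth_on_cong[OF _ oS'])
    fix P assume P: "P \<in> ?T"
    obtain \<xi> m where Pe: "P = (\<xi>, m)" by (cases P)
    then have \<xi>: "\<xi> \<in> B" "\<xi> \<in> B'" "\<Delta> (\<xi>, m) \<noteq> 0"
      using P by (auto simp: S_def)
    show "(fst P, contact.slope (fst P) (b' (fst P)) (u P) (v P)) = local_rep c d id P"
      unfolding local_rep_def Pe c(1) d(1)
      by (simp add: inv_into_J2_chart[OF c(2) \<xi>(1)] eq[OF \<xi>] snd_J2_chart_lagr_plane[OF d(2) \<xi>(2)])
  qed
qed

section \<open>The canonical system and the fibres in bundle charts\<close>

lemma chart_diff_fst:
  assumes "local_frame B b" "P \<in> fst (J2_chart B b)"
  shows "chart_diff (J2_chart B b) J1_chart fst P = fst"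
proof -
  have "frechet_derivative (local_rep (J2_chart B b) J1_chart fst) (at (snd (J2_chart B b) P)) =
      frechet_derivative fst (at (snd (J2_chart B b) P))"
  proof (rule frechet_derivative_cong_open)
    show "open (B \<times> (UNIV :: (real^3) set))"
      using assms(1) by (auto simp: local_frame_def intro: open_Times)
    show "snd (J2_chart B b) P \<in> B \<times> UNIV"
      using assms image_J2_chart by blast
    show "local_rep (J2_chart B b) J1_chart fst y = fst y" if "y \<in> B \<times> UNIV" for y
      using that by (auto simp: local_rep_def J1_chart_def inv_into_J2_chart[OF assms(1)])
  qed
  also have "\<dots> = fst"
    by (rule frechet_derivative_at[symmetric]) (auto intro: derivative_intros)
  finally show ?thesis by (simp add: chart_diff_def)
qed

lemma canonical_system_eq:
  assumes "local_frame B b" "P \<in> fst (J2_chart B b)"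
  shows "canonical_system (J2_chart B b) P = {v. fst v \<in> snd P}"
  by (simp add: canonical_system_def chart_diff_fst[OF assms])

lemma carrier_J2_subset: "carrier_of J2_atlas \<subseteq> J2_points"
proof
  fix P assume "P \<in> carrier_of J2_atlas"
  then obtain B b where "local_frame B b" "P \<in> fst (J2_chart B b)"
    unfolding carrier_of_def J2_atlas_eq by blast
  then obtain \<xi> m where "\<xi> \<in> B" "P = (\<xi>, lagr_plane (b \<xi>) m)"
    by (metis J2_chart_cases)
  then show "P \<in> J2_points"
    using contact.lagr_plane_in_LG[OF local_frame_basis[OF \<open>local_frame B b\<close>]]
    by (simp add: J2_points_def)
qed

lemma conf_iso_frame_comb:
  assumes "sympl_space V \<omega>" "conf_sympl_basis V \<omega> b"
  shows "conf_iso UNIV std_form V \<omega> (frame_comb b)"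
proof -
  obtain \<rho> where "\<rho> \<noteq> 0" "\<And>x y. \<omega> (frame_comb b x) (frame_comb b y) = \<rho> * std_form x y"
    using sympl_space.form_frame_comb[OF assms] by metis
  then show ?thesis
    unfolding conf_iso_def
    using linear_frame_comb frame_comb_inject[OF assms(2)] range_frame_comb[OF assms(2)]
    by (auto simp: inj_on_def)
qed

text \<open>The extension has constant coordinates in the standard frame.\<close>
lemma extend_basis:
  assumes b: "conf_sympl_basis (contact_plane \<xi>) (\<eta> \<xi>) b"
  obtains b' where "local_frame UNIV b'" "b' \<xi> = b"
proof -
  obtain A where A: "conf_iso (contact_plane \<xi>) (\<eta> \<xi>) UNIV std_form A"
    "\<And>v. v \<in> contact_plane \<xi> \<Longrightarrow> A v = basis_coords (std_frame \<xi>) v"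
    using contact.conf_iso_basis_coords[OF conf_sympl_basis_std_frame] by blast
  define b' where "b' = (\<lambda>\<zeta>. frame_comb (std_frame \<zeta>) \<circ> (A \<circ> b))"
  have "b' \<xi> i = b i" for i
    using conf_sympl_basis_mem[OF b] A(2) frame_comb_basis_coords[OF conf_sympl_basis_std_frame]
    by (simp add: b'_def)
  moreover have "conf_sympl_basis (contact_plane \<zeta>) (\<eta> \<zeta>) (b' \<zeta>)" for \<zeta>
    unfolding b'_def
    by (intro conf_iso_basis[OF conf_iso_frame_comb] conf_sympl_basis_std_frame
        conf_iso_basis[OF A(1) b] contact.sympl_space_axioms)
  moreover have "smooth_on UNIV (\<lambda>\<zeta>. b' \<zeta> i)" for i
  proof -
    have "smooth_on UNIV (\<lambda>\<zeta>. (x$1, x$2, fst (snd (snd (snd \<zeta>))) * x$1 + snd (snd (snd (snd \<zeta>))) * x$2,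
        x$3, x$4))" for x :: "real^4"
      by (intro smooth_on_Pair smooth_on_add smooth_on_mult smooth_on_const smooth_on_fst_snd
          smooth_on_ident open_UNIV)
    then show ?thesis
      by (simp add: b'_def frame_comb_std_frame)
  qed
  ultimately show thesis
    using that[of b'] by (auto simp: local_frame_def)
qed

text \<open>The basis behind a chart of the fibre extends to a frame over all of \<open>J1\<close>.
  The chart is the slice at \<xi> of the resulting bundle chart, and slices of open sets are
  open.\<close>

lemma openin_fibre_vimage:
  assumes U: "smooth_atlas U" and V: "openin (atlas_topology U) V"
    and s: "smooth_map U (fibre_atlas \<xi>) V s" and N: "openin (atlas_topology J2_atlas) N"
  shows "openin (atlas_topology U) {y \<in> V. s y \<in> N}"
proof (rule openin_smooth_map_chart[OF U V s])
  fix x d assume "s x \<in> N" and d: "d \<in> fibre_atlas \<xi>" "s x \<in> fst d"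
  then obtain b where b: "conf_sympl_basis (contact_plane \<xi>) (\<eta> \<xi>) b"
    and de: "d = ({\<xi>} \<times> range (lagr_plane b), inv (lagr_plane b) \<circ> snd)"
    by (auto simp: fibre_atlas_def LG_atlas_def)
  obtain b' where b': "local_frame UNIV b'" "b' \<xi> = b"
    using extend_basis[OF b] .
  let ?c = "J2_chart UNIV b'"
  have c: "?c \<in> J2_atlas" using b' by (auto simp: J2_atlas_eq)
  have o: "open (snd ?c ` (N \<inter> fst ?c))"
    using N c openin_atlas[OF smooth_atlas_J2] by blast
  let ?O = "(\<lambda>m. (\<xi>, m)) -` (snd ?c ` (N \<inter> fst ?c))"
  have "open ?O"
    by (rule continuous_open_vimage[OF o]) (intro continuous_intros)
  moreover have iff: "snd d p \<in> ?O \<longleftrightarrow> p \<in> N" if "p \<in> fst d" for p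
  proof -
    have p: "p \<in> fst ?c" "(\<xi>, snd d p) = snd ?c p"
      using that b' by (auto simp: de in_J2_chart snd_J2_chart)
    then show ?thesis
      using inj_on_image_mem_iff[OF inj_on_J2_chart[OF b'(1)], of p "N \<inter> fst ?c"] by auto
  qed
  ultimately show "\<exists>R. open R \<and> snd d (s x) \<in> R \<and> {p \<in> fst d. snd d p \<in> R} \<subseteq> N"
    using iff[OF d(2)] \<open>s x \<in> N\<close>
    by (intro exI[of _ ?O] conjI subsetI) (assumption, blast, metis (mono_tags) iff mem_Collect_eq)
qed

section \<open>Maps preserving the canonical system\<close>

text \<open>The pullback \<open>\<theta>\<close> of the contact form by \<open>f\<close> satisfies \<open>d\<theta> = f\<^sup>*\<eta>\<close>.\<close>
lemma pullback_contact_form: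
  fixes f :: "'a::euclidean_space \<Rightarrow> J1"
  assumes S: "open S" "smooth_on S f" "x \<in> S"
  defines "\<theta> \<equiv> \<lambda>v x. \<sigma> (f x) (frechet_derivative f (at x) v)"
  shows "\<theta> v differentiable (at x)"
    and "frechet_derivative (\<theta> v) (at x) u - frechet_derivative (\<theta> u) (at x) v =
      \<eta> \<zeta> (frechet_derivative f (at x) u) (frechet_derivative f (at x) v)"
proof -
  let ?D = "\<lambda>v x. frechet_derivative f (at x) v"
  let ?D2 = "\<lambda>v u. frechet_derivative (?D v) (at x) u"
  have \<sigma>: "\<sigma> \<xi> w = fst (snd (snd w)) - fst (snd (snd (snd \<xi>))) * fst w - snd (snd (snd (snd \<xi>))) * fst (snd w)"
    for \<xi> w by (cases w) (simp add: \<sigma>_eq)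
  have d: "(f has_derivative (\<lambda>u. ?D u x)) (at x)" "(?D v has_derivative ?D2 v) (at x)" for v
    using smooth_on_has_derivative[OF S(2,3)] smooth_on_has_derivative[OF smooth_on_deriv[OF S(2)] S(3)] by auto
  have *: "(\<theta> v has_derivative (\<lambda>u. \<sigma> (f x) (?D2 v u) -
      fst (snd (snd (snd (?D u x)))) * fst (?D v x) - snd (snd (snd (snd (?D u x)))) * fst (snd (?D v x)))) (at x)" for v
    unfolding \<theta>_def \<sigma>
    by (auto intro!: derivative_eq_intros d simp: algebra_simps)
  then show "\<theta> v differentiable (at x)"
    by (auto simp: differentiable_def)
  \<comment> \<open>With equal mixed derivatives the terms containing second derivatives of
    \<open>f\<close> cancel; the remaining product-rule terms form \<eta>.\<close>
  have "?D2 v u = ?D2 u v"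
    by (rule second_derivative_symmetric[OF S(2,1,3)])
  then show "frechet_derivative (\<theta> v) (at x) u - frechet_derivative (\<theta> u) (at x) v =
      \<eta> \<zeta> (frechet_derivative f (at x) u) (frechet_derivative f (at x) v)"
    using frechet_derivative_at[OF *, symmetric] by (simp add: \<eta>_components)
qed

lemma contact_plane_iff: "v \<in> contact_plane \<xi> \<longleftrightarrow> \<sigma> \<xi> v = 0"
  by (simp add: contact_plane_def)

lemma \<sigma>_linear: "\<sigma> \<xi> (v + w) = \<sigma> \<xi> v + \<sigma> \<xi> w" "\<sigma> \<xi> (r *\<^sub>R v) = r * \<sigma> \<xi> v" "\<sigma> \<xi> 0 = 0"
  by (cases v; cases w; simp add: \<sigma>_eq algebra_simps zero_prod_def)+

text \<open>Isolates what the argument takes from a contact transformation: in source coordinates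
  \<open>(\<xi>, m)\<close>, \<open>f\<close> is its \<open>J1\<close>-component and
  \<open>L P\<close> the plane of the image point, which receives the canonical system. Surjectivity
  of the differential enters only in \<open>Df_vertical\<close> and
  \<open>Df_onto_contact_plane\<close>.\<close>

locale canonical_map =
  fixes S :: "(J1 \<times> (real^3)) set" and f :: "J1 \<times> (real^3) \<Rightarrow> J1" and b :: "J1 \<Rightarrow> 4 \<Rightarrow> J1"
    and L :: "J1 \<times> (real^3) \<Rightarrow> J1 set"
  assumes S: "open S" and f: "smooth_on S f"
    and b: "P \<in> S \<Longrightarrow> conf_sympl_basis (contact_plane (fst P)) (\<eta> (fst P)) (b (fst P))"
    and L: "P \<in> S \<Longrightarrow> fst v \<in> lagr_plane (b (fst P)) (snd P) \<Longrightarrow> frechet_derivative f (at P) v \<in> L P"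
    and L_contact: "P \<in> S \<Longrightarrow> L P \<subseteq> contact_plane (f P)"
    and L_isotropic: "P \<in> S \<Longrightarrow> X \<in> L P \<Longrightarrow> Y \<in> L P \<Longrightarrow> \<eta> (f P) X Y = 0"
begin

abbreviation Df :: "J1 \<times> (real^3) \<Rightarrow> J1 \<times> (real^3) \<Rightarrow> J1" where
  "Df P \<equiv> frechet_derivative f (at P)"

definition \<theta> :: "J1 \<times> (real^3) \<Rightarrow> J1 \<times> (real^3) \<Rightarrow> real" where
  "\<theta> v P = \<sigma> (f P) (Df P v)"

lemma linear_Df: "P \<in> S \<Longrightarrow> linear (Df P)"
  using smooth_on_has_derivative[OF f] has_derivative_linear by blast

lemma \<theta>_linear:
  assumes "P \<in> S"
  shows "\<theta> (v + w) P = \<theta> v P + \<theta> w P" "\<theta> (r *\<^sub>R v) P = r * \<theta> v P"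
  using linear_Df[OF assms] by (simp_all add: \<theta>_def linear_add linear_scale \<sigma>_linear)

lemma \<theta>_lagr_plane: "P \<in> S \<Longrightarrow> fst v \<in> lagr_plane (b (fst P)) (snd P) \<Longrightarrow> \<theta> v P = 0"
  unfolding \<theta>_def contact_plane_iff[symmetric] using L L_contact by blast

lemma vertical_in_L: "P \<in> S \<Longrightarrow> Df P (0, w) \<in> L P"
  by (rule L) (simp_all add: lagr_plane_def span_zero)

text \<open>\<open>\<theta> (0, w)\<close> vanishes on \<open>S\<close>, so one of the two terms of
  d\<theta> drops out and the derivative of \<open>\<theta> v\<close> along the fibre becomes a
  value of \<eta>. Both \<open>\<theta>_frame\<close> and \<open>\<eta>_Df_vertical\<close> rest on
  this.\<close>

lemma deriv_\<theta>_vertical: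
  assumes "P \<in> S"
  shows "(\<theta> v has_derivative frechet_derivative (\<theta> v) (at P)) (at P)"
    and "frechet_derivative (\<theta> v) (at P) (0, w) = \<eta> (f P) (Df P (0, w)) (Df P v)"
proof -
  note pb = pullback_contact_form[OF S f assms, folded \<theta>_def]
  show "(\<theta> v has_derivative frechet_derivative (\<theta> v) (at P)) (at P)"
    using pb(1)[of v] by (simp add: frechet_derivative_works)
  have "\<theta> (0, w) Q = 0" if "Q \<in> S" for Q
    by (rule \<theta>_lagr_plane[OF that]) (simp add: lagr_plane_def span_zero)
  then have "frechet_derivative (\<theta> (0, w)) (at P) = frechet_derivative (\<lambda>_. 0) (at P)"
    by (intro frechet_derivative_cong_open[OF S assms]) auto
  then show "frechet_derivative (\<theta> v) (at P) (0, w) = \<eta> (f P) (Df P (0, w)) (Df P v)"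
    using pb(2)[of v "(0, w)"] by simp
qed

lemma deriv_\<theta>_fibre:
  assumes "(\<xi>, m) \<in> S"
  shows "((\<lambda>m'. \<theta> v (\<xi>, m')) has_derivative (\<lambda>w. \<eta> (f (\<xi>, m)) (Df (\<xi>, m) (0, w)) (Df (\<xi>, m) v))) (at m)"
proof -
  have "((\<lambda>m'. (\<xi>, m')) has_derivative (\<lambda>w. (0, w))) (at m)"
    by (auto intro!: derivative_eq_intros)
  from has_derivative_compose[OF this deriv_\<theta>_vertical(1)[OF assms]] show ?thesis
    by (simp add: deriv_\<theta>_vertical(2)[OF assms])
qed

lemma open_fibre: "open {m. (\<xi>, m) \<in> S}"
proof -
  have "open ((\<lambda>m. (\<xi>, m)) -` S)"
    by (rule continuous_open_vimage[OF S]) (intro continuous_intros)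
  then show ?thesis by (simp add: vimage_def)
qed

lemma deriv_zero:
  fixes g :: "real^3 \<Rightarrow> real"
  assumes "(\<xi>, m) \<in> S" "\<And>m'. (\<xi>, m') \<in> S \<Longrightarrow> g m' = 0" "(g has_derivative g') (at m)"
  shows "g' w = 0"
proof -
  have "((\<lambda>_. 0) has_derivative g') (at m)"
    by (rule has_derivative_transform_within_open[OF assms(3) open_fibre[of \<xi>]]) (use assms in auto)
  then show ?thesis
    using has_derivative_unique[OF _ has_derivative_const] by metis
qed

text \<open>The derived system of the canonical system is the preimage of the contact distribution.
  The brackets of \<open>graph1\<close> and \<open>graph2\<close> with the vertical fields \<open>(0, w)\<close> produce \<open>b 3\<close> and
  \<open>b 4\<close>, and \<open>\<theta>\<close> vanishes on them because its exterior derivative vanishes on the canonical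
  system.\<close>
lemma \<theta>_frame:
  assumes P: "(\<xi>, m) \<in> S"
  shows "\<theta> (b \<xi> i, 0) (\<xi>, m) = 0"
proof -
  let ?t = "\<lambda>i m. \<theta> (b \<xi> i, 0) (\<xi>, m)"
  have g: "\<theta> (graph1 (b \<xi>) m', 0) (\<xi>, m') = ?t 1 m' + m'$1 * ?t 3 m' + m'$2 * ?t 4 m'"
    "\<theta> (graph2 (b \<xi>) m', 0) (\<xi>, m') = ?t 2 m' + m'$2 * ?t 3 m' + m'$3 * ?t 4 m'"
    if "(\<xi>, m') \<in> S" for m'
  proof -
    have "(graph1 (b \<xi>) m', 0) = (b \<xi> 1, 0) + m'$1 *\<^sub>R (b \<xi> 3, 0) + m'$2 *\<^sub>R (b \<xi> 4, 0 :: real^3)"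
      "(graph2 (b \<xi>) m', 0) = (b \<xi> 2, 0) + m'$2 *\<^sub>R (b \<xi> 3, 0) + m'$3 *\<^sub>R (b \<xi> 4, 0 :: real^3)"
      by (simp_all add: graph1_def graph2_def)
    then show "\<theta> (graph1 (b \<xi>) m', 0) (\<xi>, m') = ?t 1 m' + m'$1 * ?t 3 m' + m'$2 * ?t 4 m'"
      "\<theta> (graph2 (b \<xi>) m', 0) (\<xi>, m') = ?t 2 m' + m'$2 * ?t 3 m' + m'$3 * ?t 4 m'"
      by (simp_all only: \<theta>_linear[OF that])
  qed
  have gz: "\<theta> (graph1 (b \<xi>) m', 0) (\<xi>, m') = 0" "\<theta> (graph2 (b \<xi>) m', 0) (\<xi>, m') = 0"
    if "(\<xi>, m') \<in> S" for m'
    by (rule \<theta>_lagr_plane[OF that]; simp add: lagr_plane_span span_base)+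
  \<comment> \<open>The vanishing of \<theta> on \<open>graph1\<close> is differentiated along
    \<open>w\<close>. The terms that differentiate \<theta> add up to \<eta> on two vectors of
    \<open>L\<close>, which is 0; the variation of \<open>graph1\<close> itself leaves this
    sum.\<close>
  have "w$1 * ?t 3 m + w$2 * ?t 4 m = 0" for w :: "real^3"
  proof -
    let ?e = "\<lambda>i w. \<eta> (f (\<xi>, m)) (Df (\<xi>, m) (0, w)) (Df (\<xi>, m) (b \<xi> i, 0))"
    have "((\<lambda>m'. ?t 1 m' + m'$1 * ?t 3 m' + m'$2 * ?t 4 m') has_derivative
        (\<lambda>w. ?e 1 w + (m$1 * ?e 3 w + w$1 * ?t 3 m) + (m$2 * ?e 4 w + w$2 * ?t 4 m))) (at m)"
      by (intro has_derivative_add has_derivative_mult deriv_\<theta>_fibre[OF P]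
          bounded_linear_imp_has_derivative bounded_linear_vec_nth)
    then have "?e 1 w + (m$1 * ?e 3 w + w$1 * ?t 3 m) + (m$2 * ?e 4 w + w$2 * ?t 4 m) = 0"
      by (rule deriv_zero[OF P, rotated]) (use g gz in simp)
    moreover have "?e 1 w + m$1 * ?e 3 w + m$2 * ?e 4 w =
        \<eta> (f (\<xi>, m)) (Df (\<xi>, m) (0, w)) (Df (\<xi>, m) (graph1 (b \<xi>) m, 0))"
    proof -
      have "(graph1 (b \<xi>) m, 0) = (b \<xi> 1, 0) + m$1 *\<^sub>R (b \<xi> 3, 0) + m$2 *\<^sub>R (b \<xi> 4, 0 :: real^3)"
        by (simp add: graph1_def)
      then show ?thesis
        by (simp only: linear_add[OF linear_Df[OF P]] linear_scale[OF linear_Df[OF P]] contact.form_simps)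
    qed
    moreover have "\<eta> (f (\<xi>, m)) (Df (\<xi>, m) (0, w)) (Df (\<xi>, m) (graph1 (b \<xi>) m, 0)) = 0"
      by (rule L_isotropic[OF P vertical_in_L[OF P] L[OF P]]) (simp add: lagr_plane_span span_base)
    ultimately show ?thesis by simp
  qed
  from this[of "axis 1 1"] this[of "axis 2 1"] have "?t 3 m = 0" "?t 4 m = 0"
    by (simp_all add: axis_def)
  moreover from this have "?t 1 m = 0" "?t 2 m = 0"
    using g[OF P] gz[OF P] by simp_all
  ultimately show ?thesis
    using exhaust_4[of i] by auto
qed

lemma Df_frame_comb:
  assumes "(\<xi>, m) \<in> S"
  shows "Df (\<xi>, m) (frame_comb (b \<xi>) x, w) =
    frame_comb (\<lambda>i. Df (\<xi>, m) (b \<xi> i, 0)) x + Df (\<xi>, m) (0, w)"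
proof -
  have "(frame_comb (b \<xi>) x, w) = frame_comb (\<lambda>i. (b \<xi> i, 0)) x + (0, w)"
    by (simp add: frame_comb_4)
  then show ?thesis
    using frame_comb_linear[OF linear_Df[OF assms], of "\<lambda>i. (b \<xi> i, 0)" x]
    by (simp add: linear_add[OF linear_Df[OF assms]] comp_def)
qed

lemma Df_contact_plane:
  assumes P: "(\<xi>, m) \<in> S" and u: "u \<in> contact_plane \<xi>"
  shows "Df (\<xi>, m) (u, w) \<in> contact_plane (f (\<xi>, m))"
proof -
  obtain x where x: "u = frame_comb (b \<xi>) x"
    using u range_frame_comb[OF b[OF P]] by auto
  have "Df (\<xi>, m) (0, w) \<in> contact_plane (f (\<xi>, m))"
    using vertical_in_L[OF P] L_contact[OF P] by blast
  then show ?thesis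
    using \<theta>_frame[OF P] unfolding x Df_frame_comb[OF P]
    by (simp add: contact_plane_iff frame_comb_4 \<sigma>_linear \<theta>_def)
qed

lemma \<eta>_Df_vertical:
  assumes P: "(\<xi>, m) \<in> S" and u: "u \<in> contact_plane \<xi>"
  shows "\<eta> (f (\<xi>, m)) (Df (\<xi>, m) (0, w)) (Df (\<xi>, m) (u, w')) = 0"
proof -
  obtain x where x: "u = frame_comb (b \<xi>) x"
    using u range_frame_comb[OF b[OF P]] by auto
  moreover have "\<eta> (f (\<xi>, m)) (Df (\<xi>, m) (0, w)) (Df (\<xi>, m) (0, w')) = 0"
    by (rule L_isotropic[OF P vertical_in_L[OF P] vertical_in_L[OF P]])
  \<comment> \<open>\<open>\<theta>_frame\<close> holds at all points of \<open>S\<close> over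
    \<xi>, so the vertical derivative of \<open>\<theta> (b \<xi> i, 0)\<close>, which is this value
    of \<eta>, is 0.\<close>
  moreover have "\<eta> (f (\<xi>, m)) (Df (\<xi>, m) (0, w)) (Df (\<xi>, m) (b \<xi> i, 0)) = 0" for i
    by (rule deriv_zero[OF P _ deriv_\<theta>_fibre[OF P]]) (rule \<theta>_frame)
  ultimately show ?thesis
    unfolding x Df_frame_comb[OF P] by (simp add: frame_comb_4 contact.form_simps)
qed

lemma
  assumes P: "(\<xi>, m) \<in> S" and surj: "surj (Df (\<xi>, m))"
  shows Df_vertical: "Df (\<xi>, m) (0, w) = 0"
    and Df_onto_contact_plane: "z \<in> contact_plane (f (\<xi>, m)) \<Longrightarrow> \<exists>u\<in>contact_plane \<xi>. Df (\<xi>, m) (u, 0) = z"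
proof -
  have onto: "\<exists>u\<in>contact_plane \<xi>. \<exists>w. Df (\<xi>, m) (u, w) = z" if z: "z \<in> contact_plane (f (\<xi>, m))" for z
  proof -
    obtain u w where uw: "Df (\<xi>, m) (u, w) = z"
      using surj by (metis surjD surj_pair)
    \<comment> \<open>Otherwise the contact and vertical directions together with
      \<open>(u, w)\<close> span everything, and the whole image lies in the contact plane;
      \<open>(0, 0, 1, 0, 0)\<close>, on which \<sigma> is 1, contradicts surjectivity. The factor
      \<open>t\<close> makes \<open>v - t *\<^sub>R u\<close> a contact direction.\<close>
    have "\<sigma> \<xi> u = 0"
    proof (rule ccontr)
      assume ne: "\<sigma> \<xi> u \<noteq> 0"
      obtain v w' where vw: "Df (\<xi>, m) (v, w') = (0, 0, 1, 0, 0)"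
        using surj by (metis surjD surj_pair)
      define t where "t = \<sigma> \<xi> v / \<sigma> \<xi> u"
      have v: "(v, w') = (v - t *\<^sub>R u, w' - t *\<^sub>R w) + t *\<^sub>R (u, w)"
        by simp
      have "\<sigma> \<xi> (v + (- t) *\<^sub>R u) = 0"
        unfolding \<sigma>_linear t_def using ne by simp
      then have "v - t *\<^sub>R u \<in> contact_plane \<xi>"
        by (simp add: contact_plane_iff)
      from Df_contact_plane[OF P this] have "\<sigma> (f (\<xi>, m)) (Df (\<xi>, m) (v - t *\<^sub>R u, w' - t *\<^sub>R w)) = 0"
        by (simp add: contact_plane_iff)
      then have "\<sigma> (f (\<xi>, m)) (Df (\<xi>, m) (v, w')) = 0"
        using z unfolding v linear_add[OF linear_Df[OF P]] linear_scale[OF linear_Df[OF P]] uw \<sigma>_linear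
        by (simp add: contact_plane_iff)
      then show False
        unfolding vw by (simp add: \<sigma>_eq)
    qed
    then show ?thesis
      using uw by (auto simp: contact_plane_iff)
  qed
  show vert: "Df (\<xi>, m) (0, w) = 0" for w
  proof (rule contact.nondegenerate[of _ "f (\<xi>, m)"])
    show "Df (\<xi>, m) (0, w) \<in> contact_plane (f (\<xi>, m))"
      using vertical_in_L[OF P] L_contact[OF P] by blast
    show "\<eta> (f (\<xi>, m)) (Df (\<xi>, m) (0, w)) z = 0" if "z \<in> contact_plane (f (\<xi>, m))" for z
      using onto[OF that] \<eta>_Df_vertical[OF P] by blast
  qed
  show "\<exists>u\<in>contact_plane \<xi>. Df (\<xi>, m) (u, 0) = z" if "z \<in> contact_plane (f (\<xi>, m))"
  proof -
    obtain u w where u: "u \<in> contact_plane \<xi>" "Df (\<xi>, m) (u, w) = z"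
      using onto \<open>z \<in> contact_plane (f (\<xi>, m))\<close> by blast
    have "Df (\<xi>, m) (u, w) = Df (\<xi>, m) (u, 0) + Df (\<xi>, m) (0, w)"
      using linear_add[OF linear_Df[OF P], of "(u, 0)" "(0, w)"] by simp
    then show ?thesis using u vert by auto
  qed
qed

end

section \<open>Contact transformations act linearly on fibres\<close>

text \<open>These polynomials arise when a skew form is evaluated on \<open>graph1\<close> and
  \<open>graph2\<close>: they combine 1, the entries of the symmetric matrix and its determinant,
  which are linearly independent on every nonempty open set.\<close>

lemma quadratic_polynomial_zero:
  assumes Y: "open Y" "m \<in> Y"
    and zero: "\<And>m :: real^3. m \<in> Y \<Longrightarrow>
      c0 + c1 * m$1 + c2 * m$2 + c3 * m$3 + e * (m$1 * m$3 - m$2 * m$2) = 0"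
  shows "c0 = 0 \<and> c1 = 0 \<and> c2 = 0 \<and> c3 = 0 \<and> e = 0"
proof -
  obtain r where r: "r > 0" "ball m r \<subseteq> Y"
    using Y open_contains_ball by blast
  define t where "t = r / 2"
  have t: "t > 0" "t < r" using r by (auto simp: t_def)
  have "m + s *\<^sub>R axis i 1 \<in> Y" if "\<bar>s\<bar> \<le> t" for s i
    using r t that by (intro subsetD[OF r(2)]) (simp add: dist_norm)
  from zero[OF this] have *: "c0 + c1 * (m + s *\<^sub>R axis i 1)$1 + c2 * (m + s *\<^sub>R axis i 1)$2 +
      c3 * (m + s *\<^sub>R axis i 1)$3 + e * ((m + s *\<^sub>R axis i 1)$1 * (m + s *\<^sub>R axis i 1)$3 -
      (m + s *\<^sub>R axis i 1)$2 * (m + s *\<^sub>R axis i 1)$2) = 0" if "\<bar>s\<bar> \<le> t" for s i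
    using that by blast
  note z = zero[OF Y(2)]
  have "t * (c1 + e * m$3) = 0"
    using *[of t 1] z t by (simp add: axis_def algebra_simps)
  then have 1: "c1 + e * m$3 = 0" using t by simp
  have "t * (c3 + e * m$1) = 0"
    using *[of t 3] z t by (simp add: axis_def algebra_simps)
  then have 3: "c3 + e * m$1 = 0" using t by simp
  \<comment> \<open>Adding the increments for \<open>t\<close> and \<open>- t\<close> removes the
    linear part and isolates \<open>e\<close>.\<close>
  have a: "t * (c2 - 2 * e * m$2) - e * (t * t) = 0"
    using *[of t 2] z t by (simp add: axis_def algebra_simps)
  have b: "- t * (c2 - 2 * e * m$2) - e * (t * t) = 0"
    using *[of "-t" 2] z t by (simp add: axis_def algebra_simps)
  have "e * (t * t) = 0" using a b by linarith
  then have e: "e = 0" using t by simp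
  then have "c2 = 0" using a t by simp
  then show ?thesis using 1 3 e z by simp
qed

text \<open>The pulled-back form has six values on pairs from \<open>b\<close>. Vanishing on the
  planes over \<open>Y\<close> kills four of them and equates the other two, so the form is a
  multiple of \<omega>. The factor is nonzero because \<open>A\<close> is onto and \<omega>'
  nondegenerate; injectivity then follows from nondegeneracy of \<omega>.\<close>

lemma conf_iso_of_lagr_planes:
  assumes V: "sympl_space V \<omega>" and V': "sympl_space V' \<omega>'"
    and b: "conf_sympl_basis V \<omega> b" and b': "conf_sympl_basis V' \<omega>' b'"
    and A: "linear A" "A ` V = V'"
    and Y: "open Y" "m0 \<in> Y"
    and iso: "\<And>m u v. m \<in> Y \<Longrightarrow> u \<in> lagr_plane b m \<Longrightarrow> v \<in> lagr_plane b m \<Longrightarrow> \<omega>' (A u) (A v) = 0"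
  shows "conf_iso V \<omega> V' \<omega>' A"
proof -
  interpret V: sympl_space V \<omega> by (rule V)
  interpret V': sympl_space V' \<omega>' by (rule V')
  obtain \<rho> where \<rho>: "\<rho> \<noteq> 0" "\<And>x y. \<omega> (frame_comb b x) (frame_comb b y) = \<rho> * std_form x y"
    using V.form_frame_comb[OF b] by metis
  define a where "a i j = \<omega>' (A (b i)) (A (b j))" for i j
  have skew: "a j i = - a i j" for i j
    unfolding a_def by (rule V'.skew)
  have "a 1 2 + a 3 2 * m$1 + (a 1 3 - a 2 4) * m$2 + a 1 4 * m$3 + a 3 4 * (m$1 * m$3 - m$2 * m$2) = 0"
    if "m \<in> Y" for m
  proof -
    have "\<omega>' (A (graph1 b m)) (A (graph2 b m)) = 0"
      by (rule iso[OF that]) (simp_all add: lagr_plane_span span_base)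
    then show ?thesis
      by (simp add: graph1_def graph2_def linear_add[OF A(1)] linear_scale[OF A(1)] V'.form_simps
          V'.alternating a_def[symmetric] skew[of 4 2] skew[of 3 4] algebra_simps)
  qed
  from quadratic_polynomial_zero[OF Y this] have z: "a 1 2 = 0" "a 3 2 = 0" "a 1 3 = a 2 4" "a 1 4 = 0" "a 3 4 = 0"
    by auto
  have eq: "\<omega>' (A (frame_comb b x)) (A (frame_comb b y)) = a 1 3 * std_form x y" for x y
    using z skew[of 1 2] skew[of 1 3] skew[of 1 4] skew[of 2 4] skew[of 2 3] skew[of 3 4]
    by (simp add: frame_comb_4 linear_add[OF A(1)] linear_scale[OF A(1)] V'.form_simps
        V'.alternating a_def[symmetric] std_form_eq algebra_simps)
  have onto: "\<exists>x. w = A (frame_comb b x)" if "w \<in> V'" for w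
    using that A(2) range_frame_comb[OF b] by blast
  have ne: "a 1 3 \<noteq> 0"
  proof
    assume "a 1 3 = 0"
    then have "\<omega>' v w = 0" if "v \<in> V'" "w \<in> V'" for v w
      using onto[OF that(1)] onto[OF that(2)] eq by auto
    then have "b' 1 = 0"
      using conf_sympl_basis_mem[OF b'] by (intro V'.nondegenerate) auto
    then have "axis (1::4) (1::real) = 0"
      using frame_comb_eq_0[OF b', of "axis 1 1"] by simp
    then show False by (simp add: axis_eq_0_iff)
  qed
  have V_comb: "\<exists>x. v = frame_comb b x" if "v \<in> V" for v
    using that range_frame_comb[OF b] by blast
  have conf: "\<omega>' (A u) (A v) = a 1 3 / \<rho> * \<omega> u v" if "u \<in> V" "v \<in> V" for u v
    using V_comb[OF that(1)] V_comb[OF that(2)] \<rho> by (auto simp: eq)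
  have sub: "subspace V" by (rule subspace_of_basis[OF b])
  have "inj_on A V"
  proof (rule inj_onI)
    fix u v assume uv: "u \<in> V" "v \<in> V" "A u = A v"
    have "\<omega> (u - v) w = 0" if "w \<in> V" for w
    proof -
      have "a 1 3 / \<rho> * \<omega> (u - v) w = \<omega>' (A (u - v)) (A w)"
        using conf[of "u - v" w] uv that sub by (simp add: subspace_diff)
      also have "A (u - v) = 0 *\<^sub>R A u"
        using uv by (simp add: linear_diff[OF A(1)])
      finally show ?thesis using ne \<rho>(1) by (simp add: V'.form_simps(3) del: scaleR_zero_left)
    qed
    then have "u - v = 0"
      using uv sub by (intro V.nondegenerate) (auto simp: subspace_diff)
    then show "u = v" by simp
  qed
  then show ?thesis
    unfolding conf_iso_def using A conf ne \<rho>(1) by (intro conjI exI[of _ "a 1 3 / \<rho>"]) auto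
qed

locale contact_charts =
  fixes D :: "J2 set" and \<phi> :: "J2 \<Rightarrow> J2"
    and B :: "J1 set" and b :: "J1 \<Rightarrow> 4 \<Rightarrow> J1" and B' :: "J1 set" and b' :: "J1 \<Rightarrow> 4 \<Rightarrow> J1"
  assumes contact: "contact_transformation D \<phi>"
    and frame: "local_frame B b" and frame': "local_frame B' b'"
begin

abbreviation "c \<equiv> J2_chart B b"
abbreviation "d \<equiv> J2_chart B' b'"
abbreviation "\<psi> \<equiv> inv_into D \<phi>"

definition "F = local_rep c d \<phi>"
definition "G = local_rep d c \<psi>"
definition "S = snd c ` {Q \<in> D \<inter> fst c. \<phi> Q \<in> fst d}"
definition "T = snd d ` {R \<in> \<phi> ` D \<inter> fst d. \<psi> R \<in> fst c}"

lemma charts: "c \<in> J2_atlas" "d \<in> J2_atlas"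
  using frame frame' by (auto simp: J2_atlas_eq)

lemma inj_\<phi>: "inj_on \<phi> D"
  using contact by (simp add: contact_transformation_def)

lemma open_S: "open S" and smooth_F: "smooth_on S F"
  and open_T: "open T" and smooth_G: "smooth_on T G"
proof -
  have "smooth_map J2_atlas J2_atlas D \<phi>" "smooth_map J2_atlas J2_atlas (\<phi> ` D) \<psi>"
    using contact unfolding contact_transformation_def by blast+
  note this[THEN smooth_map_local_rep(1)[OF smooth_atlas_J2 smooth_atlas_J2]]
    this[THEN smooth_map_local_rep(2)[OF smooth_atlas_J2 smooth_atlas_J2]]
  from this(1,3)[OF charts] this(2,4)[OF charts(2,1)]
  show "open S" "smooth_on S F" "open T" "smooth_on T G"
    unfolding S_def F_def T_def G_def by simp_all
qed

lemma F_eq: "Q \<in> fst c \<Longrightarrow> F (snd c Q) = snd d (\<phi> Q)"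
  by (simp add: F_def local_rep_def inv_into_chart[OF smooth_atlas_J2 charts(1)])

lemma G_eq: "Q \<in> D \<Longrightarrow> \<phi> Q \<in> fst d \<Longrightarrow> G (snd d (\<phi> Q)) = snd c Q"
  by (simp add: G_def local_rep_def inv_into_chart[OF smooth_atlas_J2 charts(2)] inj_\<phi>)

lemma S_cases:
  assumes "p \<in> S"
  obtains Q where "Q \<in> D" "Q \<in> fst c" "\<phi> Q \<in> fst d" "p = snd c Q" "F p = snd d (\<phi> Q)"
  using assms F_eq unfolding S_def by blast

lemma S_I: "Q \<in> D \<Longrightarrow> Q \<in> fst c \<Longrightarrow> \<phi> Q \<in> fst d \<Longrightarrow> snd c Q \<in> S"
  unfolding S_def by blast

lemma T_cases:
  assumes "p \<in> T"
  obtains Q where "Q \<in> D" "Q \<in> fst c" "\<phi> Q \<in> fst d" "p = snd d (\<phi> Q)" "G p = snd c Q"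
proof -
  obtain R where R: "R \<in> \<phi> ` D" "R \<in> fst d" "\<psi> R \<in> fst c" "p = snd d R"
    using assms unfolding T_def by blast
  moreover have "\<phi> (\<psi> R) = R" "\<psi> R \<in> D"
    using R(1) by (auto simp: f_inv_into_f inv_into_into)
  ultimately show thesis
    using that[of "\<psi> R"] G_eq[of "\<psi> R"] by simp
qed

lemma T_I: "Q \<in> D \<Longrightarrow> Q \<in> fst c \<Longrightarrow> \<phi> Q \<in> fst d \<Longrightarrow> snd d (\<phi> Q) \<in> T"
  unfolding T_def using inj_\<phi> by (intro imageI) simp

lemma G_F: "p \<in> S \<Longrightarrow> G (F p) = p" "p \<in> S \<Longrightarrow> F p \<in> T"
  by (auto elim!: S_cases simp: G_eq T_I simp del: split_paired_All)

lemma F_G: "p \<in> T \<Longrightarrow> F (G p) = p" "p \<in> T \<Longrightarrow> G p \<in> S"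
  by (auto elim!: T_cases simp: F_eq S_I)

lemma DG_DF: "p \<in> S \<Longrightarrow> frechet_derivative G (at (F p)) (frechet_derivative F (at p) v) = v"
  by (rule inverse_derivative_at[OF smooth_F smooth_G open_S]) (auto simp: G_F)

lemma DF_DG: "p \<in> S \<Longrightarrow> frechet_derivative F (at p) (frechet_derivative G (at (F p)) v) = v"
  using inverse_derivative_at[OF smooth_G smooth_F open_T, of "F p"] by (simp add: G_F F_G)

lemma DF_canonical:
  assumes "Q \<in> D" "Q \<in> fst c" "\<phi> Q \<in> fst d"
  shows "frechet_derivative F (at (snd c Q)) ` {v. fst v \<in> snd Q} = {v. fst v \<in> snd (\<phi> Q)}"
proof -
  have "chart_diff c d \<phi> Q ` canonical_system c Q = canonical_system d (\<phi> Q)"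
    using contact charts assms unfolding contact_transformation_def by blast
  then show ?thesis
    unfolding canonical_system_eq[OF frame assms(2)] canonical_system_eq[OF frame' assms(3)]
    by (simp add: chart_diff_def F_def)
qed

abbreviation "f \<equiv> \<lambda>p. fst (F p)"

lemma Df:
  assumes "p \<in> S"
  shows "frechet_derivative f (at p) = (\<lambda>v. fst (frechet_derivative F (at p) v))"
  by (rule frechet_derivative_at[symmetric])
    (intro has_derivative_fst smooth_on_has_derivative[OF smooth_F assms])

text \<open>The plane at \<open>p\<close> is that of the image point, written through the target
  frame. The condition on the differential is the \<open>J1\<close>-part of
  \<open>DF_canonical\<close>.\<close>

sublocale canonical_map S f b "\<lambda>p. lagr_plane (b' (f p)) (snd (F p))"
proof
  show "open S" by (rule open_S)
  show "smooth_on S f"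
    by (rule smooth_on_fst_snd[OF open_S smooth_F])
next
  fix p assume "p \<in> S"
  then obtain Q where Q: "Q \<in> D" "Q \<in> fst c" "\<phi> Q \<in> fst d" "p = snd c Q" "F p = snd d (\<phi> Q)"
    by (rule S_cases)
  show "conf_sympl_basis (contact_plane (fst p)) (\<eta> (fst p)) (b (fst p))"
    using Q local_frame_basis[OF frame] by (simp add: in_J2_chart)
  obtain \<xi>' m' where \<phi>Q: "\<xi>' \<in> B'" "\<phi> Q = (\<xi>', lagr_plane (b' \<xi>') m')" "F p = (\<xi>', m')"
    using J2_chart_cases[OF frame' Q(3)] Q(5) by metis
  obtain \<xi> m where Qe: "Q = (\<xi>, lagr_plane (b \<xi>) m)" "p = (\<xi>, m)"
    using J2_chart_cases[OF frame Q(2)] Q(4) by metis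
  have LG: "lagr_plane (b' \<xi>') m' \<in> LG (contact_plane \<xi>') (\<eta> \<xi>')"
    by (rule contact.lagr_plane_in_LG[OF local_frame_basis[OF frame' \<phi>Q(1)]])
  show "frechet_derivative f (at p) v \<in> lagr_plane (b' (f p)) (snd (F p))"
    if "fst v \<in> lagr_plane (b (fst p)) (snd p)" for v
  proof -
    have "v \<in> {v. fst v \<in> snd Q}"
      using that Qe by simp
    then have "frechet_derivative F (at p) v \<in> {v. fst v \<in> snd (\<phi> Q)}"
      unfolding DF_canonical[OF Q(1-3), symmetric] Q(4)[symmetric] by (rule imageI)
    then show ?thesis
      unfolding Df[OF \<open>p \<in> S\<close>] \<phi>Q by (simp add: \<phi>Q(2))
  qed
  show "lagr_plane (b' (f p)) (snd (F p)) \<subseteq> contact_plane (f p)"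
    using LG \<phi>Q(3) by (simp add: LG_def)
  show "\<eta> (f p) X Y = 0" if "X \<in> lagr_plane (b' (f p)) (snd (F p))"
    "Y \<in> lagr_plane (b' (f p)) (snd (F p))" for X Y
    using LG \<phi>Q(3) that by (simp add: LG_def)
qed

lemma surj_Df: "p \<in> S \<Longrightarrow> surj (frechet_derivative f (at p))"
  unfolding Df by (rule surjI[of _ "\<lambda>x. frechet_derivative G (at (F p)) (x, 0)"]) (simp add: DF_DG)

lemma vertical: "p \<in> S \<Longrightarrow> fst (frechet_derivative F (at p) (0, w)) = 0"
  using Df_vertical[of "fst p" "snd p" w] surj_Df[of p] Df[of p] by simp

lemma fibre_map_charts:
  assumes P: "P \<in> D" "P \<in> fst c" "\<phi> P \<in> fst d"
  shows "\<exists>A N. openin (atlas_topology J2_atlas) N \<and> P \<in> N \<and> N \<subseteq> D \<and>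
    conf_iso (contact_plane (fst P)) (\<eta> (fst P)) (contact_plane (fst (\<phi> P))) (\<eta> (fst (\<phi> P))) A \<and>
    (\<forall>Q\<in>N. fst Q = fst P \<longrightarrow> \<phi> Q = (fst (\<phi> P), A ` snd Q))"
proof -
  obtain \<xi> m0 where Pe: "\<xi> \<in> B" "P = (\<xi>, lagr_plane (b \<xi>) m0)" "snd c P = (\<xi>, m0)"
    using J2_chart_cases[OF frame P(2)] by metis
  have p0: "(\<xi>, m0) \<in> S"
    using S_I[OF P] Pe by simp
  obtain X Y' where XY': "open X" "open Y'" "(\<xi>, m0) \<in> X \<times> Y'" "X \<times> Y' \<subseteq> S"
    using open_prod_elim[OF open_S p0] by metis
  obtain r where r: "r > 0" "ball m0 r \<subseteq> Y'"
    using XY' open_contains_ball by blast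
  \<comment> \<open>A ball, because constancy along the fibre is deduced from a vanishing derivative
    on a convex set.\<close>
  define Y where "Y = ball m0 r"
  have XY: "open X" "open Y" "\<xi> \<in> X" "m0 \<in> Y" "convex Y" "\<And>\<zeta> m. \<zeta> \<in> X \<Longrightarrow> m \<in> Y \<Longrightarrow> (\<zeta>, m) \<in> S"
    using XY' r by (auto simp: Y_def)
  have const: "f (\<zeta>, m) = f (\<zeta>, m0)" if \<zeta>: "\<zeta> \<in> X" and m: "m \<in> Y" for \<zeta> m
  proof -
    have d0: "((\<lambda>m. f (\<zeta>, m)) has_derivative (\<lambda>h. 0)) (at m within Y)" if "m \<in> Y" for m
    proof -
      have s: "(\<zeta>, m) \<in> S" using XY \<zeta> that by blast
      have "((\<lambda>m'. (\<zeta>, m')) has_derivative (\<lambda>w. (0, w))) (at m)"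
        by (auto intro!: derivative_eq_intros)
      from has_derivative_compose[OF this smooth_on_has_derivative[OF f s]]
      have "((\<lambda>m. f (\<zeta>, m)) has_derivative (\<lambda>h. 0)) (at m)"
        using Df_vertical[OF s surj_Df[OF s]] by simp
      then show ?thesis by (rule has_derivative_at_withinI)
    qed
    show ?thesis
      using has_derivative_zero_constant[OF XY(5) d0] m XY(4) by (metis (no_types, lifting))
  qed
  define A where "A u = frechet_derivative f (at (\<xi>, m0)) (u, 0)" for u
  have linA: "linear A"
  proof -
    have "linear (\<lambda>u::J1. (u, 0::real^3))" by (rule linearI) auto
    from linear_compose[OF this linear_Df[OF p0]] show ?thesis
      unfolding A_def[abs_def] comp_def .
  qed
  \<comment> \<open>\<open>const\<close> holds over all of \<open>X\<close>, not just over \<xi>, so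
    the derivative in base directions is the same at every \<open>m\<close> in \<open>Y\<close>, and
    one \<open>A\<close> serves the whole neighbourhood.\<close>
  have DfA: "frechet_derivative f (at (\<xi>, m)) v = A (fst v)" if m: "m \<in> Y" for m v
  proof -
    have "frechet_derivative f (at (\<xi>, m)) = frechet_derivative (\<lambda>p. f (fst p, m0)) (at (\<xi>, m))"
    proof (rule frechet_derivative_cong_open)
      show "open (X \<times> Y)" using XY by (simp add: open_Times)
      show "(\<xi>, m) \<in> X \<times> Y" using XY m by simp
      show "f p = f (fst p, m0)" if "p \<in> X \<times> Y" for p
        using that const[of "fst p" "snd p"] by auto
    qed
    also have "\<dots> = (\<lambda>v. A (fst v))"
    proof (rule frechet_derivative_at[symmetric])
      have "((\<lambda>p. (fst p, m0)) has_derivative (\<lambda>v. (fst v, 0))) (at (\<xi>, m))"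
        by (auto intro!: derivative_eq_intros)
      from has_derivative_compose[OF this, of f "frechet_derivative f (at (\<xi>, m0))"]
      show "((\<lambda>p. f (fst p, m0)) has_derivative (\<lambda>v. A (fst v))) (at (\<xi>, m))"
        using smooth_on_has_derivative[OF f p0] by (simp add: A_def)
    qed
    finally show ?thesis by simp
  qed
  define N where "N = {Q \<in> fst c. snd c Q \<in> X \<times> Y}"
  have openN: "openin (atlas_topology J2_atlas) N"
    unfolding N_def by (rule openin_chart_vimage[OF smooth_atlas_J2 charts(1)])
      (use XY in \<open>auto intro: open_Times\<close>)
  have ND: "Q \<in> D \<and> \<phi> Q \<in> fst d" if "Q \<in> N" for Q
  proof -
    have Q: "Q \<in> fst c" "snd c Q \<in> S"
      using that XY by (auto simp: N_def)
    then obtain Q' where Q': "Q' \<in> D" "Q' \<in> fst c" "\<phi> Q' \<in> fst d" "snd c Q = snd c Q'"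
      using S_cases by metis
    then have "Q = Q'"
      using Q inj_onD[OF inj_on_J2_chart[OF frame]] by metis
    then show ?thesis using Q' by simp
  qed
  have PN: "P \<in> N"
    using P Pe XY by (simp add: N_def)
  have act: "fst (\<phi> Q) = fst (\<phi> P) \<and> snd (\<phi> Q) = A ` snd Q" if Q: "Q \<in> N" "fst Q = \<xi>" for Q
  proof -
    have Qc: "Q \<in> fst c" using Q by (simp add: N_def)
    note QD = ND[OF Q(1)]
    obtain m where Qe: "Q = (\<xi>, lagr_plane (b \<xi>) m)" "snd c Q = (\<xi>, m)"
      using J2_chart_cases[OF frame Qc] Q(2) by (metis fst_conv)
    have m: "m \<in> Y" using Q(1) Qe(2) by (simp add: N_def)
    have "fst (\<phi> Q) = f (\<xi>, m)"
      using F_eq[OF Qc] Qe(2) by simp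
    also have "\<dots> = f (\<xi>, m0)"
      using const XY m by blast
    also have "\<dots> = fst (\<phi> P)"
      using F_eq[OF P(2)] Pe(3) by simp
    finally have 1: "fst (\<phi> Q) = fst (\<phi> P)" .
    have image_fst: "fst ` {v :: J1 \<times> (real^3). fst v \<in> X} = X" for X
      by (auto intro: image_eqI[of _ _ "(_, 0)"])
    \<comment> \<open>In coordinates the canonical system is the plane times the vertical space, so
      the plane is its projection; \<open>DF_canonical\<close> then determines the image
      plane.\<close>
    have "snd (\<phi> Q) = fst ` {v :: J1 \<times> (real^3). fst v \<in> snd (\<phi> Q)}"
      by (rule image_fst[symmetric])
    also have "\<dots> = (\<lambda>v. fst (frechet_derivative F (at (\<xi>, m)) v)) ` {v. fst v \<in> snd Q}"
      using DF_canonical[of Q] QD Qc Qe(2) by (simp add: image_image[symmetric] del: split_paired_All)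
    also have "\<dots> = (\<lambda>v. A (fst v)) ` {v :: J1 \<times> (real^3). fst v \<in> snd Q}"
    proof -
      have "(\<xi>, m) \<in> S" using XY m by blast
      then have "fst (frechet_derivative F (at (\<xi>, m)) v) = A (fst v)" for v
        using Df[of "(\<xi>, m)"] DfA[OF m, of v] by simp
      then show ?thesis
        by simp
    qed
    also have "\<dots> = A ` snd Q"
      using image_fst[of "snd Q"] by (metis image_image)
    finally show ?thesis using 1 by simp
  qed
  have \<xi>': "f (\<xi>, m0) = fst (\<phi> P)"
    using F_eq[OF P(2)] Pe(3) by simp
  have onto: "A ` contact_plane \<xi> = contact_plane (fst (\<phi> P))"
    using Df_contact_plane[OF p0, of _ 0] Df_onto_contact_plane[OF p0 surj_Df[OF p0]]
    unfolding \<xi>' A_def by blast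
  have "conf_iso (contact_plane \<xi>) (\<eta> \<xi>) (contact_plane (fst (\<phi> P))) (\<eta> (fst (\<phi> P))) A"
  proof (rule conf_iso_of_lagr_planes[OF contact.sympl_space_axioms contact.sympl_space_axioms
        local_frame_basis[OF frame Pe(1)] conf_sympl_basis_std_frame linA onto XY(2,4)])
    fix m u v assume m: "m \<in> Y" and uv: "u \<in> lagr_plane (b \<xi>) m" "v \<in> lagr_plane (b \<xi>) m"
    define Q where "Q = (\<xi>, lagr_plane (b \<xi>) m)"
    have Q: "Q \<in> N" "fst Q = \<xi>"
      using m XY(3) Pe(1) snd_J2_chart_lagr_plane[OF frame Pe(1)]
      by (simp_all add: N_def Q_def in_J2_chart)
    have "\<phi> Q \<in> J2_points"
      using ND[OF Q(1)] charts(2) carrier_J2_subset unfolding carrier_of_def by blast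
    then have "A ` lagr_plane (b \<xi>) m \<in> LG (contact_plane (fst (\<phi> P))) (\<eta> (fst (\<phi> P)))"
      using act[OF Q] by (cases "\<phi> Q") (simp add: J2_points_def Q_def)
    then show "\<eta> (fst (\<phi> P)) (A u) (A v) = 0"
      using uv by (simp add: LG_def)
  qed
  then have "conf_iso (contact_plane (fst P)) (\<eta> (fst P)) (contact_plane (fst (\<phi> P))) (\<eta> (fst (\<phi> P))) A"
    by (simp only: Pe(2) fst_conv)
  moreover have "\<phi> Q = (fst (\<phi> P), A ` snd Q)" if "Q \<in> N" "fst Q = fst P" for Q
    using act[OF that(1)] that(2) Pe(2) by (intro prod_eqI) simp_all
  moreover have "N \<subseteq> D"
    using ND by blast
  ultimately show ?thesis
    using openN PN by blast
qed

end

lemma contact_chartsI: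
  assumes "contact_transformation D \<phi>" "P \<in> D"
  obtains B b B' b' where "contact_charts D \<phi> B b B' b'" "P \<in> fst (J2_chart B b)" "\<phi> P \<in> fst (J2_chart B' b')"
proof -
  have "P \<in> carrier_of J2_atlas" "\<phi> P \<in> carrier_of J2_atlas"
    using assms unfolding contact_transformation_def openin_atlas[OF smooth_atlas_J2] by blast+
  then obtain B b B' b' where "local_frame B b" "P \<in> fst (J2_chart B b)"
    "local_frame B' b'" "\<phi> P \<in> fst (J2_chart B' b')"
    unfolding carrier_of_def J2_atlas_eq by blast
  then show thesis
    using that assms(1) contact_charts.intro by metis
qed

lemma fibre_map:
  assumes "contact_transformation D \<phi>" "P \<in> D"
  obtains A N where "openin (atlas_topology J2_atlas) N" "P \<in> N" "N \<subseteq> D"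
    "conf_iso (contact_plane (fst P)) (\<eta> (fst P)) (contact_plane (fst (\<phi> P))) (\<eta> (fst (\<phi> P))) A"
    "\<And>Q. Q \<in> N \<Longrightarrow> fst Q = fst P \<Longrightarrow> \<phi> Q = (fst (\<phi> P), A ` snd Q)"
proof -
  obtain B b B' b' where "contact_charts D \<phi> B b B' b'" "P \<in> fst (J2_chart B b)" "\<phi> P \<in> fst (J2_chart B' b')"
    using contact_chartsI[OF assms] .
  from contact_charts.fibre_map_charts[OF this(1) assms(2) this(2,3)] show thesis
    using that by blast
qed

section \<open>Contact invariance\<close>

text \<open>\<open>A v\<close> has in the basis \<open>A \<circ> b\<close> the coordinates that
  \<open>v\<close> has in \<open>b\<close>. With this basis in the target fibre, a map and its
  transform become the same map into the standard Grassmannian.\<close>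

lemma psi_conf_iso:
  assumes A: "conf_iso (contact_plane \<xi>) (\<eta> \<xi>) (contact_plane \<xi>') (\<eta> \<xi>') A"
    and b: "conf_sympl_basis (contact_plane \<xi>) (\<eta> \<xi>) b" and P: "P \<in> carrier_of (fibre_atlas \<xi>)"
  shows "psi (A \<circ> b) (\<xi>', A ` snd P) = psi b P"
proof -
  have l: "linear A" using A by (simp add: conf_iso_def)
  have "basis_coords (A \<circ> b) (A v) = basis_coords b v" if v: "v \<in> contact_plane \<xi>" for v
  proof -
    have "A v \<in> contact_plane \<xi>'" using A v by (auto simp: conf_iso_def)
    then have "frame_comb (A \<circ> b) (basis_coords (A \<circ> b) (A v)) = A v"
      by (rule frame_comb_basis_coords[OF conf_iso_basis[OF A b]])
    also have "\<dots> = frame_comb (A \<circ> b) (basis_coords b v)"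
      by (simp add: frame_comb_basis_coords[OF b v] frame_comb_linear[OF l])
    finally show ?thesis
      by (simp add: frame_comb_inject[OF conf_iso_basis[OF A b]])
  qed
  then show ?thesis
    unfolding psi_def snd_conv image_image using snd_carrier_fibre[OF P]
    by (intro image_cong[OF refl]) blast
qed

text \<open>\<open>induced_by\<close> gives the formula for every basis, so the invariance of
  \<kappa> is already contained in it. The standard frame is used at the source and its image under
  \<open>A\<close> at the target.\<close>

lemma contact_invariant_induced:
  assumes U: "smooth_atlas U" and K: "induced_by U n \<kappa> K"
  shows "contact_invariant U n K"
  unfolding contact_invariant_def
proof (intro allI impI)
  fix D \<phi> \<xi> x s
  assume \<phi>: "contact_transformation D \<phi>" and s: "local_map U (fibre_atlas \<xi>) x s" and x: "s x \<in> D"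
  obtain V where V: "openin (atlas_topology U) V" "x \<in> V" "smooth_map U (fibre_atlas \<xi>) V s"
    using s by (auto simp: local_map_def)
  have fst_s: "fst (s y) = \<xi>" if "y \<in> V" for y
    by (rule fst_carrier_fibre[OF smooth_map_carrier[OF V(3) that]])
  define \<xi>' where "\<xi>' = fst (\<phi> (s x))"
  obtain A N where N: "openin (atlas_topology J2_atlas) N" "s x \<in> N"
    and A: "conf_iso (contact_plane \<xi>) (\<eta> \<xi>) (contact_plane \<xi>') (\<eta> \<xi>') A"
    and act: "\<And>Q. Q \<in> N \<Longrightarrow> fst Q = \<xi> \<Longrightarrow> \<phi> Q = (\<xi>', A ` snd Q)"
    using fibre_map[OF \<phi> x] fst_s[OF V(2)] unfolding \<xi>'_def by metis
  define h :: "J2 \<Rightarrow> J2" where "h P = (\<xi>', A ` snd P)" for P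
  define V' where "V' = {y \<in> V. s y \<in> N}"
  have V': "openin (atlas_topology U) V'" "x \<in> V'"
    using openin_fibre_vimage[OF U V(1,3) N(1)] V(2) N(2) by (auto simp: V'_def)
  have eq: "(h \<circ> s) y = (\<phi> \<circ> s) y" if "y \<in> V'" for y
    using act[of "s y"] that fst_s by (simp add: V'_def h_def)
  have "local_map U (fibre_atlas \<xi>') x (h \<circ> s)"
    using local_map_atlas_iso[OF U s atlas_iso_fibres[OF A]] by (simp add: h_def[abs_def])
  then have lm: "local_map U (fibre_atlas \<xi>') x (\<phi> \<circ> s)"
    by (rule local_map_cong[OF U V', rotated]) (rule eq)
  note b = conf_sympl_basis_std_frame[of \<xi>]
  have "K (jet U (fibre_atlas \<xi>') n x (\<phi> \<circ> s)) = \<kappa> (jet U LG24_atlas n x (psi (A \<circ> std_frame \<xi>) \<circ> (\<phi> \<circ> s)))"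
    using K lm conf_iso_basis[OF A b] unfolding induced_by_def by blast
  also have "jet U LG24_atlas n x (psi (A \<circ> std_frame \<xi>) \<circ> (\<phi> \<circ> s)) = jet U LG24_atlas n x (psi (std_frame \<xi>) \<circ> s)"
  proof (rule jet_eqI[OF same_jet_germ[OF U V']])
    fix y assume y: "y \<in> V'"
    then have "s y \<in> carrier_of (fibre_atlas \<xi>)"
      using smooth_map_carrier[OF V(3)] by (simp add: V'_def)
    then show "(psi (A \<circ> std_frame \<xi>) \<circ> (\<phi> \<circ> s)) y = (psi (std_frame \<xi>) \<circ> s) y"
      using psi_conf_iso[OF A b, of "s y"] eq[OF y] by (simp add: h_def)
  qed
  also have "\<kappa> \<dots> = K (jet U (fibre_atlas \<xi>) n x s)"
    using K s b unfolding induced_by_def by metis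
  finally show "local_map U (fibre_atlas (fst (\<phi> (s x)))) x (\<phi> \<circ> s) \<and>
      K (jet U (fibre_atlas (fst (\<phi> (s x)))) n x (\<phi> \<circ> s)) = K (jet U (fibre_atlas \<xi>) n x s)"
    using lm unfolding \<xi>'_def by blast
qed

section \<open>Images of equations\<close>

context contact_charts
begin

text \<open>In coordinates the image has the equation \<open>E\<close> composed with the inverse
  \<open>G\<close>. The differential is recorded as well, since transversality of the image is read
  off from it.\<close>

lemma local_equation_image:
  assumes P: "P \<in> D" "P \<in> fst c" "\<phi> P \<in> fst d" and E: "local_equation c \<Sigma> P E"
  shows "local_equation d (\<phi> ` (\<Sigma> \<inter> D)) (\<phi> P) (\<lambda>w. E (G w))"
    and "frechet_derivative (\<lambda>w. E (G w)) (at (snd d (\<phi> P))) =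
      (\<lambda>v. frechet_derivative E (at (snd c P)) (frechet_derivative G (at (snd d (\<phi> P))) v))"
proof -
  obtain W where W: "open W" "snd c P \<in> W" "W \<subseteq> snd c ` fst c" "smooth_on W E"
    "\<forall>w\<in>W. frechet_derivative E (at w) \<noteq> (\<lambda>_. 0)" "snd c ` (\<Sigma> \<inter> fst c) \<inter> W = {w\<in>W. E w = 0}"
    using E unfolding local_equation_def by blast
  define W' where "W' = T \<inter> G -` W"
  have W': "open W'"
    unfolding W'_def by (metis continuous_on_open_vimage[OF open_T] smooth_on_continuous_on[OF smooth_G] W(1) Int_commute)
  have PW': "snd d (\<phi> P) \<in> W'"
    using T_I[OF P] G_eq[OF P(1,3)] W(2) by (simp add: W'_def)
  have D: "frechet_derivative (\<lambda>w. E (G w)) (at w) =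
      (\<lambda>v. frechet_derivative E (at (G w)) (frechet_derivative G (at w) v))" if "w \<in> W'" for w
    by (rule frechet_derivative_at[symmetric],
        rule has_derivative_compose[OF smooth_on_has_derivative[OF smooth_G] smooth_on_has_derivative[OF W(4)]])
      (use that in \<open>auto simp: W'_def\<close>)
  show "frechet_derivative (\<lambda>w. E (G w)) (at (snd d (\<phi> P))) =
      (\<lambda>v. frechet_derivative E (at (snd c P)) (frechet_derivative G (at (snd d (\<phi> P))) v))"
    using D[OF PW'] G_eq[OF P(1,3)] by simp
  have nz: "frechet_derivative (\<lambda>w. E (G w)) (at w) \<noteq> (\<lambda>_. 0)" if w: "w \<in> W'" for w
  proof
    assume 0: "frechet_derivative (\<lambda>w. E (G w)) (at w) = (\<lambda>_. 0)"
    have GS: "G w \<in> S" "F (G w) = w"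
      using w F_G by (auto simp: W'_def)
    have "frechet_derivative E (at (G w)) v = 0" for v
      using fun_cong[OF 0, of "frechet_derivative F (at (G w)) v"] DG_DF[OF GS(1), of v]
      unfolding D[OF w] GS(2) by simp
    then have "frechet_derivative E (at (G w)) = (\<lambda>_. 0)"
      by (rule ext)
    then show False
      using W(5) w by (simp add: W'_def)
  qed
  have zero: "snd d ` (\<phi> ` (\<Sigma> \<inter> D) \<inter> fst d) \<inter> W' = {w\<in>W'. E (G w) = 0}"
  proof -
    have "w \<in> snd d ` (\<phi> ` (\<Sigma> \<inter> D) \<inter> fst d) \<longleftrightarrow> E (G w) = 0" if w: "w \<in> W'" for w
    proof -
      have "w \<in> T" using w by (simp add: W'_def)
      then obtain Q where Q: "Q \<in> D" "Q \<in> fst c" "\<phi> Q \<in> fst d" "w = snd d (\<phi> Q)" "G w = snd c Q"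
        by (rule T_cases)
      have "w \<in> snd d ` (\<phi> ` (\<Sigma> \<inter> D) \<inter> fst d) \<longleftrightarrow> \<phi> Q \<in> \<phi> ` (\<Sigma> \<inter> D)"
        using inj_on_image_mem_iff[OF inj_on_J2_chart[OF frame'] Q(3), of "\<phi> ` (\<Sigma> \<inter> D) \<inter> fst d"] Q(3,4)
        by simp
      also have "\<dots> \<longleftrightarrow> Q \<in> \<Sigma>"
        using inj_on_image_mem_iff[OF inj_\<phi> Q(1), of "\<Sigma> \<inter> D"] Q(1) by simp
      also have "\<dots> \<longleftrightarrow> snd c Q \<in> snd c ` (\<Sigma> \<inter> fst c)"
        using inj_on_image_mem_iff[OF inj_on_J2_chart[OF frame] Q(2), of "\<Sigma> \<inter> fst c"] Q(2) by simp
      also have "\<dots> \<longleftrightarrow> E (G w) = 0"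
        using W(6) w Q(5) unfolding W'_def by auto
      finally show ?thesis .
    qed
    then show ?thesis by blast
  qed
  have "W' \<subseteq> snd d ` fst d"
    by (auto simp: W'_def T_def)
  moreover have "smooth_on W' (\<lambda>w. E (G w))"
    by (rule smooth_on_compose[OF W(4) smooth_on_subset[OF smooth_G] W' W(1)]) (auto simp: W'_def)
  ultimately show "local_equation d (\<phi> ` (\<Sigma> \<inter> D)) (\<phi> P) (\<lambda>w. E (G w))"
    unfolding local_equation_def using P(3) W' PW' nz zero by blast
qed

text \<open>The image of an equation stays transverse to the fibres because the differential of a
  contact transformation maps vertical vectors to vertical vectors.\<close>
lemma transverse_image:
  assumes P: "P \<in> D" "P \<in> fst c" "\<phi> P \<in> fst d"
    and T: "{u + v | u v. u \<in> T0 \<and> fst v = 0} = UNIV"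
  shows "{u + v | u v. frechet_derivative G (at (snd d (\<phi> P))) u \<in> T0 \<and> fst v = 0} = UNIV"
    and "fst ` {u. frechet_derivative G (at (snd d (\<phi> P))) u \<in> T0} = UNIV"
proof -
  let ?DF = "frechet_derivative F (at (snd c P))" and ?DG = "frechet_derivative G (at (snd d (\<phi> P)))"
  have p: "snd c P \<in> S" "F (snd c P) = snd d (\<phi> P)"
    using S_I[OF P] F_eq[OF P(2)] by auto
  have lin: "linear ?DF"
    by (rule has_derivative_linear[OF smooth_on_has_derivative[OF smooth_F p(1)]])
  have *: "\<exists>u v. w = u + v \<and> ?DG u \<in> T0 \<and> fst v = 0" for w
  proof -
    have "?DG w \<in> {u + v | u v. u \<in> T0 \<and> fst v = 0}"
      unfolding T by simp
    then obtain u v where uv: "?DG w = u + v" "u \<in> T0" "fst v = 0"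
      by blast
    have "w = ?DF u + ?DF v"
      using DF_DG[OF p(1), of w] unfolding p(2) uv(1) linear_add[OF lin] by simp
    moreover have "?DG (?DF u) = u"
      using DG_DF[OF p(1)] unfolding p(2) .
    moreover have "fst (?DF v) = 0"
      using vertical[OF p(1), of "snd v"] uv(3) by (metis prod.collapse)
    ultimately show ?thesis using uv(2) by metis
  qed
  then show "{u + v | u v. ?DG u \<in> T0 \<and> fst v = 0} = UNIV"
    by blast
  have "y \<in> fst ` {u. ?DG u \<in> T0}" for y
  proof -
    obtain u v where "(y, 0) = u + v" "?DG u \<in> T0" "fst v = 0"
      using * by metis
    then have "y = fst u"
      by (metis fst_add fst_conv add.right_neutral)
    then show ?thesis
      using \<open>?DG u \<in> T0\<close> by blast
  qed
  then show "fst ` {u. ?DG u \<in> T0} = UNIV"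
    by blast
qed

end

lemma contact_transformation_points:
  assumes "contact_transformation D \<phi>"
  shows "D \<subseteq> J2_points" "\<phi> ` D \<subseteq> J2_points"
proof -
  have "openin (atlas_topology J2_atlas) D" "openin (atlas_topology J2_atlas) (\<phi> ` D)"
    using assms by (simp_all add: contact_transformation_def)
  then have "D \<subseteq> carrier_of J2_atlas" "\<phi> ` D \<subseteq> carrier_of J2_atlas"
    by (simp_all only: openin_atlas[OF smooth_atlas_J2])
  then show "D \<subseteq> J2_points" "\<phi> ` D \<subseteq> J2_points"
    using carrier_J2_subset by blast+
qed

lemma is_PDE_over_image:
  assumes \<phi>: "contact_transformation D \<phi>" and \<Sigma>: "is_PDE_over B0 \<Sigma>"
  shows "is_PDE_over (fst ` \<phi> ` (\<Sigma> \<inter> D)) (\<phi> ` (\<Sigma> \<inter> D))"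
  unfolding is_PDE_over_def
proof (intro conjI ballI)
  show "\<phi> ` (\<Sigma> \<inter> D) \<subseteq> J2_points"
    using contact_transformation_points(2)[OF \<phi>] by blast
  fix R assume "R \<in> \<phi> ` (\<Sigma> \<inter> D)"
  then obtain P where P: "P \<in> \<Sigma>" "P \<in> D" "R = \<phi> P" by blast
  obtain c E where c: "c \<in> J2_atlas" "local_equation c \<Sigma> P E"
    and tr: "let T = {v. frechet_derivative E (at (snd c P)) v = 0}; dpi = chart_diff c J1_chart fst P
      in {u + v | u v. u \<in> T \<and> dpi v = 0} = UNIV \<and> dpi ` T = UNIV"
    using \<Sigma> P(1) unfolding is_PDE_over_def by blast
  obtain B b where cb: "c = J2_chart B b" "local_frame B b"
    using c(1) by (auto simp: J2_atlas_eq)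
  have Pc: "P \<in> fst (J2_chart B b)"
    using c(2) cb(1) by (simp add: local_equation_def)
  obtain B1 b1 B' b' where "contact_charts D \<phi> B1 b1 B' b'" and Rd: "\<phi> P \<in> fst (J2_chart B' b')"
    using contact_chartsI[OF \<phi> P(2)] by metis
  \<comment> \<open>The given equation prescribes the source chart, so only the target chart is
    taken from the pair just obtained.\<close>
  then have cc: "contact_charts D \<phi> B b B' b'"
    using cb(2) by (simp add: contact_charts_def)
  let ?d = "J2_chart B' b'" and ?G = "contact_charts.G D \<phi> B b B' b'"
  have frame': "local_frame B' b'"
    using cc by (simp add: contact_charts_def)
  note le = contact_charts.local_equation_image[OF cc P(2) Pc Rd c(2)[unfolded cb(1)]]
  have "{u + v | u v. u \<in> {v. frechet_derivative E (at (snd c P)) v = 0} \<and> fst v = 0} = UNIV"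
    using tr unfolding Let_def cb(1) chart_diff_fst[OF cb(2) Pc] by blast
  note tr' = contact_charts.transverse_image[OF cc P(2) Pc Rd this, unfolded mem_Collect_eq]
  show "\<exists>c\<in>J2_atlas. \<exists>F. local_equation c (\<phi> ` (\<Sigma> \<inter> D)) R F \<and>
        (let T = {v. frechet_derivative F (at (snd c R)) v = 0}; dpi = chart_diff c J1_chart fst R
         in {u + v | u v. u \<in> T \<and> dpi v = 0} = UNIV \<and> dpi ` T = UNIV)"
    unfolding P(3)
  proof (intro bexI exI conjI)
    show "local_equation ?d (\<phi> ` (\<Sigma> \<inter> D)) (\<phi> P) (\<lambda>w. E (?G w))" by (rule le(1))
    show "?d \<in> J2_atlas" using frame' by (auto simp: J2_atlas_eq)
    show "let T = {v. frechet_derivative (\<lambda>w. E (?G w)) (at (snd ?d (\<phi> P))) v = 0};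
        dpi = chart_diff ?d J1_chart fst (\<phi> P)
      in {u + v | u v. u \<in> T \<and> dpi v = 0} = UNIV \<and> dpi ` T = UNIV"
      unfolding Let_def le(2) chart_diff_fst[OF frame' Rd] mem_Collect_eq
      using tr' by (simp add: cb(1))
  qed
qed simp

text \<open>The parametrization is pulled back by the inverse \<open>h\<close> of the linear fibre
  map rather than by the inverse of \<phi>: \<open>h\<close> is an \<open>atlas_iso\<close>, so
  smoothness and injectivity of the differentials carry over chart by chart.\<close>

lemma local_parametrization_preimage:
  assumes U: "smooth_atlas U" and \<phi>: "contact_transformation D \<phi>"
    and s: "local_parametrization U (\<phi> ` (\<Sigma> \<inter> D)) \<xi>' x s"
  obtains t \<xi> V where "local_parametrization U \<Sigma> \<xi> x t" "t x \<in> D" "\<xi>' = fst (\<phi> (t x))"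
    "openin (atlas_topology U) V" "x \<in> V" "\<And>y. y \<in> V \<Longrightarrow> \<phi> (t y) = s y"
proof -
  obtain V where V: "openin (atlas_topology U) V" "x \<in> V" "smooth_map U (fibre_atlas \<xi>') V s"
    "s ` V \<subseteq> \<phi> ` (\<Sigma> \<inter> D)" "inj_on s V"
    and imm: "\<forall>y\<in>V. \<forall>c\<in>U. \<forall>d\<in>fibre_atlas \<xi>'. y \<in> fst c \<longrightarrow> s y \<in> fst d \<longrightarrow> inj (chart_diff c d s y)"
    using s unfolding local_parametrization_def by blast
  obtain P where P: "P \<in> \<Sigma>" "P \<in> D" "s x = \<phi> P"
    using V(2,4) by blast
  have fst_s: "fst (s y) = \<xi>'" if "y \<in> V" for y
    by (rule fst_carrier_fibre[OF smooth_map_carrier[OF V(3) that]])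
  define \<xi> where "\<xi> = fst P"
  have \<xi>': "\<xi>' = fst (\<phi> P)" using fst_s[OF V(2)] P(3) by simp
  obtain A N where N: "openin (atlas_topology J2_atlas) N" "P \<in> N" "N \<subseteq> D"
    and A: "conf_iso (contact_plane \<xi>) (\<eta> \<xi>) (contact_plane \<xi>') (\<eta> \<xi>') A"
    and act: "\<And>Q. Q \<in> N \<Longrightarrow> fst Q = \<xi> \<Longrightarrow> \<phi> Q = (\<xi>', A ` snd Q)"
    using fibre_map[OF \<phi> P(2)] unfolding \<xi>_def \<xi>' by metis
  obtain B where B: "conf_iso (contact_plane \<xi>') (\<eta> \<xi>') (contact_plane \<xi>) (\<eta> \<xi>) B"
    "\<And>v. v \<in> contact_plane \<xi> \<Longrightarrow> B (A v) = v" "\<And>w. w \<in> contact_plane \<xi>' \<Longrightarrow> A (B w) = w"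
    using conf_iso_inverse[OF A subspace_of_basis[OF conf_sympl_basis_std_frame]] by metis
  define h :: "J2 \<Rightarrow> J2" where "h Q = (\<xi>, B ` snd Q)" for Q
  have h: "atlas_iso (fibre_atlas \<xi>') (fibre_atlas \<xi>) h"
    using atlas_iso_fibres[OF B(1)] by (simp add: h_def[abs_def])
  have sm: "smooth_map U (fibre_atlas \<xi>) V (h \<circ> s)"
    by (rule smooth_map_atlas_iso[OF U V(3) h])
  \<comment> \<open>On \<open>V'\<close> the values of \<open>h \<circ> s\<close> stay where the
    linear map describes \<phi>, so \<open>h\<close> inverts \<phi> there.\<close>
  define V' where "V' = {y \<in> V. (h \<circ> s) y \<in> N}"
  have oV': "openin (atlas_topology U) V'"
    unfolding V'_def by (rule openin_fibre_vimage[OF U V(1) sm N(1)])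
  have "P \<in> J2_points"
    using P(2) contact_transformation_points(1)[OF \<phi>] by blast
  then have "snd P \<subseteq> contact_plane \<xi>"
    by (cases P) (simp add: J2_points_def LG_def \<xi>_def)
  then have "B ` A ` snd P = snd P"
    using B(2) by (force simp: image_image)
  then have hx: "(h \<circ> s) x = P"
    using act[OF N(2)] P(3) by (simp add: h_def \<xi>_def)
  then have xV': "x \<in> V'"
    using V(2) N(2) by (simp add: V'_def)
  have \<phi>h: "\<phi> ((h \<circ> s) y) = s y" if y: "y \<in> V'" for y
  proof -
    have y': "y \<in> V" "(h \<circ> s) y \<in> N" using y by (auto simp: V'_def)
    have "snd (s y) \<subseteq> contact_plane \<xi>'"
      by (rule snd_carrier_fibre[OF smooth_map_carrier[OF V(3) y'(1)]])
    then have "A ` B ` snd (s y) = snd (s y)"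
      using B(3) by (force simp: image_image)
    then have "\<phi> ((h \<circ> s) y) = (\<xi>', snd (s y))"
      using act[OF y'(2)] by (simp add: h_def)
    then show ?thesis
      using fst_s[OF y'(1)] by (metis prod.collapse)
  qed
  have inj_\<phi>: "inj_on \<phi> D" using \<phi> by (simp add: contact_transformation_def)
  have "local_parametrization U \<Sigma> \<xi> x (h \<circ> s)"
    unfolding local_parametrization_def
  proof (intro exI[of _ V'] conjI ballI impI)
    show "openin (atlas_topology U) V'" "x \<in> V'" by (rule oV' xV')+
    show "smooth_map U (fibre_atlas \<xi>) V' (h \<circ> s)"
      by (rule smooth_map_subset[OF sm oV']) (auto simp: V'_def)
    show "(h \<circ> s) ` V' \<subseteq> \<Sigma>"
    proof
      fix Q assume "Q \<in> (h \<circ> s) ` V'"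
      then obtain y where y: "y \<in> V'" "Q = (h \<circ> s) y" by blast
      then have "Q \<in> D" "y \<in> V" using N(3) by (auto simp: V'_def)
      moreover have "\<phi> Q \<in> \<phi> ` (\<Sigma> \<inter> D)"
        using \<phi>h[OF y(1)] y(2) V(4) \<open>y \<in> V\<close> by auto
      ultimately show "Q \<in> \<Sigma>"
        using inj_onD[OF inj_\<phi>] by blast
    qed
    show "inj_on (h \<circ> s) V'"
      using \<phi>h V(5) unfolding inj_on_def V'_def by (metis (no_types, lifting) mem_Collect_eq)
    fix y c d assume y: "y \<in> V'" "c \<in> U" "d \<in> fibre_atlas \<xi>" "y \<in> fst c" "(h \<circ> s) y \<in> fst d"
    have yV: "y \<in> V" using y(1) by (simp add: V'_def)
    obtain d' where d': "d' \<in> fibre_atlas \<xi>'" "corresponding_charts (fibre_atlas \<xi>') h d' d"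
      using h y(3) unfolding atlas_iso_def by blast
    have "s y \<in> fst d'"
      using d'(2) y(5) smooth_map_carrier[OF V(3) yV] by (simp add: corresponding_charts_def del: split_paired_All)
    then show "inj (chart_diff c d (h \<circ> s) y)"
      unfolding chart_diff_atlas_iso[OF U V(1,3) y(2) d'(2) yV y(4)]
      using imm yV y(2,4) d'(1) by blast
  qed
  then show thesis
    by (rule that[of \<xi> "h \<circ> s" V']) (simp_all only: hx P(2) \<xi>' oV' xV' \<phi>h)
qed

section \<open>Global transformations and invariance of the class\<close>

text \<open>By \<open>LG_cover\<close> every plane of the fibre shares with the fixed plane
  \<open>L\<close> a chart range that is a copy of R^3. On it the base point of the image is locally
  constant by \<open>fibre_map\<close>, hence constant. The chart range has to lie in the domain,
  hence \<open>J2_points\<close>.\<close>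

lemma fst_image_fibre_const:
  assumes \<phi>: "contact_transformation J2_points \<phi>"
    and P: "P \<in> J2_points" "Q \<in> J2_points" "fst P = fst Q"
  shows "fst (\<phi> P) = fst (\<phi> Q)"
proof -
  define \<xi> where "\<xi> = fst P"
  let ?b = "std_frame \<xi>"
  define L where "L = span {?b 1 + ?b 3, ?b 2 + ?b 4}"
  have "fst (\<phi> P') = fst (\<phi> (\<xi>, L))" if P': "P' \<in> J2_points" "fst P' = \<xi>" for P'
  proof -
    have "snd P' \<in> LG (contact_plane \<xi>) (\<eta> \<xi>)"
      using P' by (cases P') (simp add: J2_points_def)
    then obtain b where b: "conf_sympl_basis (contact_plane \<xi>) (\<eta> \<xi>) b"
      and r: "snd P' \<in> range (lagr_plane b)" "L \<in> range (lagr_plane b)"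
      using contact.LG_cover[OF conf_sympl_basis_std_frame] unfolding L_def by metis
    obtain b' where b': "local_frame UNIV b'" "b' \<xi> = b"
      using extend_basis[OF b] .
    let ?c = "J2_chart UNIV b'"
    have c: "?c \<in> J2_atlas" using b' by (auto simp: J2_atlas_eq)
    let ?g = "\<lambda>m. fst (\<phi> (\<xi>, lagr_plane b m))"
    have mem: "(\<xi>, lagr_plane b m) \<in> J2_points" for m
      using contact.lagr_plane_in_LG[OF b] by (simp add: J2_points_def)
    have "\<exists>M. open M \<and> m \<in> M \<and> (\<forall>m'\<in>M. ?g m' = ?g m)" for m
    proof -
      obtain A N where N: "openin (atlas_topology J2_atlas) N" "(\<xi>, lagr_plane b m) \<in> N"
        and act: "\<And>Q. Q \<in> N \<Longrightarrow> fst Q = \<xi> \<Longrightarrow> \<phi> Q = (?g m, A ` snd Q)"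
        using fibre_map[OF \<phi> mem[of m]] by (metis fst_conv)
      have o: "open (snd ?c ` (N \<inter> fst ?c))"
        using N(1) c openin_atlas[OF smooth_atlas_J2] by blast
      have iff: "(\<xi>, m') \<in> snd ?c ` (N \<inter> fst ?c) \<longleftrightarrow> (\<xi>, lagr_plane b m') \<in> N" for m'
      proof -
        have Q: "(\<xi>, lagr_plane b m') \<in> fst ?c" "snd ?c (\<xi>, lagr_plane b m') = (\<xi>, m')"
          using b' snd_J2_chart_lagr_plane[OF b'(1), of \<xi> m'] by (auto simp: in_J2_chart)
        then show ?thesis
          using inj_on_image_mem_iff[OF inj_on_J2_chart[OF b'(1)] Q(1), of "N \<inter> fst ?c"] by simp
      qed
      define M where "M = (\<lambda>m'. (\<xi>, m')) -` (snd ?c ` (N \<inter> fst ?c))"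
      have M: "m' \<in> M \<longleftrightarrow> (\<xi>, lagr_plane b m') \<in> N" for m'
        unfolding M_def vimage_eq by (rule iff)
      have "open M"
        unfolding M_def by (rule continuous_open_vimage[OF o]) (intro continuous_intros)
      moreover have "?g m' = ?g m" if "m' \<in> M" for m'
        using act[OF that[unfolded M]] by simp
      moreover have "m \<in> M"
        using N(2) M by simp
      ultimately show ?thesis
        by blast
    qed
    then have "?g constant_on UNIV"
      by (intro locally_constant_imp_constant connected_UNIV) (simp add: open_openin[symmetric])
    then show ?thesis
      using r P'(2) unfolding constant_on_def by (metis UNIV_I image_iff prod.collapse)
  qed
  then show ?thesis
    using P by (metis \<xi>_def)
qed

lemma contact_invariant_class_induced:
  assumes U: "smooth_atlas U" and K: "contact_invariant U n K"
  shows "contact_invariant_class (PDE_class U n K k)"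
proof -
  have loc: "\<phi> ` (\<Sigma> \<inter> D) \<in> PDE_class U n K k (fst ` \<phi> ` (\<Sigma> \<inter> D))"
    if \<phi>: "contact_transformation D \<phi>" and \<Sigma>: "\<Sigma> \<in> PDE_class U n K k B" for D \<phi> B \<Sigma>
    unfolding PDE_class_def
  proof (intro CollectI conjI allI impI)
    show "is_PDE_over (fst ` \<phi> ` (\<Sigma> \<inter> D)) (\<phi> ` (\<Sigma> \<inter> D))"
      using is_PDE_over_image[OF \<phi>] \<Sigma> by (auto simp: PDE_class_def)
    fix \<xi>' x s assume s: "local_parametrization U (\<phi> ` (\<Sigma> \<inter> D)) \<xi>' x s"
    obtain t \<xi> V where t: "local_parametrization U \<Sigma> \<xi> x t" "t x \<in> D" "\<xi>' = fst (\<phi> (t x))"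
      and V: "openin (atlas_topology U) V" "x \<in> V" "\<And>y. y \<in> V \<Longrightarrow> \<phi> (t y) = s y"
      using local_parametrization_preimage[OF U \<phi> s] by metis
    have "local_map U (fibre_atlas \<xi>) x t"
      using t(1) unfolding local_parametrization_def local_map_def by blast
    then have "K (jet U (fibre_atlas \<xi>') n x (\<phi> \<circ> t)) = K (jet U (fibre_atlas \<xi>) n x t)"
      using K \<phi> t(2) unfolding contact_invariant_def t(3) by blast
    also have "\<dots> = k"
      using \<Sigma> t(1) unfolding PDE_class_def by blast
    also have "jet U (fibre_atlas \<xi>') n x (\<phi> \<circ> t) = jet U (fibre_atlas \<xi>') n x s"
      by (rule jet_eqI[OF same_jet_germ[OF U V(1,2)]]) (simp add: V(3))
    finally show "K (jet U (fibre_atlas \<xi>') n x s) = k" .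
  qed
  have "\<phi> ` \<Sigma> \<in> PDE_class U n K k UNIV"
    if \<phi>: "contact_transformation J2_points \<phi>" "\<phi> ` J2_points = J2_points"
      and \<Sigma>: "\<Sigma> \<in> PDE_class U n K k UNIV" for \<phi> \<Sigma>
  proof -
    have sub: "\<Sigma> \<subseteq> J2_points" "fst ` \<Sigma> = UNIV"
      using \<Sigma> by (auto simp: PDE_class_def is_PDE_over_def)
    \<comment> \<open>The point found over \<xi>' may come from a point off \<Sigma>, but \<Sigma>
      meets the fibre of that point, and the whole fibre goes into one fibre.\<close>
    have "\<xi>' \<in> fst ` \<phi> ` \<Sigma>" for \<xi>'
    proof -
      have "(\<xi>', lagr_plane (std_frame \<xi>') 0) \<in> J2_points"
        using contact.lagr_plane_in_LG[OF conf_sympl_basis_std_frame] by (simp add: J2_points_def)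
      then obtain P where P: "P \<in> J2_points" "fst (\<phi> P) = \<xi>'"
        using \<phi>(2) by (metis fst_conv imageE)
      obtain Q where Q: "Q \<in> \<Sigma>" "fst Q = fst P"
        using sub(2) by (metis UNIV_I imageE)
      have "fst (\<phi> Q) = \<xi>'"
        using fst_image_fibre_const[OF \<phi>(1) _ P(1) Q(2)] Q(1) sub(1) P(2) by blast
      then show ?thesis using Q(1) by blast
    qed
    then have "fst ` \<phi> ` \<Sigma> = UNIV" by blast
    then show ?thesis
      using loc[OF \<phi>(1) \<Sigma>] sub(1) by (simp add: inf.absorb1)
  qed
  then show ?thesis
    unfolding contact_invariant_class_def using loc by blast
qed

theorem theorem2p7:
  fixes U :: "('u, real^2) chart set"
    and \<kappa> :: "('u, (real^4) set) jet \<Rightarrow> real"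
    and n :: nat
  assumes "is_manifold U"
    and "connected_space (atlas_topology U)"
    and "CSp_invariant U n \<kappa>"
  shows "(\<exists>!K. K \<in> extensional (JJ U n) \<and> induced_by U n \<kappa> K) \<and>
    (\<forall>K. induced_by U n \<kappa> K \<longrightarrow>
       contact_invariant U n K \<and> (\<forall>c. contact_invariant_class (PDE_class U n K c)))"
proof -
  have U: "smooth_atlas U"
    using assms(1) by (simp add: is_manifold_def)
  show ?thesis
    using ex1_induced_function[OF U assms(3)] contact_invariant_induced[OF U]
      contact_invariant_class_induced[OF U] by blast
qed

end
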